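(* Let $\theta\in\mathbb{R}$ and let $I$ be the two-sided $*$-ideal in the Hopf algebra $\mathcal{A}(\mathrm{SL}_\theta(2,\mathbb{H}))$ generated by the elements $\sum_k (A_{ki})^*A_{kj}-\delta_{ij}$, $i,j=1,\dots,4$. Then the quotient $\mathcal{A}(\mathrm{Sp}_\theta(2)):=\mathcal{A}(\mathrm{SL}_\theta(2,\mathbb{H}))/I$ is a Hopf algebra with the induced Hopf algebra structure (coproduct induced by $(\pi\otimes\pi)\circ\Delta$, counit induced by $\epsilon$, antipode induced by $\pi\circ S$, where $\pi$ is the quotient map).
   Context: Let $\theta\in\mathbb{R}$, $\mu=e^{\pi \mathrm{i}\theta}$, and let $\eta=(\eta_{ij})$ be $$\eta=\begin{pmatrix}1&1&\bar\mu&\mu\\1&1&\mu&\bar\mu\\ \mu&\bar\mu&1&1\\ \bar\mu&\mu&1&1\end{pmatrix}.$$ $\mathcal{A}(M_\theta(2,\mathbb{H}))$ is the unital complex $*$-algebra generated by the entries of $$A_\theta=(A_{ij})=\begin{pmatrix}a_1&a_2&b_1&b_2\\-a_2^*&a_1^*&-b_2^*&b_1^*\\c_1&c_2&d_1&d_2\\-c_2^*&c_1^*&-d_2^*&d_1^*\end{pmatrix}$$ with relations $A_{ij}A_{kl}=\eta_{ki}\eta_{jl}A_{kl}A_{ij}$ for all $i,j,k,l$. The determinant is $\det(A_\theta)=\sum_{\sigma\in S_4}(-1)^{|\sigma|}\varepsilon^{\sigma(1)\sigma(2)\sigma(3)\sigma(4)}A_{1,\sigma(1)}A_{2,\sigma(2)}A_{3,\sigma(3)}A_{4,\sigma(4)}$,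 where $\varepsilon^{ijkl}=\mu$ if $(i,j,k,l)$ is $(1,3,2,4)$ or one of its cyclic rotations, $\varepsilon^{ijkl}=\bar\mu$ if it is $(1,4,2,3)$ or one of its cyclic rotations, and $\varepsilon^{ijkl}=1$ for all other permutations. It is central, and $\mathcal{A}(\mathrm{SL}_\theta(2,\mathbb{H}))$ is the quotient of $\mathcal{A}(M_\theta(2,\mathbb{H}))$ by the two-sided ideal generated by $\det(A_\theta)-1$. $\mathcal{A}(\mathrm{SL}_\theta(2,\mathbb{H}))$ is a Hopf algebra with $\Delta(A_{ij})=\sum_k A_{ik}\otimes A_{kj}$, $\epsilon(A_{ij})=\delta_{ij}$ and $S(A_{ij})=(-1)^{i+j}\hat A_{ji}$, where $$\hat A_{il}=\sum_{\sigma\in S_3}(-1)^{|\sigma|}\,\varepsilon^{\sigma_1\dots\sigma_{i-1}\,l\,\sigma_{i+1}\dots\sigma_4}\,\eta_{\sigma_1 l}\cdots\eta_{\sigma_{i-1}l}\;A_{1,\sigma_1}\cdots A_{i-1,\sigma_{i-1}}A_{i+1,\sigma_{i+1}}\cdots A_{4,\sigma_4},$$ with $(\sigma_1,\dots,\sigma_{i-1},\sigma_{i+1},\dots,\sigma_4)$ running over the permutations $\sigma$ of the three elements $(1,\dots,l-1,l+1,\dots,4)$. *)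

theory Defs
  imports
    "HOL-Algebra.Algebraic_Closure_Type"
    "HOL-Library.Poly_Mapping"
begin

section \<open>Complex algebras\<close>

abbreviation complex_ring :: "complex ring" where
  "complex_ring \<equiv> ring_of_type_algebra"

text \<open>The locale \<^locale>\<open>algebra\<close> of HOL-Algebra demands commutativity, so it cannot be used here.\<close>

locale complex_algebra = Module.module complex_ring A + ring A for A (structure) +
  assumes smult_mult_left:
      "\<lbrakk>x \<in> carrier A; y \<in> carrier A\<rbrakk> \<Longrightarrow> (c \<odot> x) \<otimes> y = c \<odot> (x \<otimes> y)"
    and smult_mult_right:
      "\<lbrakk>x \<in> carrier A; y \<in> carrier A\<rbrakk> \<Longrightarrow> x \<otimes> (c \<odot> y) = c \<odot> (x \<otimes> y)"

definition complex_alg :: "(complex, complex) module" where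
  "complex_alg = ring.extend complex_ring \<lparr>module.smult = (*)\<rparr>"

definition linear_hom ::
  "(complex, 'a, 'm) module_scheme \<Rightarrow> (complex, 'b, 'n) module_scheme \<Rightarrow> ('a \<Rightarrow> 'b) set" where
  "linear_hom A B = {f \<in> carrier A \<rightarrow> carrier B.
     (\<forall>x\<in>carrier A. \<forall>y\<in>carrier A. f (x \<oplus>\<^bsub>A\<^esub> y) = f x \<oplus>\<^bsub>B\<^esub> f y) \<and>
     (\<forall>c. \<forall>x\<in>carrier A. f (c \<odot>\<^bsub>A\<^esub> x) = c \<odot>\<^bsub>B\<^esub> f x)}"

definition alg_hom ::
  "(complex, 'a, 'm) module_scheme \<Rightarrow> (complex, 'b, 'n) module_scheme \<Rightarrow> ('a \<Rightarrow> 'b) set" where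
  "alg_hom A B = ring_hom A B \<inter> linear_hom A B"

definition alg_antihom ::
  "(complex, 'a, 'm) module_scheme \<Rightarrow> (complex, 'b, 'n) module_scheme \<Rightarrow> ('a \<Rightarrow> 'b) set" where
  "alg_antihom A B = {f \<in> linear_hom A B. f \<one>\<^bsub>A\<^esub> = \<one>\<^bsub>B\<^esub> \<and>
     (\<forall>x\<in>carrier A. \<forall>y\<in>carrier A. f (x \<otimes>\<^bsub>A\<^esub> y) = f y \<otimes>\<^bsub>B\<^esub> f x)}"

definition quot_algebra ::
  "(complex, 'a, 'm) module_scheme \<Rightarrow> 'a set \<Rightarrow> (complex, 'a set) module" where
  "quot_algebra A I =
     ring.extend (A Quot I) \<lparr>module.smult = (\<lambda>c Y. \<Union>x\<in>Y. I +>\<^bsub>A\<^esub> (c \<odot>\<^bsub>A\<^esub> x))\<rparr>"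

definition linear_span :: "(complex, 'a, 'm) module_scheme \<Rightarrow> 'a set \<Rightarrow> 'a set" where
  "linear_span A S = \<Inter>{J. submodule J complex_ring A \<and> S \<subseteq> J}"

text \<open>The monoid algebra $\mathbb{C}[G]$: finitely supported functions on $G$ with convolution.\<close>

definition monoid_algebra :: "('g, 'm) monoid_scheme \<Rightarrow> (complex, 'g \<Rightarrow>\<^sub>0 complex) module" where
  "monoid_algebra G =
     \<lparr>carrier = {p. Poly_Mapping.keys p \<subseteq> carrier G},
      monoid.mult = (\<lambda>p q. \<Sum>g\<in>Poly_Mapping.keys p. \<Sum>h\<in>Poly_Mapping.keys q.
        Poly_Mapping.single (g \<otimes>\<^bsub>G\<^esub> h) (Poly_Mapping.lookup p g * Poly_Mapping.lookup q h)),
      one = Poly_Mapping.single \<one>\<^bsub>G\<^esub> 1,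
      zero = 0,
      add = (+),
      module.smult = (\<lambda>c. Poly_Mapping.map ((*) c))\<rparr>"


section \<open>Tensor products of algebras\<close>

text \<open>
  $A \otimes B$ is the free vector space on the set $A \times B$ modulo the span of the bilinearity
  relations. Realising the free vector space as the monoid algebra of the multiplicative monoid
  $A \times B$ makes $(x \otimes y)(x' \otimes y') = xx' \otimes yy'$ the product of the quotient.
\<close>

definition tensor_relations ::
  "(complex, 'a, 'm) module_scheme \<Rightarrow> (complex, 'b, 'n) module_scheme \<Rightarrow> ('a \<times> 'b \<Rightarrow>\<^sub>0 complex) set"
where
  "tensor_relations A B =
     {Poly_Mapping.single (x \<oplus>\<^bsub>A\<^esub> x', y) 1 - Poly_Mapping.single (x, y) 1
        - Poly_Mapping.single (x', y) 1 | x x' y.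
        x \<in> carrier A \<and> x' \<in> carrier A \<and> y \<in> carrier B} \<union>
     {Poly_Mapping.single (x, y \<oplus>\<^bsub>B\<^esub> y') 1 - Poly_Mapping.single (x, y) 1
        - Poly_Mapping.single (x, y') 1 | x y y'.
        x \<in> carrier A \<and> y \<in> carrier B \<and> y' \<in> carrier B} \<union>
     {Poly_Mapping.single (c \<odot>\<^bsub>A\<^esub> x, y) 1 - Poly_Mapping.single (x, y) c | c x y.
        x \<in> carrier A \<and> y \<in> carrier B} \<union>
     {Poly_Mapping.single (x, c \<odot>\<^bsub>B\<^esub> y) 1 - Poly_Mapping.single (x, y) c | c x y.
        x \<in> carrier A \<and> y \<in> carrier B}"

definition tensor_null ::
  "(complex, 'a, 'm) module_scheme \<Rightarrow> (complex, 'b, 'n) module_scheme \<Rightarrow> ('a \<times> 'b \<Rightarrow>\<^sub>0 complex) set"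
where
  "tensor_null A B = linear_span (monoid_algebra (A \<times>\<times> B)) (tensor_relations A B)"

definition tensor ::
  "(complex, 'a, 'm) module_scheme \<Rightarrow> (complex, 'b, 'n) module_scheme \<Rightarrow>
   (complex, ('a \<times> 'b \<Rightarrow>\<^sub>0 complex) set) module"
where
  "tensor A B = quot_algebra (monoid_algebra (A \<times>\<times> B)) (tensor_null A B)"

definition pure_tensor ::
  "(complex, 'a, 'm) module_scheme \<Rightarrow> (complex, 'b, 'n) module_scheme \<Rightarrow> 'a \<Rightarrow> 'b \<Rightarrow>
   ('a \<times> 'b \<Rightarrow>\<^sub>0 complex) set"
where
  "pure_tensor A B x y =
     tensor_null A B +>\<^bsub>monoid_algebra (A \<times>\<times> B)\<^esub> Poly_Mapping.single (x, y) 1"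

text \<open>
  The linear map out of $A \otimes B$ induced by a bilinear map \<open>\<beta>\<close> into \<open>W\<close>. Elements of the tensor
  product are cosets, and for bilinear \<open>\<beta>\<close> the linear extension of \<open>\<beta>\<close> is constant on each of them.
\<close>

definition tensor_lift ::
  "(complex, 'w, 'k) module_scheme \<Rightarrow> ('a \<Rightarrow> 'b \<Rightarrow> 'w) \<Rightarrow> ('a \<times> 'b \<Rightarrow>\<^sub>0 complex) set \<Rightarrow> 'w"
where
  "tensor_lift W \<beta> t = the_elem
     ((\<lambda>p. \<Oplus>\<^bsub>W\<^esub>u\<in>Poly_Mapping.keys p. Poly_Mapping.lookup p u \<odot>\<^bsub>W\<^esub> \<beta> (fst u) (snd u)) ` t)"

text \<open>\<open>f \<otimes> g\<close> with values in \<open>C \<otimes> D\<close>.\<close>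

definition tensor_map ::
  "(complex, 'c, 'm) module_scheme \<Rightarrow> (complex, 'd, 'n) module_scheme \<Rightarrow> ('a \<Rightarrow> 'c) \<Rightarrow> ('b \<Rightarrow> 'd) \<Rightarrow>
   ('a \<times> 'b \<Rightarrow>\<^sub>0 complex) set \<Rightarrow> ('c \<times> 'd \<Rightarrow>\<^sub>0 complex) set"
where
  "tensor_map C D f g = tensor_lift (tensor C D) (\<lambda>x y. pure_tensor C D (f x) (g y))"

text \<open>The canonical map $(A \otimes A) \otimes A \to A \otimes (A \otimes A)$.\<close>

definition tensor_assoc ::
  "(complex, 'a, 'm) module_scheme \<Rightarrow>
   (('a \<times> 'a \<Rightarrow>\<^sub>0 complex) set \<times> 'a \<Rightarrow>\<^sub>0 complex) set \<Rightarrow>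
   ('a \<times> ('a \<times> 'a \<Rightarrow>\<^sub>0 complex) set \<Rightarrow>\<^sub>0 complex) set"
where
  "tensor_assoc A =
     tensor_lift (tensor A (tensor A A)) (\<lambda>t z.
       tensor_lift (tensor A (tensor A A)) (\<lambda>x y.
         pure_tensor A (tensor A A) x (pure_tensor A A y z)) t)"


section \<open>Hopf algebras\<close>

locale hopf_algebra = complex_algebra A for A (structure) +
  fixes \<Delta> :: "'a \<Rightarrow> ('a \<times> 'a \<Rightarrow>\<^sub>0 complex) set" and \<epsilon> :: "'a \<Rightarrow> complex" and S :: "'a \<Rightarrow> 'a"
  assumes comult_hom: "\<Delta> \<in> alg_hom A (tensor A A)"
    and counit_hom: "\<epsilon> \<in> alg_hom A complex_alg"
    and antipode_linear: "S \<in> linear_hom A A"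
    and coassoc: "x \<in> carrier A \<Longrightarrow>
      tensor_assoc A (tensor_map (tensor A A) A \<Delta> (\<lambda>y. y) (\<Delta> x))
        = tensor_map A (tensor A A) (\<lambda>y. y) \<Delta> (\<Delta> x)"
    and counit_left: "x \<in> carrier A \<Longrightarrow> tensor_lift A (\<lambda>y z. \<epsilon> y \<odot> z) (\<Delta> x) = x"
    and counit_right: "x \<in> carrier A \<Longrightarrow> tensor_lift A (\<lambda>y z. \<epsilon> z \<odot> y) (\<Delta> x) = x"
    and antipode_left: "x \<in> carrier A \<Longrightarrow> tensor_lift A (\<lambda>y z. S y \<otimes> z) (\<Delta> x) = \<epsilon> x \<odot> \<one>"
    and antipode_right: "x \<in> carrier A \<Longrightarrow> tensor_lift A (\<lambda>y z. y \<otimes> S z) (\<Delta> x) = \<epsilon> x \<odot> \<one>"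


section \<open>Star algebras\<close>

record 'a star_algebra = "(complex, 'a) module" +
  star :: "'a \<Rightarrow> 'a"

definition star_ideal :: "('a, 'm) star_algebra_scheme \<Rightarrow> 'a set \<Rightarrow> 'a set" where
  "star_ideal A G = \<Inter>{J. ideal J A \<and> star A ` J \<subseteq> J \<and> G \<subseteq> J}"

definition quot_star_algebra :: "('a, 'm) star_algebra_scheme \<Rightarrow> 'a set \<Rightarrow> 'a set star_algebra" where
  "quot_star_algebra A I =
     module.extend (quot_algebra A I) \<lparr>star = (\<lambda>Y. \<Union>x\<in>Y. I +>\<^bsub>A\<^esub> star A x)\<rparr>"

text \<open>
  The free unital $*$-algebra on the type \<open>'g\<close>: noncommutative polynomials in the letters $g$ and
  $g^*$, encoded as \<open>(g, False)\<close> and \<open>(g, True)\<close>.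
\<close>

definition free_star_algebra :: "(('g \<times> bool) list \<Rightarrow>\<^sub>0 complex) star_algebra" where
  "free_star_algebra =
     module.extend (monoid_algebra \<lparr>carrier = UNIV, monoid.mult = (@), one = []\<rparr>)
       \<lparr>star = (\<lambda>p. \<Sum>w\<in>Poly_Mapping.keys p.
          Poly_Mapping.single (rev (map (apsnd Not) w)) (cnj (Poly_Mapping.lookup p w)))\<rparr>"

definition free_gen :: "'g \<Rightarrow> (('g \<times> bool) list \<Rightarrow>\<^sub>0 complex)" where
  "free_gen g = Poly_Mapping.single [(g, False)] 1"


section \<open>The quaternionic matrix algebras\<close>

text \<open>Matrix indices are natural numbers in \<open>{1..4}\<close> throughout.\<close>

definition \<mu> :: "real \<Rightarrow> complex" where
  "\<mu> \<theta> = exp (of_real pi * \<i> * of_real \<theta>)"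

definition \<eta> :: "real \<Rightarrow> nat \<Rightarrow> nat \<Rightarrow> complex" where
  "\<eta> \<theta> i j =
     [[1, 1, cnj (\<mu> \<theta>), \<mu> \<theta>],
      [1, 1, \<mu> \<theta>, cnj (\<mu> \<theta>)],
      [\<mu> \<theta>, cnj (\<mu> \<theta>), 1, 1],
      [cnj (\<mu> \<theta>), \<mu> \<theta>, 1, 1]] ! (i - 1) ! (j - 1)"

text \<open>The coefficient $\varepsilon^{ijkl}$, indexed by the list \<open>[i, j, k, l]\<close>.\<close>

definition eps :: "real \<Rightarrow> nat list \<Rightarrow> complex" where
  "eps \<theta> s = (if \<exists>n. s = rotate n [1, 3, 2, 4] then \<mu> \<theta>
              else if \<exists>n. s = rotate n [1, 4, 2, 3] then cnj (\<mu> \<theta>) else 1)"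

datatype gen = a\<^sub>1 | a\<^sub>2 | b\<^sub>1 | b\<^sub>2 | c\<^sub>1 | c\<^sub>2 | d\<^sub>1 | d\<^sub>2

type_synonym free_elem = "(gen \<times> bool) list \<Rightarrow>\<^sub>0 complex"

definition free_mat :: "nat \<Rightarrow> nat \<Rightarrow> free_elem" where
  "free_mat i j =
     (let F = free_star_algebra; x = free_gen; y = (\<lambda>g. star F (free_gen g)) in
      [[x a\<^sub>1, x a\<^sub>2, x b\<^sub>1, x b\<^sub>2],
       [\<ominus>\<^bsub>F\<^esub> y a\<^sub>2, y a\<^sub>1, \<ominus>\<^bsub>F\<^esub> y b\<^sub>2, y b\<^sub>1],
       [x c\<^sub>1, x c\<^sub>2, x d\<^sub>1, x d\<^sub>2],
       [\<ominus>\<^bsub>F\<^esub> y c\<^sub>2, y c\<^sub>1, \<ominus>\<^bsub>F\<^esub> y d\<^sub>2, y d\<^sub>1]] ! (i - 1) ! (j - 1))"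

definition M_ideal :: "real \<Rightarrow> free_elem set" where
  "M_ideal \<theta> = star_ideal free_star_algebra
     {free_mat i j \<otimes>\<^bsub>F\<^esub> free_mat k l \<ominus>\<^bsub>F\<^esub>
        (\<eta> \<theta> k i * \<eta> \<theta> j l) \<odot>\<^bsub>F\<^esub> (free_mat k l \<otimes>\<^bsub>F\<^esub> free_mat i j) | F i j k l.
      F = free_star_algebra \<and> i \<in> {1..4} \<and> j \<in> {1..4} \<and> k \<in> {1..4} \<and> l \<in> {1..4}}"

definition M_alg :: "real \<Rightarrow> free_elem set star_algebra" where
  "M_alg \<theta> = quot_star_algebra free_star_algebra (M_ideal \<theta>)"

definition M_mat :: "real \<Rightarrow> nat \<Rightarrow> nat \<Rightarrow> free_elem set" where
  "M_mat \<theta> i j = M_ideal \<theta> +>\<^bsub>free_star_algebra\<^esub> free_mat i j"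

definition M_det :: "real \<Rightarrow> free_elem set" where
  "M_det \<theta> =
     (\<Oplus>\<^bsub>M_alg \<theta>\<^esub>\<sigma>\<in>{\<sigma>. \<sigma> permutes {1..4}}.
        (of_int (sign \<sigma>) * eps \<theta> [\<sigma> 1, \<sigma> 2, \<sigma> 3, \<sigma> 4]) \<odot>\<^bsub>M_alg \<theta>\<^esub>
          (M_mat \<theta> 1 (\<sigma> 1) \<otimes>\<^bsub>M_alg \<theta>\<^esub> M_mat \<theta> 2 (\<sigma> 2) \<otimes>\<^bsub>M_alg \<theta>\<^esub>
           M_mat \<theta> 3 (\<sigma> 3) \<otimes>\<^bsub>M_alg \<theta>\<^esub> M_mat \<theta> 4 (\<sigma> 4)))"

definition SL_ideal :: "real \<Rightarrow> free_elem set set" where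
  "SL_ideal \<theta> = Idl\<^bsub>M_alg \<theta>\<^esub> {M_det \<theta> \<ominus>\<^bsub>M_alg \<theta>\<^esub> \<one>\<^bsub>M_alg \<theta>\<^esub>}"

definition SL_alg :: "real \<Rightarrow> free_elem set set star_algebra" where
  "SL_alg \<theta> = quot_star_algebra (M_alg \<theta>) (SL_ideal \<theta>)"

definition SL_mat :: "real \<Rightarrow> nat \<Rightarrow> nat \<Rightarrow> free_elem set set" where
  "SL_mat \<theta> i j = SL_ideal \<theta> +>\<^bsub>M_alg \<theta>\<^esub> M_mat \<theta> i j"

text \<open>
  The element $\hat A_{il}$. The list \<open>s\<close> is $(\sigma_1,\dots,\sigma_{i-1},\sigma_{i+1},\dots,\sigma_4)$,
  the image under $\sigma$ of the three column indices different from $l$ in increasing order.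
\<close>

definition SL_hat :: "real \<Rightarrow> nat \<Rightarrow> nat \<Rightarrow> free_elem set set" where
  "SL_hat \<theta> i l =
     (\<Oplus>\<^bsub>SL_alg \<theta>\<^esub>\<sigma>\<in>{\<sigma>. \<sigma> permutes ({1..4} - {l})}.
        let s = map \<sigma> (remove1 l [1, 2, 3, 4]); r = remove1 i [1, 2, 3, 4] in
        (of_int (sign \<sigma>) * eps \<theta> (take (i - 1) s @ [l] @ drop (i - 1) s)
           * (\<Prod>k\<leftarrow>take (i - 1) s. \<eta> \<theta> k l)) \<odot>\<^bsub>SL_alg \<theta>\<^esub>
          (SL_mat \<theta> (r ! 0) (s ! 0) \<otimes>\<^bsub>SL_alg \<theta>\<^esub> SL_mat \<theta> (r ! 1) (s ! 1) \<otimes>\<^bsub>SL_alg \<theta>\<^esub>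
           SL_mat \<theta> (r ! 2) (s ! 2)))"

text \<open>
  The structure maps are specified by their values on the generators $A_{ij}$, which determine them
  on the carrier because the $A_{ij}$ generate the algebra. Outside the carrier the choice is
  immaterial.
\<close>

definition SL_comult ::
  "real \<Rightarrow> free_elem set set \<Rightarrow> (free_elem set set \<times> free_elem set set \<Rightarrow>\<^sub>0 complex) set" where
  "SL_comult \<theta> = (SOME \<Delta>. \<Delta> \<in> alg_hom (SL_alg \<theta>) (tensor (SL_alg \<theta>) (SL_alg \<theta>)) \<and>
     (\<forall>i\<in>{1..4}. \<forall>j\<in>{1..4}. \<Delta> (SL_mat \<theta> i j) =
        (\<Oplus>\<^bsub>tensor (SL_alg \<theta>) (SL_alg \<theta>)\<^esub>k\<in>{1..4}.
           pure_tensor (SL_alg \<theta>) (SL_alg \<theta>) (SL_mat \<theta> i k) (SL_mat \<theta> k j))))"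

definition SL_counit :: "real \<Rightarrow> free_elem set set \<Rightarrow> complex" where
  "SL_counit \<theta> = (SOME \<epsilon>. \<epsilon> \<in> alg_hom (SL_alg \<theta>) complex_alg \<and>
     (\<forall>i\<in>{1..4}. \<forall>j\<in>{1..4}. \<epsilon> (SL_mat \<theta> i j) = (if i = j then 1 else 0)))"

definition SL_antipode :: "real \<Rightarrow> free_elem set set \<Rightarrow> free_elem set set" where
  "SL_antipode \<theta> = (SOME S. S \<in> alg_antihom (SL_alg \<theta>) (SL_alg \<theta>) \<and>
     (\<forall>i\<in>{1..4}. \<forall>j\<in>{1..4}. S (SL_mat \<theta> i j) = (-1) ^ (i + j) \<odot>\<^bsub>SL_alg \<theta>\<^esub> SL_hat \<theta> j i))"

definition Sp_ideal :: "real \<Rightarrow> free_elem set set set" where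
  "Sp_ideal \<theta> = star_ideal (SL_alg \<theta>)
     {(\<Oplus>\<^bsub>SL_alg \<theta>\<^esub>k\<in>{1..4}. star (SL_alg \<theta>) (SL_mat \<theta> k i) \<otimes>\<^bsub>SL_alg \<theta>\<^esub> SL_mat \<theta> k j)
        \<ominus>\<^bsub>SL_alg \<theta>\<^esub> (if i = j then \<one>\<^bsub>SL_alg \<theta>\<^esub> else \<zero>\<^bsub>SL_alg \<theta>\<^esub>) | i j.
      i \<in> {1..4} \<and> j \<in> {1..4}}"

definition Sp_alg :: "real \<Rightarrow> free_elem set set set star_algebra" where
  "Sp_alg \<theta> = quot_star_algebra (SL_alg \<theta>) (Sp_ideal \<theta>)"

definition Sp_proj :: "real \<Rightarrow> free_elem set set \<Rightarrow> free_elem set set set" where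
  "Sp_proj \<theta> x = Sp_ideal \<theta> +>\<^bsub>SL_alg \<theta>\<^esub> x"

end

theory Submission
  imports Defs
begin

text \<open>
  Everything about $\mathrm{SL}_\theta$ reduces to one fact: a matrix with the twisted commutation
  relations in any algebra satisfies
  $\sum_\sigma E^\sigma A_{i\sigma_1}A_{j\sigma_2}A_{k\sigma_3}A_{l\sigma_4} = E^{ijkl}\det A$
  for all row indices, where $E = (-1)^{|\cdot|}\varepsilon$. It gives the multiplicativity of the
  determinant (hence the coproduct) and the inverse matrix of signed minors. If $A$ has the inverse
  $C$, then $C$ satisfies the opposite relations, and contracting $C_{4s}C_{3r}C_{2q}C_{1p}$ with the
  displayed identity shows that it has opposite determinant $1$; this gives the antipode.

  As $A_{ij}^* = (-1)^{i+j}A_{i'j'}$ for the involution $i \mapsto i'$ exchanging $1,2$ and $3,4$, the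
  relations $A^\dagger A = 1$ are polynomial in the entries, their $*$-ideal is the ideal they
  generate, and the three structure maps send them to zero in the quotient. There the antipode
  is $A \mapsto A^\dagger$, and the Hopf algebra axioms have to be checked only on the entries of $A$.
\<close>

section \<open>Complex algebras and their homomorphisms\<close>

text \<open>The structure maps on SL are specified by a choice operator, so nothing is known about
  them before maps with the prescribed values exist. Existence comes from universal properties along
  the chain free algebra, M, SL, Sp: a homomorphism out of SL is given by a matrix in the target
  with the twisted relations and determinant 1. The targets (a tensor square, the complex numbers,
  an opposite algebra) are treated as plain algebras, which is why every ideal generated with the
  star has to be recognised as an ordinary ideal. The determinant identity rests on one property of
  \<open>twisted_lc\<close>: exchanging neighbouring indices costs exactly the factor \<eta> that
  commuting two entries produces. The identity expands along rows and so yields only a right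
  inverse; the left inverse is the right inverse of the transposed matrix over the opposite algebra,
  once row and column determinants are known to agree. The antipode axioms are not equations between
  homomorphisms. They are verified on the entries and carried over to products by a separate
  argument.\<close>

lemma complex_ring_simps [simp]:
  "carrier complex_ring = UNIV"
  "x \<oplus>\<^bsub>complex_ring\<^esub> y = x + y"
  "x \<otimes>\<^bsub>complex_ring\<^esub> y = x * y"
  "\<one>\<^bsub>complex_ring\<^esub> = 1"
  "\<zero>\<^bsub>complex_ring\<^esub> = 0"
  by (simp_all add: ring_of_type_algebra_def)

lemma cring_complex_ring: "cring complex_ring"
  by (rule cring_from_type_algebra)

text \<open>Additive inverses come from the scalars: \<open>(-1) \<odot> x \<oplus> x = (-1 + 1)
  \<odot> x = 0 \<odot> x = \<zero>\<close>.\<close>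

lemma complex_algebraI:
  fixes A (structure)
  assumes closed: "\<And>x y. x \<in> carrier A \<Longrightarrow> y \<in> carrier A \<Longrightarrow> x \<oplus> y \<in> carrier A"
    "\<And>x y. x \<in> carrier A \<Longrightarrow> y \<in> carrier A \<Longrightarrow> x \<otimes> y \<in> carrier A"
    "\<And>c x. x \<in> carrier A \<Longrightarrow> c \<odot> x \<in> carrier A" "\<zero> \<in> carrier A" "\<one> \<in> carrier A"
    and add: "\<And>x y z. x \<in> carrier A \<Longrightarrow> y \<in> carrier A \<Longrightarrow> z \<in> carrier A \<Longrightarrow>
        x \<oplus> y \<oplus> z = x \<oplus> (y \<oplus> z)"
      "\<And>x y. x \<in> carrier A \<Longrightarrow> y \<in> carrier A \<Longrightarrow> x \<oplus> y = y \<oplus> x"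
      "\<And>x. x \<in> carrier A \<Longrightarrow> \<zero> \<oplus> x = x"
    and smult: "\<And>x. x \<in> carrier A \<Longrightarrow> 0 \<odot> x = \<zero>" "\<And>x. x \<in> carrier A \<Longrightarrow> 1 \<odot> x = x"
      "\<And>c d x. x \<in> carrier A \<Longrightarrow> (c + d) \<odot> x = c \<odot> x \<oplus> d \<odot> x"
      "\<And>c d x. x \<in> carrier A \<Longrightarrow> (c * d) \<odot> x = c \<odot> (d \<odot> x)"
      "\<And>c x y. x \<in> carrier A \<Longrightarrow> y \<in> carrier A \<Longrightarrow> c \<odot> (x \<oplus> y) = c \<odot> x \<oplus> c \<odot> y"
    and mult: "\<And>x y z. x \<in> carrier A \<Longrightarrow> y \<in> carrier A \<Longrightarrow> z \<in> carrier A \<Longrightarrow>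
        x \<otimes> y \<otimes> z = x \<otimes> (y \<otimes> z)"
      "\<And>x. x \<in> carrier A \<Longrightarrow> \<one> \<otimes> x = x" "\<And>x. x \<in> carrier A \<Longrightarrow> x \<otimes> \<one> = x"
      "\<And>x y z. x \<in> carrier A \<Longrightarrow> y \<in> carrier A \<Longrightarrow> z \<in> carrier A \<Longrightarrow>
        (x \<oplus> y) \<otimes> z = x \<otimes> z \<oplus> y \<otimes> z"
      "\<And>x y z. x \<in> carrier A \<Longrightarrow> y \<in> carrier A \<Longrightarrow> z \<in> carrier A \<Longrightarrow>
        z \<otimes> (x \<oplus> y) = z \<otimes> x \<oplus> z \<otimes> y"
      "\<And>c x y. x \<in> carrier A \<Longrightarrow> y \<in> carrier A \<Longrightarrow> (c \<odot> x) \<otimes> y = c \<odot> (x \<otimes> y)"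
      "\<And>c x y. x \<in> carrier A \<Longrightarrow> y \<in> carrier A \<Longrightarrow> x \<otimes> (c \<odot> y) = c \<odot> (x \<otimes> y)"
  shows "complex_algebra A"
proof -
  have inv: "\<exists>y\<in>carrier A. y \<oplus> x = \<zero>" if x: "x \<in> carrier A" for x
    using smult(3)[OF x, of "-1" 1] smult(1,2)[OF x] closed(3)[OF x, of "-1"]
    by (intro bexI[of _ "(-1) \<odot> x"]) auto
  have ag: "abelian_group A"
    by (rule abelian_groupI) (use closed add inv in auto)
  have r: "ring A"
    by (rule ringI[OF ag monoidI]) (use closed mult in auto)
  have "module complex_ring A"
    by (rule moduleI[OF cring_complex_ring ag]) (use closed smult in auto)
  with r show ?thesis
    by (intro complex_algebra.intro complex_algebra_axioms.intro) (use mult in auto)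
qed

context complex_algebra
begin

lemma smult_closed' [simp, intro]: "x \<in> carrier A \<Longrightarrow> c \<odot> x \<in> carrier A"
  by simp

lemma smult_add_left: "x \<in> carrier A \<Longrightarrow> (c + d) \<odot> x = c \<odot> x \<oplus> d \<odot> x"
  using smult_l_distr[of c d x] by simp

lemma smult_add_right: "x \<in> carrier A \<Longrightarrow> y \<in> carrier A \<Longrightarrow> c \<odot> (x \<oplus> y) = c \<odot> x \<oplus> c \<odot> y"
  using smult_r_distr[of c x y] by simp

lemma smult_smult [simp]: "x \<in> carrier A \<Longrightarrow> c \<odot> (d \<odot> x) = (c * d) \<odot> x"
  using smult_assoc1[of c d x] by simp

lemma smult_1 [simp]: "x \<in> carrier A \<Longrightarrow> 1 \<odot> x = x"
  using smult_one[of x] by simp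

lemma smult_0 [simp]: "x \<in> carrier A \<Longrightarrow> 0 \<odot> x = \<zero>"
  using smult_l_null[of x] by simp

lemma smult_zero [simp]: "c \<odot> \<zero> = \<zero>"
  using smult_r_null[of c] by simp

lemma smult_mult [simp]:
  assumes "x \<in> carrier A" "y \<in> carrier A"
  shows "(c \<odot> x) \<otimes> y = c \<odot> (x \<otimes> y)" "x \<otimes> (c \<odot> y) = c \<odot> (x \<otimes> y)"
  using assms by (simp_all add: smult_mult_left smult_mult_right)

lemma minus_eq_smult: "x \<in> carrier A \<Longrightarrow> \<ominus> x = (-1) \<odot> x"
  using smult_add_left[of x "-1" 1] by (simp add: minus_equality)

lemma diff_eq_smult: "x \<in> carrier A \<Longrightarrow> y \<in> carrier A \<Longrightarrow> x \<ominus> y = x \<oplus> (-1) \<odot> y"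
  by (simp add: minus_eq minus_eq_smult)

section \<open>Finite sums in a complex algebra\<close>

lemma fsum_closed [simp]: "(\<And>i. i \<in> I \<Longrightarrow> f i \<in> carrier A) \<Longrightarrow> finsum A f I \<in> carrier A"
  by (rule finsum_closed) auto

lemma fsum_cong:
  assumes "\<And>i. i \<in> I \<Longrightarrow> g i \<in> carrier A" "\<And>i. i \<in> I \<Longrightarrow> f i = g i"
  shows "finsum A f I = finsum A g I"
  by (rule finsum_cong') (use assms in auto)

lemma fsum_add:
  assumes "\<And>i. i \<in> I \<Longrightarrow> f i \<in> carrier A" "\<And>i. i \<in> I \<Longrightarrow> g i \<in> carrier A"
  shows "finsum A (\<lambda>i. f i \<oplus> g i) I = finsum A f I \<oplus> finsum A g I"
  by (rule finsum_addf) (use assms in auto)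

lemma fsum_mult_right:
  assumes "finite I" "x \<in> carrier A" "\<And>i. i \<in> I \<Longrightarrow> f i \<in> carrier A"
  shows "x \<otimes> finsum A f I = finsum A (\<lambda>i. x \<otimes> f i) I"
  using assms by (intro finsum_rdistr) auto

lemma fsum_mult_left:
  assumes "finite I" "x \<in> carrier A" "\<And>i. i \<in> I \<Longrightarrow> f i \<in> carrier A"
  shows "finsum A f I \<otimes> x = finsum A (\<lambda>i. f i \<otimes> x) I"
  using assms by (intro finsum_ldistr) auto

lemma fsum_smult:
  assumes "\<And>i. i \<in> I \<Longrightarrow> f i \<in> carrier A" "finite I"
  shows "c \<odot> finsum A f I = finsum A (\<lambda>i. c \<odot> f i) I"
  using assms(2,1) by (induction I) (auto simp: smult_add_right Pi_def)

lemma fsum_swap: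
  assumes "finite I" "finite J" "\<And>i j. i \<in> I \<Longrightarrow> j \<in> J \<Longrightarrow> f i j \<in> carrier A"
  shows "finsum A (\<lambda>i. finsum A (f i) J) I = finsum A (\<lambda>j. finsum A (\<lambda>i. f i j) I) J"
  using assms(1,3)
proof (induction I)
  case empty
  show ?case using finsum_zero[of J] by simp
next
  case (insert i I)
  have "finsum A (\<lambda>i. finsum A (f i) J) (insert i I)
      = finsum A (f i) J \<oplus> finsum A (\<lambda>j. finsum A (\<lambda>i. f i j) I) J"
    using insert by (subst finsum_insert) auto
  also have "\<dots> = finsum A (\<lambda>j. f i j \<oplus> finsum A (\<lambda>i. f i j) I) J"
    using insert by (intro fsum_add[symmetric]) auto
  also have "\<dots> = finsum A (\<lambda>j. finsum A (\<lambda>i. f i j) (insert i I)) J"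
    using insert by (intro fsum_cong) auto
  finally show ?case .
qed

lemma fsum_delta:
  assumes "finite I" "j \<in> I" "x j \<in> carrier A"
  shows "finsum A (\<lambda>i. if i = j then x i else \<zero>) I = x j"
proof -
  have "finsum A (\<lambda>i. if i = j then x i else \<zero>) I = finsum A (\<lambda>i. if j = i then x i else \<zero>) I"
    using assms by (intro fsum_cong) auto
  also have "finsum A (\<lambda>i. if j = i then x i else \<zero>) I
      = finsum A (\<lambda>i. if j = i then (\<lambda>_. x j) i else \<zero>) I"
    using assms by (intro fsum_cong) auto
  also have "\<dots> = x j" using assms by (intro finsum_singleton) auto
  finally show ?thesis .
qed

lemma fsum_eq_single:
  assumes "finite I" "j \<in> I" "f j \<in> carrier A" "\<And>i. i \<in> I \<Longrightarrow> i \<noteq> j \<Longrightarrow> f i = \<zero>"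
  shows "finsum A f I = f j"
proof -
  have "finsum A f I = finsum A (\<lambda>i. if i = j then f i else \<zero>) I"
    using assms by (intro fsum_cong) auto
  then show ?thesis using fsum_delta[of I j f] assms by simp
qed

lemma fsum_scalars:
  assumes "finite I" "x \<in> carrier A"
  shows "finsum A (\<lambda>i. c i \<odot> x) I = (\<Sum>i\<in>I. c i) \<odot> x"
  using assms(1) by (induction I) (use assms(2) in \<open>auto simp: smult_add_left Pi_def\<close>)

text \<open>A scalar can be moved onto the unit,
  \<open>c \<odot> x = (c \<odot> \<one>) \<otimes> x\<close>, so ring ideals are subspaces and
  their quotients are again complex algebras.\<close>

lemma ideal_smult:
  assumes "ideal I A" "x \<in> I"
  shows "c \<odot> x \<in> I"
proof -
  interpret ideal I A by fact
  have "(c \<odot> \<one>) \<otimes> x \<in> I" using assms(2) by (intro I_l_closed) auto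
  then show ?thesis using Icarr[OF assms(2)] by simp
qed

end

text \<open>Carries the axioms to a record with the same algebra fields, in particular from a plain
  algebra to its extension by a star.\<close>

lemma complex_algebra_cong:
  assumes "complex_algebra A" "carrier B = carrier A" "monoid.mult B = monoid.mult A"
    "one B = one A" "zero B = zero A" "add B = add A" "module.smult B = module.smult A"
  shows "complex_algebra B"
proof -
  interpret complex_algebra A by fact
  show ?thesis
    by (rule complex_algebraI)
      (simp_all add: assms smult_add_left smult_add_right a_ac m_assoc l_distr r_distr)
qed

section \<open>Linear maps and algebra homomorphisms\<close>

lemma linear_homD:
  assumes "f \<in> linear_hom A B"
  shows "x \<in> carrier A \<Longrightarrow> f x \<in> carrier B"
    "x \<in> carrier A \<Longrightarrow> y \<in> carrier A \<Longrightarrow> f (x \<oplus>\<^bsub>A\<^esub> y) = f x \<oplus>\<^bsub>B\<^esub> f y"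
    "x \<in> carrier A \<Longrightarrow> f (c \<odot>\<^bsub>A\<^esub> x) = c \<odot>\<^bsub>B\<^esub> f x"
  using assms by (auto simp: linear_hom_def)

lemma linear_homI:
  assumes "\<And>x. x \<in> carrier A \<Longrightarrow> f x \<in> carrier B"
    "\<And>x y. x \<in> carrier A \<Longrightarrow> y \<in> carrier A \<Longrightarrow> f (x \<oplus>\<^bsub>A\<^esub> y) = f x \<oplus>\<^bsub>B\<^esub> f y"
    "\<And>c x. x \<in> carrier A \<Longrightarrow> f (c \<odot>\<^bsub>A\<^esub> x) = c \<odot>\<^bsub>B\<^esub> f x"
  shows "f \<in> linear_hom A B"
  using assms by (auto simp: linear_hom_def)

lemma alg_homD:
  assumes "f \<in> alg_hom A B"
  shows "f \<in> linear_hom A B" "f \<one>\<^bsub>A\<^esub> = \<one>\<^bsub>B\<^esub>"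
    "x \<in> carrier A \<Longrightarrow> f x \<in> carrier B"
    "x \<in> carrier A \<Longrightarrow> y \<in> carrier A \<Longrightarrow> f (x \<oplus>\<^bsub>A\<^esub> y) = f x \<oplus>\<^bsub>B\<^esub> f y"
    "x \<in> carrier A \<Longrightarrow> f (c \<odot>\<^bsub>A\<^esub> x) = c \<odot>\<^bsub>B\<^esub> f x"
    "x \<in> carrier A \<Longrightarrow> y \<in> carrier A \<Longrightarrow> f (x \<otimes>\<^bsub>A\<^esub> y) = f x \<otimes>\<^bsub>B\<^esub> f y"
  using assms linear_homD[of f A B] by (auto simp: alg_hom_def ring_hom_def)

lemma alg_homI:
  assumes "f \<in> linear_hom A B" "f \<one>\<^bsub>A\<^esub> = \<one>\<^bsub>B\<^esub>"
    "\<And>x y. x \<in> carrier A \<Longrightarrow> y \<in> carrier A \<Longrightarrow> f (x \<otimes>\<^bsub>A\<^esub> y) = f x \<otimes>\<^bsub>B\<^esub> f y"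
  shows "f \<in> alg_hom A B"
  using assms linear_homD[OF assms(1)] by (auto simp: alg_hom_def ring_hom_def)

lemma linear_hom_zero:
  assumes "complex_algebra A" "complex_algebra B" "f \<in> linear_hom A B"
  shows "f \<zero>\<^bsub>A\<^esub> = \<zero>\<^bsub>B\<^esub>"
proof -
  interpret A: complex_algebra A by fact
  interpret B: complex_algebra B by fact
  show ?thesis
    using linear_homD(3)[OF assms(3), of "\<zero>\<^bsub>A\<^esub>" 0] linear_homD(1)[OF assms(3), of "\<zero>\<^bsub>A\<^esub>"] by simp
qed

lemma linear_hom_diff:
  assumes "complex_algebra A" "complex_algebra B" "f \<in> linear_hom A B"
    "x \<in> carrier A" "y \<in> carrier A"
  shows "f (x \<ominus>\<^bsub>A\<^esub> y) = f x \<ominus>\<^bsub>B\<^esub> f y"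
proof -
  interpret A: complex_algebra A by fact
  interpret B: complex_algebra B by fact
  show ?thesis
    using linear_homD[OF assms(3)] assms(4,5)
    by (simp add: A.diff_eq_smult B.diff_eq_smult)
qed

lemma linear_hom_finsum:
  assumes "complex_algebra A" "complex_algebra B" "f \<in> linear_hom A B"
    "finite I" "\<And>i. i \<in> I \<Longrightarrow> g i \<in> carrier A"
  shows "f (finsum A g I) = finsum B (\<lambda>i. f (g i)) I"
proof -
  interpret A: complex_algebra A by fact
  interpret B: complex_algebra B by fact
  note h = linear_homD[OF assms(3)]
  show ?thesis using assms(4,5)
    by (induction I)
      (auto simp: linear_hom_zero[OF assms(1-3)] Pi_def h A.fsum_closed B.fsum_closed)
qed

lemma alg_hom_compose:
  "f \<in> alg_hom A B \<Longrightarrow> g \<in> alg_hom B C \<Longrightarrow> (\<lambda>x. g (f x)) \<in> alg_hom A C"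
  by (auto simp: alg_hom_def ring_hom_def linear_hom_def Pi_def)

lemma alg_hom_id: "(\<lambda>x. x) \<in> alg_hom A A"
  by (auto simp: alg_hom_def ring_hom_def linear_hom_def)

lemma complex_alg_simps [simp]:
  "carrier complex_alg = UNIV"
  "x \<oplus>\<^bsub>complex_alg\<^esub> y = x + y"
  "x \<otimes>\<^bsub>complex_alg\<^esub> y = x * y"
  "\<one>\<^bsub>complex_alg\<^esub> = 1"
  "\<zero>\<^bsub>complex_alg\<^esub> = 0"
  "c \<odot>\<^bsub>complex_alg\<^esub> x = c * x"
  by (simp_all add: complex_alg_def ring.defs ring_of_type_algebra_def)

lemma complex_algebra_complex_alg: "complex_algebra complex_alg"
  by (rule complex_algebraI) (simp_all add: algebra_simps)


subsection \<open>Opposite algebras\<close>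

text \<open>Turns antihomomorphisms into homomorphisms, so that the universal properties also
  produce the antipode, and turns statements about rows of a matrix into statements about
  columns.\<close>

definition op_algebra :: "(complex, 'a, 'm) module_scheme \<Rightarrow> (complex, 'a, 'm) module_scheme" where
  "op_algebra A = A\<lparr>monoid.mult := \<lambda>x y. y \<otimes>\<^bsub>A\<^esub> x\<rparr>"

lemma op_algebra_simps [simp]:
  "carrier (op_algebra A) = carrier A"
  "x \<otimes>\<^bsub>op_algebra A\<^esub> y = y \<otimes>\<^bsub>A\<^esub> x"
  "\<one>\<^bsub>op_algebra A\<^esub> = \<one>\<^bsub>A\<^esub>"
  "\<zero>\<^bsub>op_algebra A\<^esub> = \<zero>\<^bsub>A\<^esub>"
  "add (op_algebra A) = add A"
  "module.smult (op_algebra A) = module.smult A"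
  by (simp_all add: op_algebra_def)

lemma finsum_op_algebra [simp]: "finsum (op_algebra A) f I = finsum A f I"
  by (simp add: finsum_def finprod_def)

lemma complex_algebra_op:
  assumes "complex_algebra A" shows "complex_algebra (op_algebra A)"
proof -
  interpret complex_algebra A by fact
  show ?thesis
    by (rule complex_algebraI)
      (simp_all add: smult_add_left smult_add_right a_ac m_assoc l_distr r_distr)
qed

lemma alg_antihom_op: "alg_antihom A B = alg_hom A (op_algebra B)"
  by (auto simp: alg_antihom_def alg_hom_def ring_hom_def linear_hom_def Pi_def)


subsection \<open>Quotient algebras\<close>

lemma quot_algebra_simps:
  "carrier (quot_algebra A I) = a_rcosets\<^bsub>A\<^esub> I"
  "monoid.mult (quot_algebra A I) = rcoset_mult A I"
  "\<one>\<^bsub>quot_algebra A I\<^esub> = I +>\<^bsub>A\<^esub> \<one>\<^bsub>A\<^esub>"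
  "\<zero>\<^bsub>quot_algebra A I\<^esub> = I"
  "add (quot_algebra A I) = set_add A"
  "c \<odot>\<^bsub>quot_algebra A I\<^esub> Y = (\<Union>x\<in>Y. I +>\<^bsub>A\<^esub> (c \<odot>\<^bsub>A\<^esub> x))"
  by (simp_all add: quot_algebra_def ring.defs FactRing_def)

lemma carrier_quot_algebra: "carrier (quot_algebra A I) = (\<lambda>x. I +>\<^bsub>A\<^esub> x) ` carrier A"
  by (auto simp: quot_algebra_simps A_RCOSETS_def')

locale algebra_ideal = complex_algebra A + ideal I A for A (structure) and I
begin

lemma coset_eq_iff:
  assumes "x \<in> carrier A" "y \<in> carrier A"
  shows "I +> x = I +> y \<longleftrightarrow> x \<ominus> y \<in> I"
  using quotient_eq_iff_same_a_r_cos[OF ideal_axioms assms] by auto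

lemma coset_memberD:
  assumes "y \<in> I +> x" "x \<in> carrier A"
  shows "y \<in> carrier A" "y \<ominus> x \<in> I"
proof -
  show y: "y \<in> carrier A" using assms a_r_coset_subset_G[OF a_subset] by blast
  have "I +> y = I +> x" using a_repr_independence[OF assms a_subgroup] by simp
  then show "y \<ominus> x \<in> I" using coset_eq_iff y assms by blast
qed

lemma coset_smult:
  assumes "x \<in> carrier A"
  shows "c \<odot>\<^bsub>quot_algebra A I\<^esub> (I +> x) = I +> c \<odot> x"
proof -
  have "I +> c \<odot> y = I +> c \<odot> x" if "y \<in> I +> x" for y
  proof -
    note y = coset_memberD[OF that assms]
    then have "c \<odot> (y \<ominus> x) \<in> I" using ideal_smult ideal_axioms by blast
    then show ?thesis
      using y assms
      by (subst coset_eq_iff) (simp_all add: diff_eq_smult smult_add_right mult.commute)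
  qed
  moreover have "x \<in> I +> x" using a_rcos_self assms by blast
  ultimately show ?thesis unfolding quot_algebra_simps(6) by blast
qed

lemma coset_ops:
  assumes "x \<in> carrier A" "y \<in> carrier A"
  shows "(I +> x) \<oplus>\<^bsub>quot_algebra A I\<^esub> (I +> y) = I +> (x \<oplus> y)"
    "(I +> x) \<otimes>\<^bsub>quot_algebra A I\<^esub> (I +> y) = I +> (x \<otimes> y)"
  using assms by (simp_all add: quot_algebra_simps a_rcos_sum rcoset_mult_add)

lemma coset_zero: "I +> \<zero> = \<zero>\<^bsub>quot_algebra A I\<^esub>"
  by (simp add: quot_algebra_simps a_coset_add_zero[OF a_subset])

lemma complex_algebra_quot: "complex_algebra (quot_algebra A I)"
proof -
  note coset_one = quot_algebra_simps(3)[of A I]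
  show ?thesis
    by (rule complex_algebraI)
      (auto simp add: carrier_quot_algebra coset_ops coset_smult coset_zero[symmetric]
        coset_one smult_add_left smult_add_right a_ac m_assoc l_distr r_distr)
qed

lemma quot_proj_alg_hom: "(\<lambda>x. I +> x) \<in> alg_hom A (quot_algebra A I)"
  by (intro alg_homI linear_homI)
    (simp_all add: carrier_quot_algebra coset_ops coset_smult quot_algebra_simps(3))

lemma coset_eq_zero_iff: "x \<in> carrier A \<Longrightarrow> I +> x = \<zero>\<^bsub>quot_algebra A I\<^esub> \<longleftrightarrow> x \<in> I"
  unfolding coset_zero[symmetric] by (subst coset_eq_iff) (simp_all add: minus_eq)

lemma quot_factor:
  assumes "complex_algebra B" "f \<in> linear_hom A B" "\<And>x. x \<in> I \<Longrightarrow> f x = \<zero>\<^bsub>B\<^esub>"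
  obtains g where "g \<in> linear_hom (quot_algebra A I) B" "\<And>x. x \<in> carrier A \<Longrightarrow> g (I +> x) = f x"
proof -
  interpret B: complex_algebra B by fact
  note f = linear_homD[OF assms(2)]
  have wd: "f x = f y" if "x \<in> carrier A" "y \<in> carrier A" "I +> x = I +> y" for x y
  proof -
    have "x \<ominus> y \<in> I" using that coset_eq_iff by blast
    then have "f (x \<ominus> y) = \<zero>\<^bsub>B\<^esub>" by (rule assms(3))
    then have "f x \<ominus>\<^bsub>B\<^esub> f y = \<zero>\<^bsub>B\<^esub>"
      using linear_hom_diff[OF complex_algebra_axioms assms(1,2)] that by simp
    then show ?thesis using f(1) that by (metis B.r_right_minus_eq)
  qed
  \<comment> \<open>By \<open>wd\<close> the choice of the representative does not influence the
    value on a coset.\<close>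
  define g where "g Y = f (SOME x. x \<in> carrier A \<and> Y = I +> x)" for Y
  have g: "g (I +> x) = f x" if "x \<in> carrier A" for x
    unfolding g_def by (rule someI2[of _ x]) (use that wd in \<open>simp, blast\<close>)
  have "g \<in> linear_hom (quot_algebra A I) B"
    by (rule linear_homI) (auto simp: carrier_quot_algebra coset_ops coset_smult g f)
  with g that show thesis by blast
qed

lemma quot_factor_alg:
  assumes "complex_algebra B" "f \<in> alg_hom A B" "\<And>x. x \<in> I \<Longrightarrow> f x = \<zero>\<^bsub>B\<^esub>"
  obtains g where "g \<in> alg_hom (quot_algebra A I) B" "\<And>x. x \<in> carrier A \<Longrightarrow> g (I +> x) = f x"
proof -
  obtain g where g: "g \<in> linear_hom (quot_algebra A I) B" "\<And>x. x \<in> carrier A \<Longrightarrow> g (I +> x) = f x"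
    using quot_factor[OF assms(1) alg_homD(1)[OF assms(2)] assms(3)] by blast
  have "g \<in> alg_hom (quot_algebra A I) B"
    by (rule alg_homI[OF g(1)])
      (auto simp: carrier_quot_algebra coset_ops g(2) alg_homD[OF assms(2)] quot_algebra_simps(3))
  with g(2) that show thesis by blast
qed

end

text \<open>Together with minimality of a generated ideal this reduces vanishing of \<open>f\<close>
  on an ideal to vanishing on its generators.\<close>

lemma kernel_ideal:
  assumes "complex_algebra A" "complex_algebra B" "f \<in> alg_hom A B"
  shows "ideal {x \<in> carrier A. f x = \<zero>\<^bsub>B\<^esub>} A"
proof -
  interpret A: complex_algebra A by fact
  interpret B: complex_algebra B by fact
  interpret ring_hom_ring A B f
    by (intro ring_hom_ringI2 A.ring_axioms B.ring_axioms) (use assms(3) in \<open>simp add: alg_hom_def\<close>)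
  show ?thesis using kernel_is_ideal unfolding a_kernel_def' .
qed

section \<open>Monoid algebras\<close>

abbreviation single :: "'a \<Rightarrow> complex \<Rightarrow> 'a \<Rightarrow>\<^sub>0 complex" where
  "single \<equiv> Poly_Mapping.single"

abbreviation lookup :: "('a \<Rightarrow>\<^sub>0 complex) \<Rightarrow> 'a \<Rightarrow> complex" where
  "lookup \<equiv> Poly_Mapping.lookup"

abbreviation keys :: "('a \<Rightarrow>\<^sub>0 complex) \<Rightarrow> 'a set" where
  "keys \<equiv> Poly_Mapping.keys"

abbreviation scale :: "complex \<Rightarrow> ('a \<Rightarrow>\<^sub>0 complex) \<Rightarrow> 'a \<Rightarrow>\<^sub>0 complex" where
  "scale c \<equiv> Poly_Mapping.map ((*) c)"

lemma lookup_map_mult [simp]: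
  fixes c :: complex
  shows "lookup (scale c p) k = c * lookup p k"
  by (simp add: Poly_Mapping.map.rep_eq when_def)

lemma map_mult_single [simp]:
  "scale c (single g d) = single g (c * d :: complex)"
  by (rule poly_mapping_eqI) (simp add: lookup_single when_def)

lemma keys_map_mult: "keys (scale (c::complex) p) \<subseteq> keys p"
  by (auto simp: in_keys_iff)

lemma monoid_algebra_simps [simp]:
  "carrier (monoid_algebra G) = {p. keys p \<subseteq> carrier G}"
  "\<one>\<^bsub>monoid_algebra G\<^esub> = single \<one>\<^bsub>G\<^esub> 1"
  "\<zero>\<^bsub>monoid_algebra G\<^esub> = 0"
  "p \<oplus>\<^bsub>monoid_algebra G\<^esub> q = p + q"
  "c \<odot>\<^bsub>monoid_algebra G\<^esub> p = scale c p"
  by (simp_all add: monoid_algebra_def)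

text \<open>The defining sum runs over the supports, which change under addition and scaling. Over
  fixed finite supersets the product is visibly additive and homogeneous in each factor.\<close>

lemma monoid_algebra_mult_superset:
  assumes "finite S" "finite T" "keys p \<subseteq> S" "keys q \<subseteq> T"
  shows "p \<otimes>\<^bsub>monoid_algebra G\<^esub> q = (\<Sum>g\<in>S. \<Sum>h\<in>T.
    single (g \<otimes>\<^bsub>G\<^esub> h) (lookup p g * lookup q h))"
proof -
  have "(\<Sum>g\<in>S. \<Sum>h\<in>T.
      single (g \<otimes>\<^bsub>G\<^esub> h) (lookup p g * lookup q h))
    = (\<Sum>g\<in>S. \<Sum>h\<in>keys q.
      single (g \<otimes>\<^bsub>G\<^esub> h) (lookup p g * lookup q h))"
    using assms by (intro sum.cong refl sum.mono_neutral_right) (auto simp: in_keys_iff)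
  also have "\<dots> = (\<Sum>g\<in>keys p. \<Sum>h\<in>keys q.
      single (g \<otimes>\<^bsub>G\<^esub> h) (lookup p g * lookup q h))"
    using assms by (intro sum.mono_neutral_right) (auto simp: in_keys_iff)
  finally show ?thesis by (simp add: monoid_algebra_def)
qed

lemma monoid_algebra_distrib:
  "(p + p') \<otimes>\<^bsub>monoid_algebra G\<^esub> q = p \<otimes>\<^bsub>monoid_algebra G\<^esub> q + p' \<otimes>\<^bsub>monoid_algebra G\<^esub> q" (is ?l)
  "q \<otimes>\<^bsub>monoid_algebra G\<^esub> (p + p') = q \<otimes>\<^bsub>monoid_algebra G\<^esub> p + q \<otimes>\<^bsub>monoid_algebra G\<^esub> p'" (is ?r)
proof -
  let ?S = "keys p \<union> keys p'" and ?T = "keys q"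
  have k: "keys (p + p') \<subseteq> ?S" by (rule keys_add)
  have l: "r \<otimes>\<^bsub>monoid_algebra G\<^esub> q = (\<Sum>g\<in>?S. \<Sum>h\<in>?T.
    single (g \<otimes>\<^bsub>G\<^esub> h) (lookup r g * lookup q h))"
    if "keys r \<subseteq> ?S" for r
    by (rule monoid_algebra_mult_superset) (use that in auto)
  have r: "q \<otimes>\<^bsub>monoid_algebra G\<^esub> r = (\<Sum>g\<in>?T. \<Sum>h\<in>?S.
    single (g \<otimes>\<^bsub>G\<^esub> h) (lookup q g * lookup r h))"
    if "keys r \<subseteq> ?S" for r
    by (rule monoid_algebra_mult_superset) (use that in auto)
  show ?l
    by (simp add: l[OF k] l lookup_add distrib_right single_add sum.distrib)
  show ?r
    by (simp add: r[OF k] r lookup_add distrib_left single_add sum.distrib)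
qed

lemma monoid_algebra_mult_smult:
  "scale c p \<otimes>\<^bsub>monoid_algebra G\<^esub> q
    = scale c (p \<otimes>\<^bsub>monoid_algebra G\<^esub> q)" (is ?l)
  "p \<otimes>\<^bsub>monoid_algebra G\<^esub> scale c q
    = scale c (p \<otimes>\<^bsub>monoid_algebra G\<^esub> q)" (is ?r)
proof -
  let ?S = "keys p" and ?T = "keys q"
  have m: "p' \<otimes>\<^bsub>monoid_algebra G\<^esub> q' = (\<Sum>g\<in>?S. \<Sum>h\<in>?T.
    single (g \<otimes>\<^bsub>G\<^esub> h) (lookup p' g * lookup q' h))"
    if "keys p' \<subseteq> ?S" "keys q' \<subseteq> ?T" for p' q'
    by (rule monoid_algebra_mult_superset) (use that in auto)
  show ?l
    by (rule poly_mapping_eqI)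
      (simp add: m keys_map_mult lookup_sum lookup_single sum_distrib_left when_def
        if_distrib[of "(*) c"] mult.assoc cong: if_cong)
  show ?r
    by (rule poly_mapping_eqI)
      (simp add: m keys_map_mult lookup_sum lookup_single sum_distrib_left when_def
        if_distrib[of "(*) c"] mult.left_commute cong: if_cong)
qed

lemma monoid_algebra_mult_single [simp]:
  "single g c \<otimes>\<^bsub>monoid_algebra G\<^esub> single h d
    = single (g \<otimes>\<^bsub>G\<^esub> h) (c * d)"
  by (subst monoid_algebra_mult_superset[of "{g}" "{h}"]) auto

lemma poly_mapping_sum_singles:
  fixes p :: "'a \<Rightarrow>\<^sub>0 complex"
  shows
  "p = (\<Sum>g\<in>keys p. single g (lookup p g))"
  by (rule poly_mapping_eqI)
    (auto simp: lookup_sum lookup_single when_def in_keys_iff sum.delta)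

text \<open>Every element is the sum of its singles, and all partial sums keep their support inside
  \<open>S\<close>; hence the support conditions in the additive case.\<close>

lemma poly_mapping_induct [consumes 1, case_names zero single add]:
  fixes p :: "'a \<Rightarrow>\<^sub>0 complex"
  assumes "keys p \<subseteq> S" "P 0" "\<And>g c. g \<in> S \<Longrightarrow> P (single g c)"
    "\<And>p q. keys p \<subseteq> S \<Longrightarrow> keys q \<subseteq> S \<Longrightarrow> P p \<Longrightarrow> P q \<Longrightarrow> P (p + q)"
  shows "P p"
proof -
  let ?f = "\<lambda>g. single g (lookup p g)"
  have "P (sum ?f F) \<and> keys (sum ?f F) \<subseteq> S" if "finite F" "F \<subseteq> S" for F
    using that
  proof (induction F)
    case (insert g F)
    have "keys (?f g + sum ?f F) \<subseteq> S"
      by (rule order.trans[OF keys_add]) (use insert in auto)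
    with insert assms(4)[of "?f g" "sum ?f F"] assms(3)[of g] show ?case by auto
  qed (use assms(2) in simp)
  from this[of "keys p"] show ?thesis
    using assms(1) poly_mapping_sum_singles[of p] by simp
qed

text \<open>The product is additive in each argument, so associativity, closure and the unit laws
  reduce to singles, where they are the laws of \<open>G\<close>.\<close>

lemma complex_algebra_monoid_algebra:
  assumes "Group.monoid G"
  shows "complex_algebra (monoid_algebra G)"
proof -
  interpret G: Group.monoid G by fact
  let ?M = "monoid_algebra G"
  have add_keys: "keys (p + q) \<subseteq> carrier G"
    if "keys p \<subseteq> carrier G" "keys q \<subseteq> carrier G" for p q :: "'a \<Rightarrow>\<^sub>0 complex"
    using keys_add[of p q] that by blast
  have smult_keys: "keys (scale (c::complex) p) \<subseteq> carrier G"
    if "keys p \<subseteq> carrier G" for c p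
    using keys_map_mult[of c p] that by blast
  have closed: "keys (p \<otimes>\<^bsub>?M\<^esub> q) \<subseteq> carrier G"
    if "keys p \<subseteq> carrier G" "keys q \<subseteq> carrier G" for p q
    using that(1)
  proof (induction p rule: poly_mapping_induct)
    case zero
    show ?case by (simp add: monoid_algebra_def)
  next
    case (single g c)
    have zero: "single g c \<otimes>\<^bsub>?M\<^esub> 0 = 0"
      by (simp add: monoid_algebra_def)
    from that(2) show ?case
      by (induction q rule: poly_mapping_induct)
        (use single in \<open>simp_all add: zero monoid_algebra_distrib add_keys\<close>)
  next
    case (add p q')
    then show ?case by (simp add: monoid_algebra_distrib add_keys)
  qed
  have zero: "0 \<otimes>\<^bsub>?M\<^esub> q = 0" "q \<otimes>\<^bsub>?M\<^esub> 0 = 0" for q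
    by (simp_all add: monoid_algebra_def)
  have assoc: "p \<otimes>\<^bsub>?M\<^esub> q \<otimes>\<^bsub>?M\<^esub> r = p \<otimes>\<^bsub>?M\<^esub> (q \<otimes>\<^bsub>?M\<^esub> r)"
    if "keys p \<subseteq> carrier G" "keys q \<subseteq> carrier G"
      "keys r \<subseteq> carrier G" for p q r
    using that(1)
  proof (induction p rule: poly_mapping_induct)
    case (single g c)
    from that(2) show ?case
    proof (induction q rule: poly_mapping_induct)
      case (single h d)
      from that(3) show ?case
        by (induction r rule: poly_mapping_induct)
          (use single \<open>g \<in> carrier G\<close> in \<open>simp_all add: zero monoid_algebra_distrib G.m_assoc mult.assoc\<close>)
    qed (simp_all add: zero monoid_algebra_distrib)
  qed (simp_all add: zero monoid_algebra_distrib)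
  have one: "single \<one>\<^bsub>G\<^esub> 1 \<otimes>\<^bsub>?M\<^esub> p = p" "p \<otimes>\<^bsub>?M\<^esub> single \<one>\<^bsub>G\<^esub> 1 = p"
    if "keys p \<subseteq> carrier G" for p
    using that
    by (induction p rule: poly_mapping_induct) (simp_all add: zero monoid_algebra_distrib)
  have smult: "scale 0 p = 0" "scale 1 p = p"
    "scale (c + d) p = scale c p + scale d p"
    "scale (c * d) p = scale c (scale d p)"
    "scale c (p + q) = scale c p + scale c q"
    for c d :: complex and p q :: "'a \<Rightarrow>\<^sub>0 complex"
    by (rule poly_mapping_eqI; simp add: lookup_add algebra_simps)+
  show ?thesis
    by (rule complex_algebraI)
      (simp_all add: add_keys smult_keys closed smult assoc one monoid_algebra_distrib
        monoid_algebra_mult_smult algebra_simps del: Poly_Mapping.map_eq_zero_iff)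
qed

text \<open>This is the sum that \<open>tensor_lift\<close> applies to the members of a coset. With
  words in place of pairs it also provides the homomorphisms out of the free algebra.\<close>

definition linear_extension ::
  "(complex, 'w, 'k) module_scheme \<Rightarrow> ('g \<Rightarrow> 'w) \<Rightarrow> ('g \<Rightarrow>\<^sub>0 complex) \<Rightarrow> 'w" where
  "linear_extension W f p =
     (\<Oplus>\<^bsub>W\<^esub>u\<in>keys p. lookup p u \<odot>\<^bsub>W\<^esub> f u)"

lemma linear_extension_superset:
  assumes "complex_algebra W" "finite S" "keys p \<subseteq> S" "f \<in> S \<rightarrow> carrier W"
  shows "linear_extension W f p = (\<Oplus>\<^bsub>W\<^esub>u\<in>S. lookup p u \<odot>\<^bsub>W\<^esub> f u)"
proof -
  interpret W: complex_algebra W by fact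
  show ?thesis unfolding linear_extension_def
    by (rule W.add.finprod_mono_neutral_cong_left)
      (use assms(2-4) in \<open>auto simp: in_keys_iff Pi_def\<close>)
qed

lemma linear_extension_single:
  assumes "complex_algebra W" "f g \<in> carrier W"
  shows "linear_extension W f (single g c) = c \<odot>\<^bsub>W\<^esub> f g"
proof -
  interpret W: complex_algebra W by fact
  show ?thesis using assms by (subst linear_extension_superset[of _ "{g}"]) auto
qed

lemma linear_extension_linear:
  assumes "complex_algebra W" "f \<in> carrier G \<rightarrow> carrier W"
  shows "linear_extension W f \<in> linear_hom (monoid_algebra G) W"
proof -
  interpret W: complex_algebra W by fact
  show ?thesis
  proof (rule linear_homI)
    fix p q assume pq: "p \<in> carrier (monoid_algebra G)" "q \<in> carrier (monoid_algebra G)"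
    let ?S = "keys p \<union> keys q"
    have f: "f u \<in> carrier W" if "u \<in> ?S" for u using assms(2) pq that by auto
    have e: "linear_extension W f r = (\<Oplus>\<^bsub>W\<^esub>u\<in>?S. lookup r u \<odot>\<^bsub>W\<^esub> f u)"
      if "keys r \<subseteq> ?S" for r
      by (rule linear_extension_superset) (use that f assms in auto)
    show "linear_extension W f (p \<oplus>\<^bsub>monoid_algebra G\<^esub> q)
        = linear_extension W f p \<oplus>\<^bsub>W\<^esub> linear_extension W f q"
      using f by (simp add: e keys_add lookup_add W.smult_add_left W.fsum_add cong: W.finsum_cong)
  next
    fix c p assume p: "p \<in> carrier (monoid_algebra G)"
    let ?S = "keys p"
    have f: "f u \<in> carrier W" if "u \<in> ?S" for u using assms(2) p that by auto
    have e: "linear_extension W f r = (\<Oplus>\<^bsub>W\<^esub>u\<in>?S. lookup r u \<odot>\<^bsub>W\<^esub> f u)"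
      if "keys r \<subseteq> ?S" for r
      by (rule linear_extension_superset) (use that f assms in auto)
    show "linear_extension W f (c \<odot>\<^bsub>monoid_algebra G\<^esub> p) = c \<odot>\<^bsub>W\<^esub> linear_extension W f p"
      using f by (simp add: e keys_map_mult W.fsum_smult cong: W.finsum_cong)
    show "linear_extension W f p \<in> carrier W"
      using f by (simp add: e)
  qed
qed

lemma linear_extension_alg_hom:
  assumes "complex_algebra W" "Group.monoid G" "f \<in> carrier G \<rightarrow> carrier W" "f \<one>\<^bsub>G\<^esub> = \<one>\<^bsub>W\<^esub>"
    "\<And>g h. g \<in> carrier G \<Longrightarrow> h \<in> carrier G \<Longrightarrow> f (g \<otimes>\<^bsub>G\<^esub> h) = f g \<otimes>\<^bsub>W\<^esub> f h"
  shows "linear_extension W f \<in> alg_hom (monoid_algebra G) W"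
proof -
  interpret W: complex_algebra W by fact
  interpret G: Group.monoid G by fact
  let ?M = "monoid_algebra G" and ?L = "linear_extension W f"
  interpret M: complex_algebra ?M using complex_algebra_monoid_algebra assms(2) .
  have L: "?L \<in> linear_hom ?M W" using linear_extension_linear assms by blast
  note LD = linear_homD[OF L]
  have zero: "?L 0 = \<zero>\<^bsub>W\<^esub>" by (simp add: linear_extension_def)
  have ladd: "?L (p + q) = ?L p \<oplus>\<^bsub>W\<^esub> ?L q"
    if "keys p \<subseteq> carrier G" "keys q \<subseteq> carrier G" for p q
    using LD(2)[of p q] that by simp
  have closed: "?L p \<in> carrier W" if "keys p \<subseteq> carrier G" for p
    using LD(1)[of p] that by simp
  have mclosed: "keys (p \<otimes>\<^bsub>?M\<^esub> q) \<subseteq> carrier G"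
    if "keys p \<subseteq> carrier G" "keys q \<subseteq> carrier G" for p q
    using M.m_closed[of p q] that by simp
  have sclosed: "keys (single g c) \<subseteq> carrier G"
    if "g \<in> carrier G" for g and c :: complex
    using that by simp
  have f: "f g \<in> carrier W" if "g \<in> carrier G" for g using assms(3) that by auto
  have lsingle: "?L (single g c) = c \<odot>\<^bsub>W\<^esub> f g" if "g \<in> carrier G" for g c
    using linear_extension_single[OF assms(1), of f g c] f that by simp
  have mzero: "0 \<otimes>\<^bsub>?M\<^esub> q = 0" "q \<otimes>\<^bsub>?M\<^esub> 0 = 0" for q
    by (simp_all add: monoid_algebra_def)
  have mult: "?L (p \<otimes>\<^bsub>?M\<^esub> q) = ?L p \<otimes>\<^bsub>W\<^esub> ?L q"
    if p: "keys p \<subseteq> carrier G" and q: "keys q \<subseteq> carrier G" for p q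
    using p
  proof (induction p rule: poly_mapping_induct)
    case (single g c)
    from q show ?case
    proof (induction q rule: poly_mapping_induct)
      case (single h d)
      then show ?case using \<open>g \<in> carrier G\<close> f
        by (simp add: lsingle assms(5) mult.commute)
    next
      case (add p' q')
      then show ?case using \<open>g \<in> carrier G\<close>
        by (simp add: monoid_algebra_distrib ladd mclosed sclosed closed W.r_distr)
    qed (use \<open>g \<in> carrier G\<close> sclosed closed in \<open>simp add: mzero zero\<close>)
  next
    case (add p' q')
    then show ?case using q
      by (simp add: monoid_algebra_distrib ladd mclosed closed W.l_distr)
  qed (use q closed in \<open>simp add: mzero zero\<close>)
  show ?thesis
    using lsingle[of "\<one>\<^bsub>G\<^esub>" 1] by (intro alg_homI[OF L]) (simp_all add: mult assms(4))
qed


section \<open>Linear spans\<close>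

context complex_algebra
begin

lemma submodule_iff:
  "submodule J complex_ring A \<longleftrightarrow> J \<subseteq> carrier A \<and> \<zero> \<in> J \<and> (\<forall>x\<in>J. \<forall>y\<in>J. x \<oplus> y \<in> J)
     \<and> (\<forall>c. \<forall>x\<in>J. c \<odot> x \<in> J)" (is "?l \<longleftrightarrow> ?r")
proof
  assume ?l
  then interpret submodule J complex_ring A .
  show ?r using m_closed one_closed subset smult_closed by auto
next
  assume r: ?r
  then have "\<ominus> x \<in> J" if "x \<in> J" for x
    using that by (auto simp: minus_eq_smult subset_iff)
  with r show ?l
    by (intro submodule.intro submodule_axioms.intro add.subgroupI) (auto simp: a_inv_def)
qed

lemma linear_span_props:
  assumes "S \<subseteq> carrier A"
  shows "submodule (linear_span A S) complex_ring A" "S \<subseteq> linear_span A S"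
    "\<And>J. submodule J complex_ring A \<Longrightarrow> S \<subseteq> J \<Longrightarrow> linear_span A S \<subseteq> J"
proof -
  have "submodule (carrier A) complex_ring A" by (simp add: submodule_iff)
  then show "submodule (linear_span A S) complex_ring A"
    using assms unfolding submodule_iff linear_span_def by auto
qed (auto simp: linear_span_def)

lemma linear_span_closed:
  assumes "S \<subseteq> carrier A"
  shows "\<zero> \<in> linear_span A S" "x \<in> S \<Longrightarrow> x \<in> linear_span A S"
    "x \<in> linear_span A S \<Longrightarrow> y \<in> linear_span A S \<Longrightarrow> x \<oplus> y \<in> linear_span A S"
    "x \<in> linear_span A S \<Longrightarrow> c \<odot> x \<in> linear_span A S"
  using linear_span_props(1,2)[OF assms] by (auto simp: submodule_iff)

lemma linear_span_induct [consumes 2, case_names base zero add smult]: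
  assumes "x \<in> linear_span A S" "S \<subseteq> carrier A"
    and "\<And>x. x \<in> S \<Longrightarrow> P x" "P \<zero>"
    and "\<And>x y. x \<in> carrier A \<Longrightarrow> y \<in> carrier A \<Longrightarrow> P x \<Longrightarrow> P y \<Longrightarrow> P (x \<oplus> y)"
    and "\<And>c x. x \<in> carrier A \<Longrightarrow> P x \<Longrightarrow> P (c \<odot> x)"
  shows "P x"
proof -
  have "submodule {x \<in> carrier A. P x} complex_ring A"
    using assms(4-6) by (auto simp: submodule_iff)
  then have "linear_span A S \<subseteq> {x \<in> carrier A. P x}"
    by (rule linear_span_props(3)[OF assms(2)]) (use assms(2,3) in auto)
  with assms(1) show ?thesis by blast
qed

text \<open>\<open>tensor_null\<close> is defined as a span, yet cosets can be multiplied only if it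
  is an ideal. Membership of the products is linear in the element, so it suffices to multiply the
  spanning elements.\<close>

lemma linear_span_ideal:
  assumes S: "S \<subseteq> carrier A"
    and closed: "\<And>s x. s \<in> S \<Longrightarrow> x \<in> carrier A \<Longrightarrow> x \<otimes> s \<in> linear_span A S \<and> s \<otimes> x \<in> linear_span A S"
  shows "ideal (linear_span A S) A"
proof (rule idealI[OF ring_axioms])
  show "subgroup (linear_span A S) (add_monoid A)"
    using linear_span_props(1)[OF S] by (simp add: submodule_def)
  have "x \<otimes> a \<in> linear_span A S \<and> a \<otimes> x \<in> linear_span A S"
    if "a \<in> linear_span A S" and x: "x \<in> carrier A" for a x
    using that(1) S
    by (induction a rule: linear_span_induct)
      (use x closed S in \<open>auto simp: l_distr r_distr linear_span_closed\<close>)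
  then show "a \<in> linear_span A S \<Longrightarrow> x \<in> carrier A \<Longrightarrow> x \<otimes> a \<in> linear_span A S"
    "a \<in> linear_span A S \<Longrightarrow> x \<in> carrier A \<Longrightarrow> a \<otimes> x \<in> linear_span A S" for a x
    by blast+
qed

end

section \<open>Tensor products\<close>

definition bilinear_map ::
  "(complex, 'a, 'm) module_scheme \<Rightarrow> (complex, 'b, 'n) module_scheme \<Rightarrow>
   (complex, 'w, 'k) module_scheme \<Rightarrow> ('a \<Rightarrow> 'b \<Rightarrow> 'w) \<Rightarrow> bool" where
  "bilinear_map A B W \<beta> \<longleftrightarrow> (\<forall>x\<in>carrier A. \<beta> x \<in> linear_hom B W) \<and>
     (\<forall>y\<in>carrier B. (\<lambda>x. \<beta> x y) \<in> linear_hom A W)"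

lemma bilinear_mapD:
  assumes "bilinear_map A B W \<beta>" "x \<in> carrier A" "y \<in> carrier B"
  shows "\<beta> x y \<in> carrier W"
    "x' \<in> carrier A \<Longrightarrow> \<beta> (x \<oplus>\<^bsub>A\<^esub> x') y = \<beta> x y \<oplus>\<^bsub>W\<^esub> \<beta> x' y"
    "y' \<in> carrier B \<Longrightarrow> \<beta> x (y \<oplus>\<^bsub>B\<^esub> y') = \<beta> x y \<oplus>\<^bsub>W\<^esub> \<beta> x y'"
    "\<beta> (c \<odot>\<^bsub>A\<^esub> x) y = c \<odot>\<^bsub>W\<^esub> \<beta> x y"
    "\<beta> x (c \<odot>\<^bsub>B\<^esub> y) = c \<odot>\<^bsub>W\<^esub> \<beta> x y"
  using assms by (auto simp: bilinear_map_def linear_hom_def)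

lemma bilinear_mapI:
  assumes "\<And>x. x \<in> carrier A \<Longrightarrow> \<beta> x \<in> linear_hom B W"
    "\<And>y. y \<in> carrier B \<Longrightarrow> (\<lambda>x. \<beta> x y) \<in> linear_hom A W"
  shows "bilinear_map A B W \<beta>"
  using assms by (simp add: bilinear_map_def)

lemma tensor_lift_altdef:
  "tensor_lift W \<beta> t = the_elem (linear_extension W (\<lambda>u. \<beta> (fst u) (snd u)) ` t)"
  by (simp add: tensor_lift_def linear_extension_def)

locale tensor_product = A: complex_algebra A + B: complex_algebra B
  for A :: "(complex, 'a, 'm) module_scheme" and B :: "(complex, 'b, 'n) module_scheme"
begin

abbreviation AB where "AB \<equiv> monoid_algebra (A \<times>\<times> B)"

abbreviation pure (infixl "\<otimes>p" 75) where "x \<otimes>p y \<equiv> pure_tensor A B x y"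

lemma monoid_AB: "Group.monoid (A \<times>\<times> B)"
  by (rule DirProd_monoid[OF A.monoid_axioms B.monoid_axioms])

sublocale AB: complex_algebra AB
  by (rule complex_algebra_monoid_algebra[OF monoid_AB])

lemma carrier_AB: "p \<in> carrier AB \<longleftrightarrow> keys p \<subseteq> carrier A \<times> carrier B"
  by (simp add: DirProd_def)

lemma single_AB: "x \<in> carrier A \<Longrightarrow> y \<in> carrier B \<Longrightarrow> single (x, y) c \<in> carrier AB"
  by (simp add: carrier_AB)

lemma AB_diff: "p \<in> carrier AB \<Longrightarrow> q \<in> carrier AB \<Longrightarrow> p - q \<in> carrier AB"
  using keys_diff[of p q] by (auto simp: carrier_AB)

lemma AB_minus: "p \<in> carrier AB \<Longrightarrow> q \<in> carrier AB \<Longrightarrow> p \<ominus>\<^bsub>AB\<^esub> q = p - q"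
proof -
  assume pq: "p \<in> carrier AB" "q \<in> carrier AB"
  have "scale (-1) q = - q"
    by (rule poly_mapping_eqI) simp
  then show ?thesis using AB.diff_eq_smult[OF pq] by simp
qed

lemma relations_subset: "tensor_relations A B \<subseteq> carrier AB"
  unfolding tensor_relations_def
  by (intro Un_least subsetI; clarify; intro AB_diff single_AB; simp)

lemma tensor_relationsE:
  assumes "r \<in> tensor_relations A B"
  obtains (left) x x' y where "x \<in> carrier A" "x' \<in> carrier A" "y \<in> carrier B"
      "r = single (x \<oplus>\<^bsub>A\<^esub> x', y) 1 - single (x, y) 1
        - single (x', y) 1"
    | (right) x y y' where "x \<in> carrier A" "y \<in> carrier B" "y' \<in> carrier B"
      "r = single (x, y \<oplus>\<^bsub>B\<^esub> y') 1 - single (x, y) 1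
        - single (x, y') 1"
    | (smult_left) c x y where "x \<in> carrier A" "y \<in> carrier B"
      "r = single (c \<odot>\<^bsub>A\<^esub> x, y) 1 - single (x, y) c"
    | (smult_right) c x y where "x \<in> carrier A" "y \<in> carrier B"
      "r = single (x, c \<odot>\<^bsub>B\<^esub> y) 1 - single (x, y) c"
  using assms unfolding tensor_relations_def
  apply (elim UnE CollectE exE conjE)
  subgoal by (rule left)
  subgoal by (rule right)
  subgoal by (rule smult_left)
  subgoal by (rule smult_right)
  done

lemma tensor_relationsI:
  "x \<in> carrier A \<Longrightarrow> x' \<in> carrier A \<Longrightarrow> y \<in> carrier B \<Longrightarrow>
    single (x \<oplus>\<^bsub>A\<^esub> x', y) 1 - single (x, y) 1
        - single (x', y) 1 \<in> tensor_relations A B"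
  "x \<in> carrier A \<Longrightarrow> y \<in> carrier B \<Longrightarrow> y' \<in> carrier B \<Longrightarrow>
    single (x, y \<oplus>\<^bsub>B\<^esub> y') 1 - single (x, y) 1
        - single (x, y') 1 \<in> tensor_relations A B"
  "x \<in> carrier A \<Longrightarrow> y \<in> carrier B \<Longrightarrow>
    single (c \<odot>\<^bsub>A\<^esub> x, y) 1 - single (x, y) c \<in> tensor_relations A B"
  "x \<in> carrier A \<Longrightarrow> y \<in> carrier B \<Longrightarrow>
    single (x, c \<odot>\<^bsub>B\<^esub> y) 1 - single (x, y) c \<in> tensor_relations A B"
  unfolding tensor_relations_def
  by (rule UnI1, rule UnI1, rule UnI1, blast, rule UnI1, rule UnI1, rule UnI2, blast,
      rule UnI1, rule UnI2, blast, rule UnI2, blast)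

lemma AB_mult_diff:
  "(p - q) \<otimes>\<^bsub>AB\<^esub> r = p \<otimes>\<^bsub>AB\<^esub> r - q \<otimes>\<^bsub>AB\<^esub> r" "r \<otimes>\<^bsub>AB\<^esub> (p - q) = r \<otimes>\<^bsub>AB\<^esub> p - r \<otimes>\<^bsub>AB\<^esub> q"
  using monoid_algebra_distrib[where p = "p - q" and p' = q and G = "A \<times>\<times> B" and q = r] by (simp_all add: algebra_simps)

lemma DirProd_mult [simp]: "(x, y) \<otimes>\<^bsub>A \<times>\<times> B\<^esub> (x', y') = (x \<otimes>\<^bsub>A\<^esub> x', y \<otimes>\<^bsub>B\<^esub> y')"
  by (simp add: DirProd_def)

lemma single_scaled:
  "single u c = scale c (single u (1::complex))"
  by simp

text \<open>By distributivity and compatibility with scalars in the component concerned, a pair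
  times a bilinearity relation is a bilinearity relation of the same kind.\<close>

lemma relation_mult:
  assumes "r \<in> tensor_relations A B" "x \<in> carrier A" "y \<in> carrier B"
  shows "single (x, y) 1 \<otimes>\<^bsub>AB\<^esub> r \<in> tensor_relations A B"
    "r \<otimes>\<^bsub>AB\<^esub> single (x, y) 1 \<in> tensor_relations A B"
  using assms(1)
  by (cases rule: tensor_relationsE,
      insert assms(2,3), simp_all add: AB_mult_diff A.r_distr B.r_distr A.l_distr B.l_distr tensor_relationsI)+

lemma tensor_null_ideal: "ideal (tensor_null A B) AB"
  unfolding tensor_null_def
proof (rule AB.linear_span_ideal[OF relations_subset])
  let ?N = "linear_span AB (tensor_relations A B)"
  fix r p assume r: "r \<in> tensor_relations A B" and p: "p \<in> carrier AB"
  note N = AB.linear_span_closed[OF relations_subset]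
  from p have "keys p \<subseteq> carrier A \<times> carrier B" by (simp add: carrier_AB)
  then show "p \<otimes>\<^bsub>AB\<^esub> r \<in> ?N \<and> r \<otimes>\<^bsub>AB\<^esub> p \<in> ?N"
  proof (induction p rule: poly_mapping_induct)
    case zero
    then show ?case using N(1) by (simp add: monoid_algebra_def)
  next
    case (single g c)
    obtain x y where g: "g = (x, y)" "x \<in> carrier A" "y \<in> carrier B" using single by auto
    have "scale c (single (x, y) 1 \<otimes>\<^bsub>AB\<^esub> r) \<in> ?N"
      "scale c (r \<otimes>\<^bsub>AB\<^esub> single (x, y) 1) \<in> ?N"
      using N(4)[OF N(2)[OF relation_mult(1)[OF r g(2,3)]], of c]
        N(4)[OF N(2)[OF relation_mult(2)[OF r g(2,3)]], of c] by simp_all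
    then show ?case
      unfolding g(1) single_scaled[of "(x, y)" c] monoid_algebra_mult_smult by blast
  next
    case (add p q)
    then show ?case using N(3) by (auto simp: monoid_algebra_distrib)
  qed
qed

sublocale null: algebra_ideal AB "tensor_null A B"
  by (intro algebra_ideal.intro tensor_null_ideal AB.complex_algebra_axioms)

sublocale T: complex_algebra "tensor A B"
  unfolding tensor_def by (rule null.complex_algebra_quot)

lemma pure_in_carrier [simp, intro]: "x \<in> carrier A \<Longrightarrow> y \<in> carrier B \<Longrightarrow> x \<otimes>p y \<in> carrier (tensor A B)"
  using single_AB[of x y 1] by (auto simp: pure_tensor_def tensor_def carrier_quot_algebra)

lemma coset_single:
  "x \<in> carrier A \<Longrightarrow> y \<in> carrier B \<Longrightarrow>
    tensor_null A B +>\<^bsub>AB\<^esub> single (x, y) c = c \<odot>\<^bsub>tensor A B\<^esub> (x \<otimes>p y)"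
  using null.coset_smult[OF single_AB, of x y c 1] by (simp add: tensor_def pure_tensor_def)

lemma relation_coset:
  assumes "p \<in> carrier AB" "q \<in> carrier AB" "p - q \<in> tensor_relations A B"
  shows "tensor_null A B +>\<^bsub>AB\<^esub> p = tensor_null A B +>\<^bsub>AB\<^esub> q"
proof -
  have "p - q \<in> tensor_null A B"
    using assms(3) AB.linear_span_closed(2)[OF relations_subset] unfolding tensor_null_def by blast
  then show ?thesis using assms AB_minus by (simp add: null.coset_eq_iff)
qed

lemma coset_add:
  assumes "p \<in> carrier AB" "q \<in> carrier AB"
  shows "tensor_null A B +>\<^bsub>AB\<^esub> (p + q)
    = (tensor_null A B +>\<^bsub>AB\<^esub> p) \<oplus>\<^bsub>tensor A B\<^esub> (tensor_null A B +>\<^bsub>AB\<^esub> q)"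
  using null.coset_ops(1)[OF assms] by (simp add: tensor_def)

lemma pure_bilinear: "bilinear_map A B (tensor A B) (\<lambda>x y. x \<otimes>p y)"
proof (intro bilinear_mapI linear_homI)
  fix x y y' c assume xy: "x \<in> carrier A" "y \<in> carrier B"
  show "x \<otimes>p y \<in> carrier (tensor A B)" using xy by blast
  then show "x \<otimes>p y \<in> carrier (tensor A B)" .
  have "tensor_null A B +>\<^bsub>AB\<^esub> single (x, c \<odot>\<^bsub>B\<^esub> y) 1
      = tensor_null A B +>\<^bsub>AB\<^esub> single (x, y) c"
    by (rule relation_coset) (use xy in \<open>intro single_AB tensor_relationsI; simp\<close>)+
  then show "x \<otimes>p (c \<odot>\<^bsub>B\<^esub> y) = c \<odot>\<^bsub>tensor A B\<^esub> (x \<otimes>p y)"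
    using coset_single[OF xy, of c] by (simp add: pure_tensor_def)
  have "tensor_null A B +>\<^bsub>AB\<^esub> single (c \<odot>\<^bsub>A\<^esub> x, y) 1
      = tensor_null A B +>\<^bsub>AB\<^esub> single (x, y) c"
    by (rule relation_coset) (use xy in \<open>intro single_AB tensor_relationsI; simp\<close>)+
  then show "(c \<odot>\<^bsub>A\<^esub> x) \<otimes>p y = c \<odot>\<^bsub>tensor A B\<^esub> (x \<otimes>p y)"
    using coset_single[OF xy, of c] by (simp add: pure_tensor_def)
next
  fix x y y' assume xy: "x \<in> carrier A" "y \<in> carrier B" "y' \<in> carrier B"
  have "tensor_null A B +>\<^bsub>AB\<^esub> single (x, y \<oplus>\<^bsub>B\<^esub> y') 1
      = tensor_null A B +>\<^bsub>AB\<^esub> (single (x, y) 1 + single (x, y') 1)"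
    by (rule relation_coset)
      (use xy tensor_relationsI(2)[OF xy] AB.a_closed[OF single_AB single_AB, of x y x y' 1 1]
        in \<open>auto simp: diff_diff_eq intro!: single_AB\<close>)
  then show "x \<otimes>p (y \<oplus>\<^bsub>B\<^esub> y') = x \<otimes>p y \<oplus>\<^bsub>tensor A B\<^esub> x \<otimes>p y'"
    using xy by (simp add: pure_tensor_def coset_add single_AB)
next
  fix x x' y assume xy: "y \<in> carrier B" "x \<in> carrier A" "x' \<in> carrier A"
  have "tensor_null A B +>\<^bsub>AB\<^esub> single (x \<oplus>\<^bsub>A\<^esub> x', y) 1
      = tensor_null A B +>\<^bsub>AB\<^esub> (single (x, y) 1 + single (x', y) 1)"
    by (rule relation_coset)
      (use xy tensor_relationsI(1)[OF xy(2,3,1)] AB.a_closed[OF single_AB single_AB, of x y x' y 1 1]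
        in \<open>auto simp: diff_diff_eq intro!: single_AB\<close>)
  then show "(x \<oplus>\<^bsub>A\<^esub> x') \<otimes>p y = x \<otimes>p y \<oplus>\<^bsub>tensor A B\<^esub> x' \<otimes>p y"
    using xy by (simp add: pure_tensor_def coset_add single_AB)
qed

lemmas pureD = bilinear_mapD[OF pure_bilinear]

text \<open>Scalars are absorbed into the first component,
  \<open>c \<odot> (x \<otimes> y) = (c \<odot> x) \<otimes> y\<close>, and zero is itself a pure
  tensor; pure tensors and sums therefore exhaust the cases.\<close>

lemma tensor_induct [consumes 1, case_names pure add]:
  assumes "t \<in> carrier (tensor A B)"
    "\<And>x y. x \<in> carrier A \<Longrightarrow> y \<in> carrier B \<Longrightarrow> P (x \<otimes>p y)"
    "\<And>s t. s \<in> carrier (tensor A B) \<Longrightarrow> t \<in> carrier (tensor A B) \<Longrightarrow> P s \<Longrightarrow> P t \<Longrightarrow>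
       P (s \<oplus>\<^bsub>tensor A B\<^esub> t)"
  shows "P t"
proof -
  obtain p where p: "t = tensor_null A B +>\<^bsub>AB\<^esub> p" "p \<in> carrier AB"
    using assms(1) by (auto simp: tensor_def carrier_quot_algebra)
  from p(2) have "keys p \<subseteq> carrier A \<times> carrier B" by (simp add: carrier_AB)
  then have "P (tensor_null A B +>\<^bsub>AB\<^esub> p)"
  proof (induction p rule: poly_mapping_induct)
    case zero
    have "tensor_null A B +>\<^bsub>AB\<^esub> 0 = \<zero>\<^bsub>A\<^esub> \<otimes>p \<zero>\<^bsub>B\<^esub>"
      using coset_single[of "\<zero>\<^bsub>A\<^esub>" "\<zero>\<^bsub>B\<^esub>" 0] pureD(4)[of "\<zero>\<^bsub>A\<^esub>" "\<zero>\<^bsub>B\<^esub>" 0] by simp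
    then show ?case using assms(2) by simp
  next
    case (single g c)
    then obtain x y where g: "g = (x, y)" "x \<in> carrier A" "y \<in> carrier B" by auto
    then have "tensor_null A B +>\<^bsub>AB\<^esub> single g c = (c \<odot>\<^bsub>A\<^esub> x) \<otimes>p y"
      by (simp add: coset_single pureD)
    then show ?case using assms(2) g by simp
  next
    case (add p q)
    then have c: "p \<in> carrier AB" "q \<in> carrier AB" by (simp_all add: carrier_AB)
    have "tensor_null A B +>\<^bsub>AB\<^esub> r \<in> carrier (tensor A B)" if "r \<in> carrier AB" for r
      using that by (auto simp: tensor_def carrier_quot_algebra)
    then show ?case using add c assms(3) by (simp add: coset_add)
  qed
  then show ?thesis using p by simp
qed

lemma pure_mult:
  assumes "x \<in> carrier A" "y \<in> carrier B" "x' \<in> carrier A" "y' \<in> carrier B"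
  shows "(x \<otimes>p y) \<otimes>\<^bsub>tensor A B\<^esub> (x' \<otimes>p y') = (x \<otimes>\<^bsub>A\<^esub> x') \<otimes>p (y \<otimes>\<^bsub>B\<^esub> y')"
  using null.coset_ops(2)[OF single_AB[OF assms(1,2)] single_AB[OF assms(3,4)], of 1 1]
  by (simp add: pure_tensor_def tensor_def)

lemma pure_one: "\<one>\<^bsub>A\<^esub> \<otimes>p \<one>\<^bsub>B\<^esub> = \<one>\<^bsub>tensor A B\<^esub>"
  by (simp add: pure_tensor_def tensor_def quot_algebra_simps(3) DirProd_def)

section \<open>The universal property of the tensor product\<close>

context
  fixes W :: "(complex, 'w, 'k) module_scheme" and \<beta>
  assumes W: "complex_algebra W" and bil: "bilinear_map A B W \<beta>"
begin

interpretation W: complex_algebra W by (rule W)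

lemma tensor_extension_linear: "linear_extension W (\<lambda>u. \<beta> (fst u) (snd u)) \<in> linear_hom AB W"
  by (rule linear_extension_linear[OF W]) (use bilinear_mapD(1)[OF bil] in \<open>auto simp: DirProd_def\<close>)

lemma tensor_extension_single:
  "x \<in> carrier A \<Longrightarrow> y \<in> carrier B \<Longrightarrow>
    linear_extension W (\<lambda>u. \<beta> (fst u) (snd u)) (single (x, y) c) = c \<odot>\<^bsub>W\<^esub> \<beta> x y"
  by (subst linear_extension_single[OF W]) (use bilinear_mapD(1)[OF bil] in auto)

lemma tensor_extension_null:
  assumes "p \<in> tensor_null A B"
  shows "linear_extension W (\<lambda>u. \<beta> (fst u) (snd u)) p = \<zero>\<^bsub>W\<^esub>"
proof -
  let ?L = "linear_extension W (\<lambda>u. \<beta> (fst u) (snd u))"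
  note L = linear_homD[OF tensor_extension_linear]
  have diff: "?L (p - q) = ?L p \<ominus>\<^bsub>W\<^esub> ?L q" if "p \<in> carrier AB" "q \<in> carrier AB" for p q
    using linear_hom_diff[OF AB.complex_algebra_axioms W tensor_extension_linear that] AB_minus[OF that] by simp
  note b = bilinear_mapD[OF bil]
  have cancel: "(u \<oplus>\<^bsub>W\<^esub> v) \<ominus>\<^bsub>W\<^esub> u \<ominus>\<^bsub>W\<^esub> v = \<zero>\<^bsub>W\<^esub>"
    if "u \<in> carrier W" "v \<in> carrier W" for u v
  proof -
    have "(u \<oplus>\<^bsub>W\<^esub> v) \<ominus>\<^bsub>W\<^esub> u \<ominus>\<^bsub>W\<^esub> v = (u \<oplus>\<^bsub>W\<^esub> v) \<ominus>\<^bsub>W\<^esub> (u \<oplus>\<^bsub>W\<^esub> v)"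
      using that by (simp add: W.minus_eq W.minus_add W.a_ac)
    then show ?thesis using that by (simp add: W.r_neg W.minus_eq)
  qed
  show ?thesis
    using assms[unfolded tensor_null_def] relations_subset
    by (induction p rule: AB.linear_span_induct)
      (auto elim!: tensor_relationsE simp: diff AB_diff single_AB tensor_extension_single b cancel L
        W.r_neg W.minus_eq[of "_ \<odot>\<^bsub>W\<^esub> _"] linear_hom_zero[OF AB.complex_algebra_axioms W tensor_extension_linear]
        simp del: monoid_algebra_simps)
qed

text \<open>The linear extension of a bilinear map kills \<open>tensor_null\<close>, so its image of
  a coset is a singleton and \<open>the_elem\<close> in \<open>tensor_lift\<close> has its intended
  meaning.\<close>

lemma tensor_lift_coset:
  assumes "p \<in> carrier AB"
  shows "tensor_lift W \<beta> (tensor_null A B +>\<^bsub>AB\<^esub> p) = linear_extension W (\<lambda>u. \<beta> (fst u) (snd u)) p"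
proof -
  let ?L = "linear_extension W (\<lambda>u. \<beta> (fst u) (snd u))"
  note L = linear_homD[OF tensor_extension_linear]
  have "?L q = ?L p" if "q \<in> tensor_null A B +>\<^bsub>AB\<^esub> p" for q
  proof -
    obtain n where n: "n \<in> tensor_null A B" "q = n \<oplus>\<^bsub>AB\<^esub> p"
      using \<open>q \<in> _\<close> unfolding a_r_coset_def' by blast
    then have "n \<in> carrier AB" using null.Icarr by blast
    then show ?thesis
      unfolding n(2) using assms L(1,2) tensor_extension_null[OF n(1)] by (simp del: monoid_algebra_simps)
  qed
  moreover have "p \<in> tensor_null A B +>\<^bsub>AB\<^esub> p" using null.a_rcos_self assms by blast
  ultimately have "?L ` (tensor_null A B +>\<^bsub>AB\<^esub> p) = {?L p}" by blast
  then show ?thesis by (simp add: tensor_lift_altdef)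
qed

lemma tensor_lift_pure:
  assumes "x \<in> carrier A" "y \<in> carrier B"
  shows "tensor_lift W \<beta> (x \<otimes>p y) = \<beta> x y"
  using assms bilinear_mapD(1)[OF bil]
  by (simp add: pure_tensor_def tensor_lift_coset single_AB tensor_extension_single del: monoid_algebra_simps)

lemma tensor_lift_linear: "tensor_lift W \<beta> \<in> linear_hom (tensor A B) W"
proof -
  note L = linear_homD[OF tensor_extension_linear]
  show ?thesis
    by (intro linear_homI)
      (auto simp: tensor_def carrier_quot_algebra null.coset_ops null.coset_smult tensor_lift_coset L
        simp del: monoid_algebra_simps)
qed

text \<open>Both sides of multiplicativity are additive in \<open>s\<close> and in \<open>t\<close>,
  so the claim reduces to pure tensors, where it is the hypothesis \<open>mult\<close>.\<close>

lemma tensor_lift_alg_hom: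
  assumes one: "\<beta> \<one>\<^bsub>A\<^esub> \<one>\<^bsub>B\<^esub> = \<one>\<^bsub>W\<^esub>"
    and mult: "\<And>x y x' y'. x \<in> carrier A \<Longrightarrow> y \<in> carrier B \<Longrightarrow> x' \<in> carrier A \<Longrightarrow> y' \<in> carrier B \<Longrightarrow>
      \<beta> (x \<otimes>\<^bsub>A\<^esub> x') (y \<otimes>\<^bsub>B\<^esub> y') = \<beta> x y \<otimes>\<^bsub>W\<^esub> \<beta> x' y'"
  shows "tensor_lift W \<beta> \<in> alg_hom (tensor A B) W"
proof (rule alg_homI[OF tensor_lift_linear])
  note L = linear_homD[OF tensor_lift_linear]
  show "tensor_lift W \<beta> \<one>\<^bsub>tensor A B\<^esub> = \<one>\<^bsub>W\<^esub>"
    unfolding pure_one[symmetric] by (simp add: tensor_lift_pure one)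
  fix s t assume s: "s \<in> carrier (tensor A B)" and t: "t \<in> carrier (tensor A B)"
  from s show "tensor_lift W \<beta> (s \<otimes>\<^bsub>tensor A B\<^esub> t) = tensor_lift W \<beta> s \<otimes>\<^bsub>W\<^esub> tensor_lift W \<beta> t"
  proof (induction s rule: tensor_induct)
    case (pure x y)
    from t show ?case
      by (induction t rule: tensor_induct)
        (use pure in \<open>simp_all add: pure_mult tensor_lift_pure mult T.r_distr W.r_distr L
          bilinear_mapD(1)[OF bil]\<close>)
  next
    case (add s s')
    then show ?case using t by (simp add: T.l_distr W.l_distr L)
  qed
qed

end

end

section \<open>Tensor products of homomorphisms and the associator\<close>

lemma tensor_map_alg_hom:
  assumes "complex_algebra A" "complex_algebra B" "complex_algebra C" "complex_algebra D"
    and f: "f \<in> alg_hom A C" and g: "g \<in> alg_hom B D"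
  shows "tensor_map C D f g \<in> alg_hom (tensor A B) (tensor C D)"
    and "x \<in> carrier A \<Longrightarrow> y \<in> carrier B \<Longrightarrow>
      tensor_map C D f g (pure_tensor A B x y) = pure_tensor C D (f x) (g y)"
proof -
  interpret AB: tensor_product A B using assms by (simp add: tensor_product_def)
  interpret CD: tensor_product C D using assms by (simp add: tensor_product_def)
  note h = alg_homD[OF f] alg_homD[OF g]
  have b: "bilinear_map A B (tensor C D) (\<lambda>x y. pure_tensor C D (f x) (g y))"
    by (intro bilinear_mapI linear_homI) (simp_all add: h CD.pureD)
  show "tensor_map C D f g \<in> alg_hom (tensor A B) (tensor C D)"
    unfolding tensor_map_def
    by (rule AB.tensor_lift_alg_hom[OF CD.T.complex_algebra_axioms b])
      (simp_all add: h CD.pure_one CD.pure_mult)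
  show "x \<in> carrier A \<Longrightarrow> y \<in> carrier B \<Longrightarrow>
      tensor_map C D f g (pure_tensor A B x y) = pure_tensor C D (f x) (g y)"
    unfolding tensor_map_def by (rule AB.tensor_lift_pure[OF CD.T.complex_algebra_axioms b])
qed

text \<open>Multiplicativity of the associator makes coassociativity an equation between algebra
  homomorphisms, which can then be checked on generators.\<close>

lemma tensor_assoc_alg_hom:
  assumes "complex_algebra A"
  shows "tensor_assoc A \<in> alg_hom (tensor (tensor A A) A) (tensor A (tensor A A))"
    and "x \<in> carrier A \<Longrightarrow> y \<in> carrier A \<Longrightarrow> z \<in> carrier A \<Longrightarrow>
      tensor_assoc A (pure_tensor (tensor A A) A (pure_tensor A A x y) z)
        = pure_tensor A (tensor A A) x (pure_tensor A A y z)"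
proof -
  interpret A: complex_algebra A by fact
  interpret AA: tensor_product A A by unfold_locales
  interpret A_AA: tensor_product A "tensor A A" by unfold_locales
  interpret AA_A: tensor_product "tensor A A" A by unfold_locales
  let ?W = "tensor A (tensor A A)"
  let ?\<beta> = "\<lambda>z x y. pure_tensor A (tensor A A) x (pure_tensor A A y z)"
  let ?\<gamma> = "\<lambda>t z. tensor_lift ?W (?\<beta> z) t"
  have b: "bilinear_map A A ?W (?\<beta> z)" if "z \<in> carrier A" for z
    by (intro bilinear_mapI linear_homI) (use that in \<open>simp_all add: AA.pureD A_AA.pureD\<close>)
  note lift_pure = AA.tensor_lift_pure[OF A_AA.T.complex_algebra_axioms b]
  note lin = AA.tensor_lift_linear[OF A_AA.T.complex_algebra_axioms b]
  note linD = linear_homD[OF lin]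
  \<comment> \<open>Linearity in the tensor argument is that of the inner lift. Linearity in
    \<open>z\<close>, a parameter of the lifted map, is proved by induction on the tensor.\<close>
  have g: "bilinear_map (tensor A A) A ?W ?\<gamma>"
  proof (intro bilinear_mapI lin)
    fix t assume "t \<in> carrier (tensor A A)"
    then show "?\<gamma> t \<in> linear_hom A ?W"
    proof (induction t rule: AA.tensor_induct)
      case (pure x y)
      then show ?case
        by (intro linear_homI) (simp_all add: lift_pure AA.pureD A_AA.pureD)
    next
      case (add s t)
      then show ?case
        by (intro linear_homI)
          (simp_all add: linD linear_homD[OF add.IH(1)] linear_homD[OF add.IH(2)]
            A_AA.T.smult_add_right A_AA.T.a_ac)
    qed
  qed
  have mult: "?\<gamma> (s \<otimes>\<^bsub>tensor A A\<^esub> t) (z \<otimes>\<^bsub>A\<^esub> z') = ?\<gamma> s z \<otimes>\<^bsub>?W\<^esub> ?\<gamma> t z'"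
    if s: "s \<in> carrier (tensor A A)" and t: "t \<in> carrier (tensor A A)"
      and z: "z \<in> carrier A" "z' \<in> carrier A" for s t z z'
    using s
  proof (induction s rule: AA.tensor_induct)
    case (pure x y)
    from t show ?case
    proof (induction t rule: AA.tensor_induct)
      case (pure x' y')
      then show ?case using \<open>x \<in> carrier A\<close> \<open>y \<in> carrier A\<close> z
        by (simp add: AA.pure_mult A_AA.pure_mult lift_pure)
    next
      case (add t t')
      then show ?case using \<open>x \<in> carrier A\<close> \<open>y \<in> carrier A\<close> z
        by (simp add: AA.T.r_distr A_AA.T.r_distr linD)
    qed
  next
    case (add s s')
    then show ?case using t z by (simp add: AA.T.l_distr A_AA.T.l_distr linD)
  qed
  have one: "?\<gamma> \<one>\<^bsub>tensor A A\<^esub> \<one>\<^bsub>A\<^esub> = \<one>\<^bsub>?W\<^esub>"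
    unfolding AA.pure_one[symmetric]
    by (subst lift_pure) (simp_all add: AA.pure_one A_AA.pure_one)
  show "tensor_assoc A \<in> alg_hom (tensor (tensor A A) A) (tensor A (tensor A A))"
    unfolding tensor_assoc_def
    by (rule AA_A.tensor_lift_alg_hom[OF A_AA.T.complex_algebra_axioms g one mult])
  show "tensor_assoc A (pure_tensor (tensor A A) A (pure_tensor A A x y) z)
        = pure_tensor A (tensor A A) x (pure_tensor A A y z)"
    if "x \<in> carrier A" "y \<in> carrier A" "z \<in> carrier A"
    unfolding tensor_assoc_def using that
    by (simp add: AA_A.tensor_lift_pure[OF A_AA.T.complex_algebra_axioms g] lift_pure)
qed

section \<open>The twisted Levi-Civita symbol\<close>

lemma \<mu>_unit [simp]: "\<mu> \<theta> * cnj (\<mu> \<theta>) = 1" "cnj (\<mu> \<theta>) * \<mu> \<theta> = 1"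
proof -
  have "\<mu> \<theta> = cis (pi * \<theta>)"
    by (simp add: \<mu>_def cis_conv_exp mult_ac)
  then show "\<mu> \<theta> * cnj (\<mu> \<theta>) = 1" "cnj (\<mu> \<theta>) * \<mu> \<theta> = 1"
    by (simp_all add: cis_cnj cis_mult)
qed

text \<open>An opaque name for the index set: membership stays an atomic fact for the simplifier,
  and \<open>index_cases\<close> splits it into four cases only where a finite check is
  intended.\<close>

definition Ix :: "nat set" where "Ix = {1..4}"

lemma finite_Ix [simp]: "finite Ix"
  by (simp add: Ix_def)

lemma index_cases: "i \<in> Ix \<longleftrightarrow> i = 1 \<or> i = 2 \<or> i = 3 \<or> i = 4"
  by (auto simp: Ix_def)

lemma index_simps [simp]: "1 \<in> Ix" "Suc 0 \<in> Ix" "2 \<in> Ix" "3 \<in> Ix" "4 \<in> Ix"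
  by (simp_all add: index_cases)

lemma \<eta>_mult [simp]:
  "i \<in> Ix \<Longrightarrow> j \<in> Ix \<Longrightarrow> \<eta> \<theta> i j * \<eta> \<theta> j i = 1"
  unfolding index_cases by (elim disjE) (simp_all add: \<eta>_def)

lemma \<eta>_diag [simp]: "i \<in> Ix \<Longrightarrow> \<eta> \<theta> i i = 1"
  unfolding index_cases by (elim disjE) (simp_all add: \<eta>_def)

text \<open>Rotation of a list of length 4 depends on \<open>n mod 4\<close> only. This makes
  \<open>eps\<close> computable on concrete indices.\<close>

lemma ex_rotate4_iff:
  "(\<exists>n. s = rotate n [w, x, y, z]) \<longleftrightarrow>
     s = [w, x, y, z] \<or> s = [x, y, z, w] \<or> s = [y, z, w, x] \<or> s = [z, w, x, y]" (is "?l \<longleftrightarrow> ?r")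
proof -
  have rot: "rotate 0 [w,x,y,z] = [w,x,y,z]" "rotate 1 [w,x,y,z] = [x,y,z,w]"
    "rotate 2 [w,x,y,z] = [y,z,w,x]" "rotate 3 [w,x,y,z] = [z,w,x,y]"
    by (simp_all add: numeral_eq_Suc)
  have "?r" if "s = rotate n [w, x, y, z]" for n
  proof -
    have "s = rotate (n mod 4) [w, x, y, z]" using that rotate_conv_mod[of n "[w,x,y,z]"] by simp
    moreover have "n mod 4 = 0 \<or> n mod 4 = 1 \<or> n mod 4 = 2 \<or> n mod 4 = 3" by presburger
    ultimately show ?thesis using rot by metis
  qed
  then show ?thesis using rot by metis
qed

text \<open>The product of the signs of all differences: the sign of the quadruple as a permutation,
  and 0 as soon as two entries coincide. It extends sums over permutations to sums over all
  quadruples.\<close>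

definition sgn4 :: "nat \<Rightarrow> nat \<Rightarrow> nat \<Rightarrow> nat \<Rightarrow> int" where
  "sgn4 p q r s = sgn (int q - int p) * sgn (int r - int p) * sgn (int s - int p)
     * sgn (int r - int q) * sgn (int s - int q) * sgn (int s - int r)"

text \<open>The symbol \<open>E\<close> of the overview. On quadruples with a repetition
  \<open>eps\<close> has its default value 1, and the factor \<open>sgn4\<close> makes the symbol
  vanish.\<close>

definition twisted_lc :: "real \<Rightarrow> nat \<Rightarrow> nat \<Rightarrow> nat \<Rightarrow> nat \<Rightarrow> complex" where
  "twisted_lc \<theta> p q r s = of_int (sgn4 p q r s) * eps \<theta> [p, q, r, s]"

lemma twisted_lc_eval:
  "twisted_lc \<theta> p q r s = of_int (sgn4 p q r s) *
     (if (p, q, r, s) \<in> {(1,3,2,4),(3,2,4,1),(2,4,1,3),(4,1,3,2)} then \<mu> \<theta>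
      else if (p, q, r, s) \<in> {(1,4,2,3),(4,2,3,1),(2,3,1,4),(3,1,4,2)} then cnj (\<mu> \<theta>) else 1)"
  unfolding twisted_lc_def eps_def ex_rotate4_iff by simp

text \<open>Twisted antisymmetry in the first two positions, a finite check. The factor
  \<open>\<eta> \<theta> q p\<close> is the column factor that appears when two neighbouring entries
  are commuted; it is what the values \<mu> and its conjugate in \<open>eps\<close> are made
  for.\<close>

lemma twisted_lc_swap:
  assumes "p \<in> Ix" "q \<in> Ix" "r \<in> Ix" "s \<in> Ix"
  shows "twisted_lc \<theta> q p r s * \<eta> \<theta> q p = - twisted_lc \<theta> p q r s"
  using assms unfolding index_cases
  by (elim disjE; hypsubst; simp add: twisted_lc_eval sgn4_def \<eta>_def)

lemma twisted_lc_swap':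
  assumes "p \<in> Ix" "q \<in> Ix" "r \<in> Ix" "s \<in> Ix"
  shows "twisted_lc \<theta> p r q s * \<eta> \<theta> r q = - twisted_lc \<theta> p q r s"
  using assms unfolding index_cases
  by (elim disjE; hypsubst; simp add: twisted_lc_eval sgn4_def \<eta>_def)

lemma twisted_lc_swap'':
  assumes "p \<in> Ix" "q \<in> Ix" "r \<in> Ix" "s \<in> Ix"
  shows "twisted_lc \<theta> p q s r * \<eta> \<theta> s r = - twisted_lc \<theta> p q r s"
  using assms unfolding index_cases
  by (elim disjE; hypsubst; simp add: twisted_lc_eval sgn4_def \<eta>_def)

lemma twisted_lc_adjacent_eq [simp]:
  "twisted_lc \<theta> p p r s = 0" "twisted_lc \<theta> p q q s = 0" "twisted_lc \<theta> p q r r = 0"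
  by (simp_all add: twisted_lc_eval sgn4_def)

lemma twisted_lc_1234 [simp]: "twisted_lc \<theta> (Suc 0) 2 3 4 = 1" "twisted_lc \<theta> 1 2 3 4 = 1"
  by (simp_all add: twisted_lc_eval sgn4_def)

lemma twisted_lc_3412: "twisted_lc \<theta> 3 4 1 2 = 1"
  by (simp add: twisted_lc_eval sgn4_def)

text \<open>The index at place \<open>n\<close>, counted from 0, of the list that
  \<open>SL_hat\<close> uses for the rows and columns of a minor.\<close>

definition rest :: "nat \<Rightarrow> nat \<Rightarrow> nat" where
  "rest i n = remove1 i [1, 2, 3, 4] ! n"

lemma rest_index [simp]:
  assumes "i \<in> Ix" "n < 3"
  shows "rest i n \<in> Ix"
proof -
  have "n = 0 \<or> n = 1 \<or> n = 2" using assms(2) by auto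
  then show ?thesis using assms(1) unfolding index_cases
    by (elim disjE) (simp_all add: rest_def)
qed

text \<open>If \<open>j\<close> differs from \<open>i\<close>, it is repeated among the remaining
  indices and the symbol vanishes. If \<open>j = i\<close>, the quadruple is in neither of the two
  special rotation classes and needs \<open>i - 1\<close> exchanges to be sorted, a sign that
  \<open>(-1) ^ (i + 1)\<close> cancels.\<close>

lemma twisted_lc_rest:
  assumes "i \<in> Ix" "j \<in> Ix"
  shows "(-1) ^ (i + 1) * twisted_lc \<theta> j (rest i 0) (rest i 1) (rest i 2) = (if j = i then 1 else 0)"
  using assms unfolding index_cases
  by (elim disjE; hypsubst; simp add: twisted_lc_eval sgn4_def rest_def)

abbreviation idx4 :: "(nat \<times> nat \<times> nat \<times> nat) set" where
  "idx4 \<equiv> Ix \<times> Ix \<times> Ix \<times> Ix"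

text \<open>Each of the 24 permutations contributes 1: reversing four entries is an even
  permutation, and it interchanges the rotation classes on which \<open>eps\<close> is \<mu> and its
  conjugate.\<close>

lemma sum_twisted_lc_rev:
  "(\<Sum>(p, q, r, s)\<in>idx4. twisted_lc \<theta> p q r s * twisted_lc \<theta> s r q p) = 24"
proof -
  have e: "Ix = {1, 2, 3, 4}" by (auto simp: Ix_def)
  show ?thesis
    unfolding e sum.cartesian_product[symmetric]
    by (simp add: twisted_lc_eval sgn4_def)
qed

section \<open>Matrices with twisted commutation relations\<close>

definition sum4 ::
  "(complex, 'a, 'm) module_scheme \<Rightarrow> (nat \<Rightarrow> nat \<Rightarrow> nat \<Rightarrow> nat \<Rightarrow> 'a) \<Rightarrow> 'a" where
  "sum4 A f = finsum A (\<lambda>(p, q, r, s). f p q r s) idx4"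

definition sum3 ::
  "(complex, 'a, 'm) module_scheme \<Rightarrow> (nat \<Rightarrow> nat \<Rightarrow> nat \<Rightarrow> 'a) \<Rightarrow> 'a" where
  "sum3 A f = finsum A (\<lambda>(p, q, r). f p q r) (Ix \<times> Ix \<times> Ix)"

lemma sum34_op [simp]: "sum4 (op_algebra A) = sum4 A" "sum3 (op_algebra A) = sum3 A"
  by (simp_all add: sum4_def sum3_def fun_eq_iff)

context complex_algebra
begin

lemma fsum_cartesian:
  assumes "finite I" "finite J" "\<And>i j. i \<in> I \<Longrightarrow> j \<in> J \<Longrightarrow> f (i, j) \<in> carrier A"
  shows "finsum A f (I \<times> J) = finsum A (\<lambda>i. finsum A (\<lambda>j. f (i, j)) J) I"
  using assms(1,3)
proof (induction I)
  case (insert i I)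
  have "insert i I \<times> J = (\<lambda>j. (i, j)) ` J \<union> I \<times> J" by auto
  then have "finsum A f (insert i I \<times> J) = finsum A f ((\<lambda>j. (i, j)) ` J \<union> I \<times> J)" by simp
  also have "\<dots> = finsum A f ((\<lambda>j. (i, j)) ` J) \<oplus> finsum A f (I \<times> J)"
    using insert assms(2) by (intro finsum_Un_disjoint) auto
  also have "finsum A f ((\<lambda>j. (i, j)) ` J) = finsum A (\<lambda>j. f (i, j)) J"
    using insert by (intro finsum_reindex) (auto simp: inj_on_def)
  finally show ?case using insert by simp
qed simp

lemma fsum_permute:
  assumes "h ` S = S" "finite S" "\<And>u. u \<in> S \<Longrightarrow> f u \<in> carrier A"
  shows "finsum A f S = finsum A (\<lambda>u. f (h u)) S"
proof -
  have "inj_on h S" using assms(1,2) by (simp add: eq_card_imp_inj_on)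
  then have "finsum A f (h ` S) = finsum A (\<lambda>u. f (h u)) S"
    using assms by (intro finsum_reindex) auto
  then show ?thesis using assms(1) by simp
qed

lemma sum4_closed [simp]:
  "(\<And>p q r s. \<lbrakk>p \<in> Ix; q \<in> Ix; r \<in> Ix; s \<in> Ix\<rbrakk> \<Longrightarrow> f p q r s \<in> carrier A)
    \<Longrightarrow> sum4 A f \<in> carrier A"
  unfolding sum4_def by (rule fsum_closed) auto

lemma sum3_closed [simp]:
  "(\<And>p q r. p \<in> Ix \<Longrightarrow> q \<in> Ix \<Longrightarrow> r \<in> Ix \<Longrightarrow> f p q r \<in> carrier A)
    \<Longrightarrow> sum3 A f \<in> carrier A"
  unfolding sum3_def by (rule fsum_closed) auto

lemma sum4_cong:
  assumes "\<And>p q r s. \<lbrakk>p \<in> Ix; q \<in> Ix; r \<in> Ix; s \<in> Ix\<rbrakk> \<Longrightarrow> g p q r s \<in> carrier A"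
    and "\<And>p q r s. \<lbrakk>p \<in> Ix; q \<in> Ix; r \<in> Ix; s \<in> Ix\<rbrakk> \<Longrightarrow> f p q r s = g p q r s"
  shows "sum4 A f = sum4 A g"
  unfolding sum4_def by (rule fsum_cong) (use assms in auto)

lemma sum3_cong:
  assumes "\<And>p q r. p \<in> Ix \<Longrightarrow> q \<in> Ix \<Longrightarrow> r \<in> Ix \<Longrightarrow> g p q r \<in> carrier A"
    and "\<And>p q r. p \<in> Ix \<Longrightarrow> q \<in> Ix \<Longrightarrow> r \<in> Ix \<Longrightarrow> f p q r = g p q r"
  shows "sum3 A f = sum3 A g"
  unfolding sum3_def by (rule fsum_cong) (use assms in auto)

text \<open>A congruence rule for the simplifier: while rewriting the summand it may use membership
  of the indices, and closure of the summand is phrased as an equation with \<open>True\<close> so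
  that it is itself settled by rewriting.\<close>

lemma sum4_cong_simp:
  assumes "(\<forall>p\<in>Ix. \<forall>q\<in>Ix. \<forall>r\<in>Ix. \<forall>s\<in>Ix. f p q r s \<in> carrier A) = True"
    and "\<And>p q r s. p \<in> Ix \<and> q \<in> Ix \<and> r \<in> Ix \<and> s \<in> Ix =simp=> f p q r s = g p q r s"
  shows "sum4 A f = sum4 A g"
  by (rule sum4_cong[symmetric]) (use assms in \<open>auto simp: simp_implies_def\<close>)

lemma sum3_cong_simp:
  assumes "(\<forall>p\<in>Ix. \<forall>q\<in>Ix. \<forall>r\<in>Ix. f p q r \<in> carrier A) = True"
    and "\<And>p q r. p \<in> Ix \<and> q \<in> Ix \<and> r \<in> Ix =simp=> f p q r = g p q r"
  shows "sum3 A f = sum3 A g"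
  by (rule sum3_cong[symmetric]) (use assms in \<open>auto simp: simp_implies_def\<close>)

lemma sum4_eq_sum3:
  assumes "\<And>p q r s. \<lbrakk>p \<in> Ix; q \<in> Ix; r \<in> Ix; s \<in> Ix\<rbrakk> \<Longrightarrow> f p q r s \<in> carrier A"
  shows "sum4 A f = (\<Oplus>p\<in>Ix. sum3 A (f p))"
  unfolding sum4_def sum3_def by (subst fsum_cartesian) (use assms in auto)

lemma sum4_nested:
  assumes "\<And>p q r s. \<lbrakk>p \<in> Ix; q \<in> Ix; r \<in> Ix; s \<in> Ix\<rbrakk> \<Longrightarrow> f p q r s \<in> carrier A"
  shows "sum4 A f = (\<Oplus>p\<in>Ix. \<Oplus>q\<in>Ix. \<Oplus>r\<in>Ix. \<Oplus>s\<in>Ix. f p q r s)"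
proof -
  have "sum3 A (f p) = (\<Oplus>q\<in>Ix. \<Oplus>r\<in>Ix. \<Oplus>s\<in>Ix. f p q r s)" if "p \<in> Ix" for p
    unfolding sum3_def using assms[OF that]
    by (subst fsum_cartesian) (auto intro!: fsum_cong simp: fsum_cartesian)
  then show ?thesis
    using assms by (subst sum4_eq_sum3) (auto intro!: fsum_cong)
qed

text \<open>Each renaming is an involution of the index set and hence maps it onto itself.\<close>

lemma sum4_swaps:
  assumes "\<And>p q r s. \<lbrakk>p \<in> Ix; q \<in> Ix; r \<in> Ix; s \<in> Ix\<rbrakk> \<Longrightarrow> f p q r s \<in> carrier A"
  shows "sum4 A f = sum4 A (\<lambda>p q r s. f q p r s)"
    "sum4 A f = sum4 A (\<lambda>p q r s. f p r q s)"
    "sum4 A f = sum4 A (\<lambda>p q r s. f p q s r)"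
    "sum4 A f = sum4 A (\<lambda>p q r s. f s r q p)"
proof -
  let ?f = "\<lambda>(p, q, r, s). f p q r s"
  have f: "?f u \<in> carrier A" if "u \<in> idx4" for u
    using that assms by auto
  have *: "finsum A ?f idx4 = finsum A (\<lambda>u. ?f (h u)) idx4"
    if "\<And>u. u \<in> idx4 \<Longrightarrow> h u \<in> idx4" "\<And>u. h (h u) = u" for h
  proof (rule fsum_permute)
    show "h ` idx4 = idx4"
    proof (intro equalityI subsetI)
      fix u assume "u \<in> idx4"
      then show "u \<in> h ` idx4" using that by (metis imageI)
    qed (use that(1) in blast)
  qed (use f in auto)
  show "sum4 A f = sum4 A (\<lambda>p q r s. f q p r s)"
    using *[of "\<lambda>(p, q, r, s). (q, p, r, s)"] by (auto simp: sum4_def case_prod_unfold)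
  show "sum4 A f = sum4 A (\<lambda>p q r s. f p r q s)"
    using *[of "\<lambda>(p, q, r, s). (p, r, q, s)"] by (auto simp: sum4_def case_prod_unfold)
  show "sum4 A f = sum4 A (\<lambda>p q r s. f p q s r)"
    using *[of "\<lambda>(p, q, r, s). (p, q, s, r)"] by (auto simp: sum4_def case_prod_unfold)
  show "sum4 A f = sum4 A (\<lambda>p q r s. f s r q p)"
    using *[of "\<lambda>(p, q, r, s). (s, r, q, p)"] by (auto simp: sum4_def case_prod_unfold)
qed

lemma sum4_smult:
  assumes "\<And>p q r s. \<lbrakk>p \<in> Ix; q \<in> Ix; r \<in> Ix; s \<in> Ix\<rbrakk> \<Longrightarrow> f p q r s \<in> carrier A"
  shows "c \<odot> sum4 A f = sum4 A (\<lambda>p q r s. c \<odot> f p q r s)"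
  unfolding sum4_def using assms
  by (subst fsum_smult) (auto intro!: fsum_cong)

lemma sum4_mult_right:
  assumes "\<And>p q r s. \<lbrakk>p \<in> Ix; q \<in> Ix; r \<in> Ix; s \<in> Ix\<rbrakk> \<Longrightarrow> f p q r s \<in> carrier A"
    "x \<in> carrier A"
  shows "x \<otimes> sum4 A f = sum4 A (\<lambda>p q r s. x \<otimes> f p q r s)"
  unfolding sum4_def using assms
  by (subst fsum_mult_right) (auto intro!: fsum_cong)

lemma sum3_mult_right:
  assumes "\<And>p q r. p \<in> Ix \<Longrightarrow> q \<in> Ix \<Longrightarrow> r \<in> Ix \<Longrightarrow> f p q r \<in> carrier A"
    "x \<in> carrier A"
  shows "x \<otimes> sum3 A f = sum3 A (\<lambda>p q r. x \<otimes> f p q r)"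
  unfolding sum3_def using assms
  by (subst fsum_mult_right) (auto intro!: fsum_cong)

lemma sum4_scalars:
  assumes "x \<in> carrier A"
  shows "sum4 A (\<lambda>p q r s. c p q r s \<odot> x) = (\<Sum>(p, q, r, s)\<in>idx4. c p q r s) \<odot> x"
  using fsum_scalars[of idx4 x "\<lambda>(p, q, r, s). c p q r s"] assms
  by (simp add: sum4_def case_prod_unfold)

lemma sum4_exchange:
  assumes "\<And>p q r s i j k l. p \<in> Ix \<Longrightarrow> q \<in> Ix \<Longrightarrow> r \<in> Ix \<Longrightarrow> s \<in> Ix \<Longrightarrow>
      \<lbrakk>i \<in> Ix; j \<in> Ix; k \<in> Ix; l \<in> Ix\<rbrakk> \<Longrightarrow> f p q r s i j k l \<in> carrier A"
  shows "sum4 A (\<lambda>p q r s. sum4 A (f p q r s))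
    = sum4 A (\<lambda>i j k l. sum4 A (\<lambda>p q r s. f p q r s i j k l))"
  unfolding sum4_def case_prod_unfold
  by (rule fsum_swap) (use assms in auto)

lemma sum4_prod:
  assumes "\<And>p. p \<in> Ix \<Longrightarrow> f p \<in> carrier A" "\<And>p. p \<in> Ix \<Longrightarrow> g p \<in> carrier A"
    "\<And>p. p \<in> Ix \<Longrightarrow> h p \<in> carrier A" "\<And>p. p \<in> Ix \<Longrightarrow> k p \<in> carrier A"
  shows "(\<Oplus>p\<in>Ix. f p) \<otimes> (\<Oplus>q\<in>Ix. g q) \<otimes> (\<Oplus>r\<in>Ix. h r) \<otimes> (\<Oplus>s\<in>Ix. k s)
    = sum4 A (\<lambda>p q r s. f p \<otimes> g q \<otimes> h r \<otimes> k s)"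
proof -
  \<comment> \<open>Distributing the left-associated product leaves the sum of the last factor
    outermost; the indices are reversed to match this nesting.\<close>
  have "sum4 A (\<lambda>p q r s. f p \<otimes> g q \<otimes> h r \<otimes> k s) = sum4 A (\<lambda>p q r s. f s \<otimes> g r \<otimes> h q \<otimes> k p)"
    by (rule sum4_swaps(4)) (use assms in simp)
  then show ?thesis
    using assms by (simp add: sum4_nested fsum_mult_left fsum_mult_right cong: finsum_cong)
qed

end

text \<open>The relations of M on a matrix over an arbitrary algebra. Such matrices are the data of
  homomorphisms out of \<open>M_alg\<close>, so everything proved here applies to M, SL, Sp, tensor
  squares and opposite algebras alike.\<close>

locale twisted_matrix = complex_algebra A for A (structure) +
  fixes \<theta> :: real and a :: "nat \<Rightarrow> nat \<Rightarrow> 'a"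
  assumes entry_closed [simp]: "i \<in> Ix \<Longrightarrow> j \<in> Ix \<Longrightarrow> a i j \<in> carrier A"
    and twisted_comm: "\<lbrakk>i \<in> Ix; j \<in> Ix; k \<in> Ix; l \<in> Ix\<rbrakk> \<Longrightarrow>
      a i j \<otimes> a k l = (\<eta> \<theta> k i * \<eta> \<theta> j l) \<odot> (a k l \<otimes> a i j)"
begin

definition row_det :: "nat \<Rightarrow> nat \<Rightarrow> nat \<Rightarrow> nat \<Rightarrow> 'a" where
  "row_det i j k l = sum4 A (\<lambda>p q r s. twisted_lc \<theta> p q r s \<odot> (a i p \<otimes> a j q \<otimes> a k r \<otimes> a l s))"

lemma row_det_closed [simp]:
  "\<lbrakk>i \<in> Ix; j \<in> Ix; k \<in> Ix; l \<in> Ix\<rbrakk> \<Longrightarrow> row_det i j k l \<in> carrier A"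
  by (simp add: row_det_def)

lemma twisted_comm_left:
  "\<lbrakk>i \<in> Ix; j \<in> Ix; k \<in> Ix; l \<in> Ix; x \<in> carrier A\<rbrakk> \<Longrightarrow>
    a i j \<otimes> (a k l \<otimes> x) = (\<eta> \<theta> k i * \<eta> \<theta> j l) \<odot> (a k l \<otimes> (a i j \<otimes> x))"
  using twisted_comm[of i j k l] by (simp flip: m_assoc)

text \<open>Commuting the neighbouring factors in rows \<open>i\<close>, \<open>j\<close> and
  columns \<open>p\<close>, \<open>q\<close> produces
  \<open>\<eta> \<theta> j i * \<eta> \<theta> p q\<close>. After the columns are renamed, twisted
  antisymmetry turns the second factor into a sign, and the first is left in front of the
  sum.\<close>

lemma row_det_swap:
  assumes "i \<in> Ix" "j \<in> Ix" "k \<in> Ix" "l \<in> Ix"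
  shows "row_det i j k l = (- \<eta> \<theta> j i) \<odot> row_det j i k l" (is ?g1)
    "row_det i j k l = (- \<eta> \<theta> k j) \<odot> row_det i k j l" (is ?g2)
    "row_det i j k l = (- \<eta> \<theta> l k) \<odot> row_det i j l k" (is ?g3)
proof -
  have "row_det i j k l = sum4 A (\<lambda>p q r s. (twisted_lc \<theta> p q r s * \<eta> \<theta> p q * \<eta> \<theta> j i) \<odot>
      (a j q \<otimes> a i p \<otimes> a k r \<otimes> a l s))"
    unfolding row_det_def using assms
    by (intro sum4_cong) (simp_all add: m_assoc twisted_comm_left[of i _ j] mult.assoc mult.commute[of "\<eta> \<theta> j i"])
  also have "\<dots> = sum4 A (\<lambda>p q r s. (twisted_lc \<theta> q p r s * \<eta> \<theta> q p * \<eta> \<theta> j i) \<odot>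
      (a j p \<otimes> a i q \<otimes> a k r \<otimes> a l s))"
    by (rule sum4_swaps(1)) (use assms in simp)
  also have "\<dots> = (- \<eta> \<theta> j i) \<odot> row_det j i k l"
    unfolding row_det_def using assms
    by (subst sum4_smult, simp, intro sum4_cong) (simp_all add: twisted_lc_swap mult.commute[of "\<eta> \<theta> j i"])
  finally show ?g1 .
  have "row_det i j k l = sum4 A (\<lambda>p q r s. (twisted_lc \<theta> p q r s * \<eta> \<theta> q r * \<eta> \<theta> k j) \<odot>
      (a i p \<otimes> a k r \<otimes> a j q \<otimes> a l s))"
    unfolding row_det_def using assms
    by (intro sum4_cong) (simp_all add: m_assoc twisted_comm_left[of j _ k] mult.assoc mult.commute[of "\<eta> \<theta> k j"])
  also have "\<dots> = sum4 A (\<lambda>p q r s. (twisted_lc \<theta> p r q s * \<eta> \<theta> r q * \<eta> \<theta> k j) \<odot>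
      (a i p \<otimes> a k q \<otimes> a j r \<otimes> a l s))"
    by (rule sum4_swaps(2)) (use assms in simp)
  also have "\<dots> = (- \<eta> \<theta> k j) \<odot> row_det i k j l"
    unfolding row_det_def using assms
    by (subst sum4_smult, simp, intro sum4_cong) (simp_all add: twisted_lc_swap' mult.commute[of "\<eta> \<theta> k j"])
  finally show ?g2 .
  have "row_det i j k l = sum4 A (\<lambda>p q r s. (twisted_lc \<theta> p q r s * \<eta> \<theta> r s * \<eta> \<theta> l k) \<odot>
      (a i p \<otimes> a j q \<otimes> a l s \<otimes> a k r))"
    unfolding row_det_def using assms
    by (intro sum4_cong) (simp_all add: m_assoc twisted_comm[of k _ l] mult.assoc mult.commute[of "\<eta> \<theta> l k"])
  also have "\<dots> = sum4 A (\<lambda>p q r s. (twisted_lc \<theta> p q s r * \<eta> \<theta> s r * \<eta> \<theta> l k) \<odot>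
      (a i p \<otimes> a j q \<otimes> a l r \<otimes> a k s))"
    by (rule sum4_swaps(3)) (use assms in simp)
  also have "\<dots> = (- \<eta> \<theta> l k) \<odot> row_det i j l k"
    unfolding row_det_def using assms
    by (subst sum4_smult, simp, intro sum4_cong) (simp_all add: twisted_lc_swap'' mult.commute[of "\<eta> \<theta> l k"])
  finally show ?g3 .
qed

lemma eq_neg_imp_zero: "x \<in> carrier A \<Longrightarrow> x = (-1) \<odot> x \<Longrightarrow> x = \<zero>"
proof -
  assume x: "x \<in> carrier A" "x = (-1) \<odot> x"
  then have "x \<oplus> x = (1 + (-1)) \<odot> x" by (subst smult_add_left) simp_all
  then have "2 \<odot> x = \<zero>" using x(1) smult_add_left[of x 1 1] by simp
  then have "(1 / 2) \<odot> (2 \<odot> x) = \<zero>" by simp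
  then show ?thesis using x(1) by simp
qed

text \<open>Row determinant and symbol transform alike under neighbouring exchanges, so the rows can
  be sorted. Equal neighbours make the determinant its own negative and hence zero, as the symbol
  is; strictly increasing rows can only be 1, 2, 3, 4.\<close>

lemma row_det_eq:
  assumes "i \<in> Ix" "j \<in> Ix" "k \<in> Ix" "l \<in> Ix"
  shows "row_det i j k l = twisted_lc \<theta> i j k l \<odot> row_det 1 2 3 4"
  using assms
\<comment> \<open>The rows are read as a number in base 5; exchanging a descending pair of
  neighbours lowers it.\<close>
proof (induction "i * 125 + j * 25 + k * 5 + l" arbitrary: i j k l rule: less_induct)
  case less
  note ix = less.prems
  note swap = row_det_swap[OF ix]
  have bd: "i \<le> 4" "j \<le> 4" "k \<le> 4" "l \<le> 4" "1 \<le> i"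
    using ix by (auto simp: index_cases)
  consider "i > j" | "j > k" | "k > l" | "i = j" | "j = k" | "k = l" | "i < j" "j < k" "k < l"
    by linarith
  then show ?case
  proof cases
    case 1
    then have "row_det j i k l = twisted_lc \<theta> j i k l \<odot> row_det 1 2 3 4"
      using ix bd by (intro less.hyps) auto
    then show ?thesis using swap(1) twisted_lc_swap[of i j k l \<theta>] ix
      by (simp add: mult.commute)
  next
    case 2
    then have "row_det i k j l = twisted_lc \<theta> i k j l \<odot> row_det 1 2 3 4"
      using ix bd by (intro less.hyps) auto
    then show ?thesis using swap(2) twisted_lc_swap'[of i j k l \<theta>] ix
      by (simp add: mult.commute)
  next
    case 3
    then have "row_det i j l k = twisted_lc \<theta> i j l k \<odot> row_det 1 2 3 4"
      using ix bd by (intro less.hyps) auto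
    then show ?thesis using swap(3) twisted_lc_swap''[of i j k l \<theta>] ix
      by (simp add: mult.commute)
  next
    case 4
    then show ?thesis using swap(1) ix eq_neg_imp_zero[of "row_det i j k l"] by simp
  next
    case 5
    then show ?thesis using swap(2) ix eq_neg_imp_zero[of "row_det i j k l"] by simp
  next
    case 6
    then show ?thesis using swap(3) ix eq_neg_imp_zero[of "row_det i j k l"] by simp
  next
    case 7
    then have "i = 1" "j = 2" "k = 3" "l = 4" using bd by linarith+
    then show ?thesis by simp
  qed
qed

text \<open>Transposition replaces the coefficient by its inverse, and reversing the products
  inverts it back.\<close>

lemma transpose_twisted: "twisted_matrix (op_algebra A) \<theta> (\<lambda>i j. a j i)"
proof (intro twisted_matrix.intro complex_algebra_op complex_algebra_axioms twisted_matrix_axioms.intro)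
  fix i j k l assume "i \<in> Ix" "j \<in> Ix" "k \<in> Ix" "l \<in> Ix"
  then show "a j i \<otimes>\<^bsub>op_algebra A\<^esub> a l k
      = (\<eta> \<theta> k i * \<eta> \<theta> j l) \<odot>\<^bsub>op_algebra A\<^esub> (a l k \<otimes>\<^bsub>op_algebra A\<^esub> a j i)"
    using twisted_comm[of l k j i] by (simp add: mult.commute)
qed simp

text \<open>Both sides are evaluations of one double sum over pairs of index quadruples, since
  $\varepsilon$ of a permutation and of its reversal multiply to \<open>1\<close>.\<close>

lemma row_det_transpose:
  "twisted_matrix.row_det (op_algebra A) \<theta> (\<lambda>i j. a j i) 1 2 3 4 = row_det 1 2 3 4"
proof -
  interpret T: twisted_matrix "op_algebra A" \<theta> "\<lambda>i j. a j i" by (rule transpose_twisted)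
  let ?m = "\<lambda>p q r s i j k l. a p i \<otimes> a q j \<otimes> a r k \<otimes> a s l"
  let ?S = "sum4 A (\<lambda>p q r s. sum4 A (\<lambda>i j k l.
    (twisted_lc \<theta> s r q p * twisted_lc \<theta> i j k l) \<odot> ?m p q r s i j k l))"
  let ?d = "row_det 1 2 3 4" and ?t = "T.row_det 1 2 3 4"
  have d: "?d \<in> carrier A" by simp
  have t: "?t \<in> carrier A" using T.row_det_closed[of 1 2 3 4] by simp
  have "?S = sum4 A (\<lambda>p q r s. (twisted_lc \<theta> p q r s * twisted_lc \<theta> s r q p) \<odot> ?d)"
  proof (rule sum4_cong)
    fix p q r s assume ix: "p \<in> Ix" "q \<in> Ix" "r \<in> Ix" "s \<in> Ix"
    have "sum4 A (\<lambda>i j k l. (twisted_lc \<theta> s r q p * twisted_lc \<theta> i j k l) \<odot> ?m p q r s i j k l)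
      = twisted_lc \<theta> s r q p \<odot> row_det p q r s"
      unfolding row_det_def using ix by (subst sum4_smult) (simp_all cong: sum4_cong_simp)
    then show "sum4 A (\<lambda>i j k l. (twisted_lc \<theta> s r q p * twisted_lc \<theta> i j k l) \<odot> ?m p q r s i j k l)
      = (twisted_lc \<theta> p q r s * twisted_lc \<theta> s r q p) \<odot> ?d"
      using row_det_eq[OF ix] d by (simp add: mult.commute)
  qed (use d in simp)
  also have "\<dots> = 24 \<odot> ?d" by (simp only: sum4_scalars[OF d] sum_twisted_lc_rev)
  finally have 1: "?S = 24 \<odot> ?d" .
  have "?S = sum4 A (\<lambda>i j k l. sum4 A (\<lambda>p q r s.
    (twisted_lc \<theta> s r q p * twisted_lc \<theta> i j k l) \<odot> ?m p q r s i j k l))"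
    by (rule sum4_exchange) simp
  also have "\<dots> = sum4 A (\<lambda>i j k l. (twisted_lc \<theta> i j k l * twisted_lc \<theta> l k j i) \<odot> ?t)"
  proof (rule sum4_cong)
    fix i j k l assume ix: "i \<in> Ix" "j \<in> Ix" "k \<in> Ix" "l \<in> Ix"
    \<comment> \<open>The opposite product reverses each monomial, so the columns have to be listed
      backwards and the row indices renamed to recover the monomials of the double sum.\<close>
    have "T.row_det l k j i = sum4 A (\<lambda>p q r s. twisted_lc \<theta> p q r s \<odot> ?m s r q p i j k l)"
      unfolding T.row_det_def sum34_op using ix by (intro sum4_cong) (simp_all add: m_assoc)
    also have "\<dots> = sum4 A (\<lambda>p q r s. twisted_lc \<theta> s r q p \<odot> ?m p q r s i j k l)"
      by (rule sum4_swaps(4)) (use ix in simp)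
    finally have "twisted_lc \<theta> i j k l \<odot> T.row_det l k j i
      = sum4 A (\<lambda>p q r s. (twisted_lc \<theta> s r q p * twisted_lc \<theta> i j k l) \<odot> ?m p q r s i j k l)"
      using ix by (simp add: sum4_smult mult.commute cong: sum4_cong_simp)
    then show "sum4 A (\<lambda>p q r s. (twisted_lc \<theta> s r q p * twisted_lc \<theta> i j k l) \<odot> ?m p q r s i j k l)
      = (twisted_lc \<theta> i j k l * twisted_lc \<theta> l k j i) \<odot> ?t"
      using T.row_det_eq[OF ix(4,3,2,1)] t by simp
  qed (use t in simp)
  also have "\<dots> = 24 \<odot> ?t" by (simp only: sum4_scalars[OF t] sum_twisted_lc_rev)
  finally have "24 \<odot> ?d = 24 \<odot> ?t" using 1 by simp
  \<comment> \<open>The number of permutations is invertible in the scalars.\<close>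
  then have "(1 / 24) \<odot> (24 \<odot> ?d) = (1 / 24) \<odot> (24 \<odot> ?t)" by simp
  then show ?thesis using d t by simp
qed

text \<open>The candidate for the inverse matrix, with its indices already transposed: row
  \<open>i\<close> and column \<open>l\<close> are removed. Putting \<open>l\<close> first in the
  symbol takes care of the \<eta> factors that appear in \<open>SL_hat\<close>.\<close>

definition cofactor :: "nat \<Rightarrow> nat \<Rightarrow> 'a" where
  "cofactor l i = ((-1) ^ (i + 1)) \<odot> sum3 A (\<lambda>x y z. twisted_lc \<theta> l x y z \<odot>
     (a (rest i 0) x \<otimes> a (rest i 1) y \<otimes> a (rest i 2) z))"

lemma cofactor_closed [simp]: "l \<in> Ix \<Longrightarrow> i \<in> Ix \<Longrightarrow> cofactor l i \<in> carrier A"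
  by (simp add: cofactor_def)

text \<open>Laplace expansion: the sum reassembles the determinant of row \<open>j\<close> followed
  by the rows other than \<open>i\<close>, and \<open>row_det_eq\<close> evaluates it.\<close>

lemma mult_cofactor:
  assumes ix: "j \<in> Ix" "i \<in> Ix"
  shows "(\<Oplus>l\<in>Ix. a j l \<otimes> cofactor l i) = (if j = i then row_det 1 2 3 4 else \<zero>)"
proof -
  let ?r = "rest i"
  have r: "?r 0 \<in> Ix" "?r 1 \<in> Ix" "?r 2 \<in> Ix" "?r (Suc 0) \<in> Ix" using ix by simp_all
  have "(\<Oplus>l\<in>Ix. a j l \<otimes> cofactor l i) = (\<Oplus>l\<in>Ix. (-1) ^ (i + 1) \<odot> sum3 A (\<lambda>x y z.
      twisted_lc \<theta> l x y z \<odot> (a j l \<otimes> a (?r 0) x \<otimes> a (?r 1) y \<otimes> a (?r 2) z)))"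
  proof (rule fsum_cong)
    fix l assume l: "l \<in> Ix"
    show "a j l \<otimes> cofactor l i = (-1) ^ (i + 1) \<odot> sum3 A (\<lambda>x y z.
      twisted_lc \<theta> l x y z \<odot> (a j l \<otimes> a (?r 0) x \<otimes> a (?r 1) y \<otimes> a (?r 2) z))"
      unfolding cofactor_def using l ix r
      by (simp add: sum3_mult_right m_assoc cong: sum3_cong_simp)
  qed (use ix r in simp)
  also have "\<dots> = (-1) ^ (i + 1) \<odot> row_det j (?r 0) (?r 1) (?r 2)"
    unfolding row_det_def using ix r by (subst sum4_eq_sum3) (simp_all add: fsum_smult)
  also have "\<dots> = ((-1) ^ (i + 1) * twisted_lc \<theta> j (?r 0) (?r 1) (?r 2)) \<odot> row_det 1 2 3 4"
    using ix r by (subst row_det_eq) simp_all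
  also have "\<dots> = (if j = i then row_det 1 2 3 4 else \<zero>)"
    unfolding twisted_lc_rest[OF ix(2,1)] by simp
  finally show ?thesis .
qed

end

text \<open>The computation \<open>b = b (a c) = (b a) c = c\<close> uses only associativity. It
  serves to identify inverses that are obtained from different formulas.\<close>

lemma (in complex_algebra) matrix_inverse_unique:
  assumes closed: "\<And>i j. i \<in> I \<Longrightarrow> j \<in> I \<Longrightarrow> a i j \<in> carrier A \<and> b i j \<in> carrier A \<and> c i j \<in> carrier A"
    and I: "finite I" "i \<in> I" "j \<in> I"
    and left: "\<And>i j. i \<in> I \<Longrightarrow> j \<in> I \<Longrightarrow> (\<Oplus>k\<in>I. b i k \<otimes> a k j) = (if i = j then \<one> else \<zero>)"
    and right: "\<And>i j. i \<in> I \<Longrightarrow> j \<in> I \<Longrightarrow> (\<Oplus>k\<in>I. a i k \<otimes> c k j) = (if i = j then \<one> else \<zero>)"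
  shows "b i j = c i j"
proof -
  have "b i j = (\<Oplus>k\<in>I. b i k \<otimes> (\<Oplus>m\<in>I. a k m \<otimes> c m j))"
    using fsum_eq_single[of I j "\<lambda>k. b i k \<otimes> (\<Oplus>m\<in>I. a k m \<otimes> c m j)"] I closed right by simp
  also have "\<dots> = (\<Oplus>k\<in>I. \<Oplus>m\<in>I. b i k \<otimes> a k m \<otimes> c m j)"
    using I closed by (simp add: fsum_mult_right m_assoc cong: finsum_cong)
  also have "\<dots> = (\<Oplus>m\<in>I. \<Oplus>k\<in>I. b i k \<otimes> a k m \<otimes> c m j)"
    using I closed by (intro fsum_swap) simp_all
  also have "\<dots> = (\<Oplus>m\<in>I. (\<Oplus>k\<in>I. b i k \<otimes> a k m) \<otimes> c m j)"
    using I closed by (intro fsum_cong) (simp_all add: fsum_mult_left)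
  also have "\<dots> = c i j"
    using fsum_eq_single[of I i "\<lambda>m. (\<Oplus>k\<in>I. b i k \<otimes> a k m) \<otimes> c m j"] I closed left by simp
  finally show ?thesis .
qed

locale special_twisted_matrix = twisted_matrix +
  assumes det_one: "row_det 1 2 3 4 = \<one>"
begin

lemma row_det_special:
  "\<lbrakk>i \<in> Ix; j \<in> Ix; k \<in> Ix; l \<in> Ix\<rbrakk> \<Longrightarrow> row_det i j k l = twisted_lc \<theta> i j k l \<odot> \<one>"
  using row_det_eq[of i j k l] det_one by simp

lemma cofactor_right:
  "i \<in> Ix \<Longrightarrow> j \<in> Ix \<Longrightarrow> (\<Oplus>k\<in>Ix. a i k \<otimes> cofactor k j) = (if i = j then \<one> else \<zero>)"
  using mult_cofactor[of i j] det_one by simp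

text \<open>Laplace expansion of the transposed matrix over the opposite algebra gives a left
  inverse, because the column determinant is also 1. A left and a right inverse coincide.\<close>

lemma cofactor_left:
  assumes "i \<in> Ix" "j \<in> Ix"
  shows "(\<Oplus>k\<in>Ix. cofactor i k \<otimes> a k j) = (if i = j then \<one> else \<zero>)"
proof -
  interpret T: twisted_matrix "op_algebra A" \<theta> "\<lambda>i j. a j i" by (rule transpose_twisted)
  let ?b = "\<lambda>i k. T.cofactor k i"
  have b: "?b i k \<in> carrier A" if "i \<in> Ix" "k \<in> Ix" for i k
    using T.cofactor_closed[of k i] that by simp
  have left: "(\<Oplus>k\<in>Ix. ?b i k \<otimes> a k j) = (if i = j then \<one> else \<zero>)" if "i \<in> Ix" "j \<in> Ix" for i j
    using T.mult_cofactor[OF that(2,1)] row_det_transpose det_one by auto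
  have "cofactor i k = ?b i k" if "i \<in> Ix" "k \<in> Ix" for i k
    by (rule matrix_inverse_unique[of Ix a ?b cofactor i k, symmetric])
      (use that b left cofactor_right in auto)
  then show ?thesis using left[OF assms] assms b by (simp cong: finsum_cong)
qed

text \<open>In matrix form, with \<open>U\<close> and \<open>V\<close> the diagonal matrices of the
  weights and \<open>C\<close> the inverse of \<open>a\<close>: the hypothesis reads
  \<open>U x a = a x V\<close>, and multiplication by \<open>C\<close> on both sides gives
  \<open>C U x = x V C\<close>. The two evaluations of the double sum are these two sides.\<close>

lemma cofactor_intertwine:
  assumes ix: "k \<in> Ix" "l \<in> Ix" and x: "x \<in> carrier A"
    and comm: "\<And>p s. p \<in> Ix \<Longrightarrow> s \<in> Ix \<Longrightarrow> u p \<odot> (x \<otimes> a p s) = v s \<odot> (a p s \<otimes> x)"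
  shows "u l \<odot> (cofactor k l \<otimes> x) = v k \<odot> (x \<otimes> cofactor k l)"
proof -
  have "(\<Oplus>p\<in>Ix. \<Oplus>s\<in>Ix. u p \<odot> (cofactor k p \<otimes> (x \<otimes> (a p s \<otimes> cofactor s l))))
      = (\<Oplus>p\<in>Ix. u p \<odot> (cofactor k p \<otimes> (x \<otimes> (\<Oplus>s\<in>Ix. a p s \<otimes> cofactor s l))))"
    using ix x by (intro fsum_cong) (simp_all add: fsum_mult_right fsum_smult)
  also have "\<dots> = u l \<odot> (cofactor k l \<otimes> x)"
    using fsum_eq_single[of Ix l "\<lambda>p. u p \<odot> (cofactor k p \<otimes> (x \<otimes> (\<Oplus>s\<in>Ix. a p s \<otimes> cofactor s l)))"] ix x
    by (simp add: cofactor_right)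
  finally have 1: "(\<Oplus>p\<in>Ix. \<Oplus>s\<in>Ix. u p \<odot> (cofactor k p \<otimes> (x \<otimes> (a p s \<otimes> cofactor s l))))
      = u l \<odot> (cofactor k l \<otimes> x)" .
  have "u p \<odot> (cofactor k p \<otimes> (x \<otimes> (a p s \<otimes> cofactor s l)))
      = v s \<odot> (cofactor k p \<otimes> a p s \<otimes> (x \<otimes> cofactor s l))" if "p \<in> Ix" "s \<in> Ix" for p s
  proof -
    have "u p \<odot> (cofactor k p \<otimes> (x \<otimes> (a p s \<otimes> cofactor s l)))
        = cofactor k p \<otimes> (u p \<odot> (x \<otimes> a p s)) \<otimes> cofactor s l"
      using ix x that by (simp add: m_assoc)
    then show ?thesis unfolding comm[OF that] using ix x that by (simp add: m_assoc)
  qed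
  then have "(\<Oplus>p\<in>Ix. \<Oplus>s\<in>Ix. u p \<odot> (cofactor k p \<otimes> (x \<otimes> (a p s \<otimes> cofactor s l))))
      = (\<Oplus>p\<in>Ix. \<Oplus>s\<in>Ix. v s \<odot> (cofactor k p \<otimes> a p s \<otimes> (x \<otimes> cofactor s l)))"
    using ix x by (intro fsum_cong) simp_all
  also have "\<dots> = (\<Oplus>s\<in>Ix. \<Oplus>p\<in>Ix. v s \<odot> (cofactor k p \<otimes> a p s \<otimes> (x \<otimes> cofactor s l)))"
    using ix x by (intro fsum_swap) simp_all
  also have "\<dots> = (\<Oplus>s\<in>Ix. v s \<odot> ((\<Oplus>p\<in>Ix. cofactor k p \<otimes> a p s) \<otimes> (x \<otimes> cofactor s l)))"
    using ix x by (intro fsum_cong) (simp_all add: fsum_mult_left fsum_smult)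
  also have "\<dots> = v k \<odot> (x \<otimes> cofactor k l)"
    using fsum_eq_single[of Ix k "\<lambda>s. v s \<odot> ((\<Oplus>p\<in>Ix. cofactor k p \<otimes> a p s) \<otimes> (x \<otimes> cofactor s l))"] ix x
    by (simp add: cofactor_left)
  finally show ?thesis using 1 by simp
qed

text \<open>\<open>cofactor_intertwine\<close> is used twice: with \<open>x\<close> an entry it
  turns the relations between entries into relations between cofactors and entries, and with
  \<open>x\<close> a cofactor it turns those into relations between cofactors.\<close>

lemma cofactor_comm:
  assumes ix: "i \<in> Ix" "j \<in> Ix" "k \<in> Ix" "l \<in> Ix"
  shows "cofactor k l \<otimes> cofactor i j = (\<eta> \<theta> k i * \<eta> \<theta> j l) \<odot> (cofactor i j \<otimes> cofactor k l)"
proof -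
  have entry: "\<eta> \<theta> q l \<odot> (cofactor k l \<otimes> a q r) = \<eta> \<theta> r k \<odot> (a q r \<otimes> cofactor k l)"
    if qr: "q \<in> Ix" "r \<in> Ix" for q r
  proof (rule cofactor_intertwine[OF ix(3,4)])
    fix p s assume "p \<in> Ix" "s \<in> Ix"
    then show "\<eta> \<theta> q p \<odot> (a q r \<otimes> a p s) = \<eta> \<theta> r s \<odot> (a p s \<otimes> a q r)"
      using twisted_comm[of q r p s] qr \<eta>_mult[of q p \<theta>] by (simp flip: mult.assoc)
  qed (use qr in simp)
  have "\<eta> \<theta> j l \<odot> (cofactor i j \<otimes> cofactor k l) = \<eta> \<theta> i k \<odot> (cofactor k l \<otimes> cofactor i j)"
    by (rule cofactor_intertwine[where u = "\<lambda>q. \<eta> \<theta> q l" and v = "\<lambda>r. \<eta> \<theta> r k"])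
      (use ix entry in simp_all)
  then have "\<eta> \<theta> k i \<odot> (\<eta> \<theta> i k \<odot> (cofactor k l \<otimes> cofactor i j))
      = \<eta> \<theta> k i \<odot> (\<eta> \<theta> j l \<odot> (cofactor i j \<otimes> cofactor k l))"
    by simp
  then show ?thesis using ix by simp
qed

lemma cofactor_twisted: "twisted_matrix (op_algebra A) \<theta> cofactor"
proof (intro twisted_matrix.intro complex_algebra_op complex_algebra_axioms twisted_matrix_axioms.intro)
  fix i j k l assume "i \<in> Ix" "j \<in> Ix" "k \<in> Ix" "l \<in> Ix"
  then show "cofactor i j \<otimes>\<^bsub>op_algebra A\<^esub> cofactor k l = (\<eta> \<theta> k i * \<eta> \<theta> j l)
      \<odot>\<^bsub>op_algebra A\<^esub> (cofactor k l \<otimes>\<^bsub>op_algebra A\<^esub> cofactor i j)"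
    using cofactor_comm[of i j k l] by simp
qed simp

lemma cofactor_special: "special_twisted_matrix (op_algebra A) \<theta> cofactor"
proof -
  interpret C: twisted_matrix "op_algebra A" \<theta> cofactor by (rule cofactor_twisted)
  let ?c = cofactor
  let ?m = "\<lambda>p q r s. ?c 4 s \<otimes> (?c 3 r \<otimes> (?c 2 q \<otimes> ?c 1 p))"
  let ?n = "\<lambda>p q r s i j k l. a p i \<otimes> a q j \<otimes> a r k \<otimes> a s l"
  \<comment> \<open>The product collapses from the middle outwards: the sum over \<open>p\<close> of
    \<open>?c 1 p \<otimes> a p i\<close> is 1 or 0, which brings \<open>?c 2 q\<close> next to
    \<open>a q j\<close>, and so on.\<close>
  have inner: "sum4 A (\<lambda>p q r s. ?m p q r s \<otimes> ?n p q r s i j k l)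
      = (if i = 1 \<and> j = 2 \<and> k = 3 \<and> l = 4 then \<one> else \<zero>)"
    if ix: "i \<in> Ix" "j \<in> Ix" "k \<in> Ix" "l \<in> Ix" for i j k l
  proof -
    have s: "(\<Oplus>q\<in>Ix. ?c m q \<otimes> (x \<otimes> a q n)) = (if m = n then x else \<zero>)"
      if "x = \<one> \<or> x = \<zero>" "m \<in> Ix" "n \<in> Ix" for x m n
    proof (cases "x = \<one>")
      case True
      then show ?thesis using that cofactor_left[of m n] by (simp cong: finsum_cong)
    next
      case False
      then have "x = \<zero>" using that(1) by simp
      then show ?thesis using that by (simp cong: finsum_cong)
    qed
    have e: "sum4 A (\<lambda>p q r s. ?m p q r s \<otimes> ?n p q r s i j k l)
        = sum4 A (\<lambda>s r q p. ?m p q r s \<otimes> ?n p q r s i j k l)"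
      by (rule sum4_swaps(4)) (use ix in simp)
    also have "\<dots> = (\<Oplus>s\<in>Ix. ?c 4 s \<otimes> ((\<Oplus>r\<in>Ix. ?c 3 r \<otimes> ((\<Oplus>q\<in>Ix. ?c 2 q \<otimes> ((\<Oplus>p\<in>Ix. ?c 1 p \<otimes> a p i)
        \<otimes> a q j)) \<otimes> a r k)) \<otimes> a s l))"
      using ix by (simp add: sum4_nested fsum_mult_left fsum_mult_right m_assoc cong: finsum_cong)
    also have "\<dots> = (if i = 1 \<and> j = 2 \<and> k = 3 \<and> l = 4 then \<one> else \<zero>)"
      using ix by (simp add: cofactor_left s)
    finally show ?thesis .
  qed
  have "C.row_det 1 2 3 4 = sum4 A (\<lambda>p q r s. twisted_lc \<theta> p q r s \<odot> ?m p q r s)"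
    by (simp add: C.row_det_def)
  \<comment> \<open>The scalar \<open>twisted_lc \<theta> p q r s\<close> is replaced by the row
    determinant it equals. This inserts four entries of \<open>a\<close> behind the four
    cofactors.\<close>
  also have "\<dots> = sum4 A (\<lambda>p q r s. ?m p q r s \<otimes> row_det p q r s)"
    by (intro sum4_cong) (simp_all add: row_det_special)
  also have "\<dots> = sum4 A (\<lambda>p q r s. sum4 A (\<lambda>i j k l.
      twisted_lc \<theta> i j k l \<odot> (?m p q r s \<otimes> ?n p q r s i j k l)))"
    by (intro sum4_cong) (simp_all add: row_det_def sum4_mult_right cong: sum4_cong_simp)
  also have "\<dots> = sum4 A (\<lambda>i j k l. sum4 A (\<lambda>p q r s.
      twisted_lc \<theta> i j k l \<odot> (?m p q r s \<otimes> ?n p q r s i j k l)))"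
    by (rule sum4_exchange) simp
  \<comment> \<open>Only the columns 1, 2, 3, 4 survive the contraction, and there the symbol is
    1.\<close>
  also have "\<dots> = sum4 A (\<lambda>i j k l. (if i = 1 \<and> j = 2 \<and> k = 3 \<and> l = 4 then 1 else 0) \<odot> \<one>)"
  proof (rule sum4_cong)
    fix i j k l assume ix: "i \<in> Ix" "j \<in> Ix" "k \<in> Ix" "l \<in> Ix"
    have "sum4 A (\<lambda>p q r s. twisted_lc \<theta> i j k l \<odot> (?m p q r s \<otimes> ?n p q r s i j k l))
        = twisted_lc \<theta> i j k l \<odot> sum4 A (\<lambda>p q r s. ?m p q r s \<otimes> ?n p q r s i j k l)"
      by (rule sum4_smult[symmetric]) (use ix in simp)
    then show "sum4 A (\<lambda>p q r s. twisted_lc \<theta> i j k l \<odot> (?m p q r s \<otimes> ?n p q r s i j k l))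
        = (if i = 1 \<and> j = 2 \<and> k = 3 \<and> l = 4 then 1 else 0) \<odot> \<one>"
      unfolding inner[OF ix] by simp
  qed simp
  also have "\<dots> = (\<Sum>(i, j, k, l)\<in>idx4. if i = 1 \<and> j = 2 \<and> k = 3 \<and> l = 4 then 1 else 0) \<odot> \<one>"
    by (rule sum4_scalars) simp
  also have "(\<Sum>(i, j, k, l)\<in>idx4. if i = 1 \<and> j = 2 \<and> k = 3 \<and> l = 4 then 1 else (0::complex))
      = (\<Sum>u\<in>idx4. if u = (1, 2, 3, 4) then 1 else 0)"
    by (intro sum.cong) (auto split: if_splits)
  also have "\<dots> = 1" by (simp add: sum.delta)
  finally show ?thesis
    by (intro special_twisted_matrix.intro cofactor_twisted special_twisted_matrix_axioms.intro) simp
qed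

end

text \<open>The matrix of coproducts is again a point of SL. For the determinant, the sum over the
  outer columns forms row determinants in the second factor; these are symbols times 1, and what
  remains is the determinant in the first factor.\<close>

lemma tensor_square_special:
  fixes A (structure)
  assumes "special_twisted_matrix A \<theta> a"
  shows "special_twisted_matrix (tensor A A) \<theta>
    (\<lambda>i j. \<Oplus>\<^bsub>tensor A A\<^esub>k\<in>Ix. pure_tensor A A (a i k) (a k j))"
proof -
  interpret special_twisted_matrix A \<theta> a by fact
  interpret AA: tensor_product A A by unfold_locales
  let ?T = "tensor A A"
  let ?b = "\<lambda>i j. \<Oplus>\<^bsub>?T\<^esub>k\<in>Ix. AA.pure (a i k) (a k j)"
  have b: "twisted_matrix ?T \<theta> ?b"
  proof (intro twisted_matrix.intro AA.T.complex_algebra_axioms twisted_matrix_axioms.intro)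
    fix i j p l assume ix: "i \<in> Ix" "j \<in> Ix" "p \<in> Ix" "l \<in> Ix"
    show "?b i j \<in> carrier ?T" using ix by simp
    have e: "?b i j \<otimes>\<^bsub>?T\<^esub> ?b p l
        = (\<Oplus>\<^bsub>?T\<^esub>m\<in>Ix. \<Oplus>\<^bsub>?T\<^esub>k\<in>Ix. AA.pure (a i k \<otimes> a p m) (a k j \<otimes> a m l))"
      if "i \<in> Ix" "j \<in> Ix" "p \<in> Ix" "l \<in> Ix" for i j p l
      using that by (simp add: AA.T.fsum_mult_left AA.T.fsum_mult_right AA.pure_mult cong: AA.T.finsum_cong)
    have t: "AA.pure (a i k \<otimes> a p m) (a k j \<otimes> a m l) = (\<eta> \<theta> p i * \<eta> \<theta> j l) \<odot>\<^bsub>?T\<^esub>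
        AA.pure (a p m \<otimes> a i k) (a m l \<otimes> a k j)" if "k \<in> Ix" "m \<in> Ix" for k m
    proof -
      have "AA.pure (a i k \<otimes> a p m) (a k j \<otimes> a m l)
          = AA.pure ((\<eta> \<theta> p i * \<eta> \<theta> k m) \<odot> (a p m \<otimes> a i k)) ((\<eta> \<theta> m k * \<eta> \<theta> j l) \<odot> (a m l \<otimes> a k j))"
        using ix that twisted_comm[of i k p m] twisted_comm[of k j m l] by simp
      \<comment> \<open>The summation index is a column on the left and a row on the right, so its
        two \<eta> factors are inverse to each other.\<close>
      also have "\<dots> = (\<eta> \<theta> p i * (\<eta> \<theta> k m * \<eta> \<theta> m k) * \<eta> \<theta> j l) \<odot>\<^bsub>?T\<^esub>
          AA.pure (a p m \<otimes> a i k) (a m l \<otimes> a k j)"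
        using ix that by (simp add: AA.pureD mult_ac del: \<eta>_mult)
      also have "\<eta> \<theta> p i * (\<eta> \<theta> k m * \<eta> \<theta> m k) * \<eta> \<theta> j l = \<eta> \<theta> p i * \<eta> \<theta> j l"
        using that by simp
      finally show ?thesis .
    qed
    have "?b i j \<otimes>\<^bsub>?T\<^esub> ?b p l = (\<eta> \<theta> p i * \<eta> \<theta> j l) \<odot>\<^bsub>?T\<^esub>
        (\<Oplus>\<^bsub>?T\<^esub>m\<in>Ix. \<Oplus>\<^bsub>?T\<^esub>k\<in>Ix. AA.pure (a p m \<otimes> a i k) (a m l \<otimes> a k j))"
      unfolding e[OF ix] using ix by (simp add: t AA.T.fsum_smult cong: AA.T.finsum_cong)
    also have "(\<Oplus>\<^bsub>?T\<^esub>m\<in>Ix. \<Oplus>\<^bsub>?T\<^esub>k\<in>Ix. AA.pure (a p m \<otimes> a i k) (a m l \<otimes> a k j))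
        = ?b p l \<otimes>\<^bsub>?T\<^esub> ?b i j"
      unfolding e[OF ix(3,4,1,2)] using ix by (intro AA.T.fsum_swap) simp_all
    finally show "?b i j \<otimes>\<^bsub>?T\<^esub> ?b p l = (\<eta> \<theta> p i * \<eta> \<theta> j l) \<odot>\<^bsub>?T\<^esub> (?b p l \<otimes>\<^bsub>?T\<^esub> ?b i j)" .
  qed
  then interpret B: twisted_matrix ?T \<theta> ?b .
  let ?m = "\<lambda>p q r s. a 1 p \<otimes> a 2 q \<otimes> a 3 r \<otimes> a 4 s"
  let ?n = "\<lambda>p q r s i j k l. a p i \<otimes> a q j \<otimes> a r k \<otimes> a s l"
  have lin: "AA.pure x (sum4 A f) = sum4 ?T (\<lambda>p q r s. AA.pure x (f p q r s))"
    "AA.pure (sum4 A f) x = sum4 ?T (\<lambda>p q r s. AA.pure (f p q r s) x)"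
    if "x \<in> carrier A" and f: "\<And>p q r s. \<lbrakk>p \<in> Ix; q \<in> Ix; r \<in> Ix; s \<in> Ix\<rbrakk> \<Longrightarrow> f p q r s \<in> carrier A"
    for x f
  proof -
    have "AA.pure x \<in> linear_hom A ?T" "(\<lambda>y. AA.pure y x) \<in> linear_hom A ?T"
      using AA.pure_bilinear that(1) by (auto simp: bilinear_map_def)
    from this[THEN linear_hom_finsum[OF complex_algebra_axioms AA.T.complex_algebra_axioms], of idx4 "\<lambda>(p, q, r, s). f p q r s"]
    show "AA.pure x (sum4 A f) = sum4 ?T (\<lambda>p q r s. AA.pure x (f p q r s))"
      "AA.pure (sum4 A f) x = sum4 ?T (\<lambda>p q r s. AA.pure (f p q r s) x)"
      using f by (auto simp: sum4_def case_prod_unfold)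
  qed
  have "B.row_det 1 2 3 4 = sum4 ?T (\<lambda>i j k l. sum4 ?T (\<lambda>p q r s.
      twisted_lc \<theta> i j k l \<odot>\<^bsub>?T\<^esub> AA.pure (?m p q r s) (?n p q r s i j k l)))"
    unfolding B.row_det_def
    by (intro AA.T.sum4_cong) (simp_all add: AA.T.sum4_prod AA.pure_mult AA.T.sum4_smult cong: AA.T.sum4_cong_simp)
  also have "\<dots> = sum4 ?T (\<lambda>p q r s. sum4 ?T (\<lambda>i j k l.
      twisted_lc \<theta> i j k l \<odot>\<^bsub>?T\<^esub> AA.pure (?m p q r s) (?n p q r s i j k l)))"
    by (rule AA.T.sum4_exchange) simp
  also have "\<dots> = sum4 ?T (\<lambda>p q r s. AA.pure (?m p q r s) (row_det p q r s))"
    by (intro AA.T.sum4_cong) (simp_all add: row_det_def lin AA.pureD cong: AA.T.sum4_cong_simp)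
  also have "\<dots> = sum4 ?T (\<lambda>p q r s. AA.pure (twisted_lc \<theta> p q r s \<odot> ?m p q r s) \<one>)"
    by (intro AA.T.sum4_cong) (simp_all add: row_det_special AA.pureD)
  also have "\<dots> = AA.pure (row_det 1 2 3 4) \<one>"
    by (simp add: row_det_def lin)
  finally show ?thesis
    using b det_one AA.pure_one
    by (intro special_twisted_matrix.intro special_twisted_matrix_axioms.intro) simp_all
qed

section \<open>Sums over permutations\<close>

lemma permutes_of_lists:
  assumes "distinct xs" "distinct ys" "set ys = set xs"
  obtains \<sigma> where "\<sigma> permutes set xs" "map \<sigma> xs = ys"
proof -
  have len: "length xs = length ys" using assms by (metis distinct_card)
  define \<sigma> where "\<sigma> x = (case map_of (zip xs ys) x of Some y \<Rightarrow> y | None \<Rightarrow> x)" for x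
  have map: "map \<sigma> xs = ys"
    by (rule nth_equalityI) (use len assms(1) in \<open>simp_all add: \<sigma>_def map_of_zip_nth\<close>)
  then have "\<sigma> ` set xs = set xs" using assms(3) by (metis set_map)
  then have "bij_betw \<sigma> (set xs) (set xs)" by (simp add: bij_betw_def eq_card_imp_inj_on)
  moreover have "\<sigma> x = x" if "x \<notin> set xs" for x
  proof -
    have "map_of (zip xs ys) x = None" using map_of_zip_is_None[OF len] that by blast
    then show ?thesis by (simp add: \<sigma>_def)
  qed
  ultimately have "\<sigma> permutes set xs" by (rule bij_imp_permutes)
  then show thesis using map by (rule that)
qed

text \<open>Both sides are 1 at the identity and change sign under composition with a transposition
  on the right.\<close>

lemma sign_eq_sgn4:
  assumes "\<sigma> permutes Ix"
  shows "sign \<sigma> = sgn4 (\<sigma> 1) (\<sigma> 2) (\<sigma> 3) (\<sigma> 4)"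
  using finite_Ix assms
proof (induction \<sigma> rule: permutes_rev_induct)
  case id
  show ?case by (simp add: sgn4_def)
next
  case (swap a b p)
  have neg: "sgn (x - y) = - sgn (y - x)" for x y :: int
    by (simp add: sgn_if)
  have pos: "sgn4 (p (transpose a b 1)) (p (transpose a b 2)) (p (transpose a b 3)) (p (transpose a b 4))
      = - sgn4 (p 1) (p 2) (p 3) (p 4)"
    if "a < b" "a \<in> Ix" "b \<in> Ix" for a b
    using that unfolding index_cases
    by (elim disjE; hypsubst; simp add: transpose_def sgn4_def;
        simp add: neg[of "int (p (Suc 0))"] neg[of "int (p 2)" "int (p 3)"]
          neg[of "int (p 2)" "int (p 4)"] neg[of "int (p 3)" "int (p 4)"])
  have "sgn4 ((p \<circ> transpose a b) 1) ((p \<circ> transpose a b) 2) ((p \<circ> transpose a b) 3) ((p \<circ> transpose a b) 4)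
      = - sgn4 (p 1) (p 2) (p 3) (p 4)"
    using pos[of a b] pos[of b a] swap(1-3) by (cases "a < b") (simp_all add: transpose_commute)
  moreover have "sign (p \<circ> transpose a b) = - sign p"
    using swap permutes_imp_permutation[OF finite_Ix \<open>p permutes Ix\<close>]
    by (simp add: sign_compose sign_swap_id permutation_swap_id)
  ultimately show ?case using swap.IH by (simp only:)
qed

lemma sgn4_nondistinct: "\<not> distinct [p, q, r, s] \<Longrightarrow> sgn4 p q r s = 0"
  by (auto simp: sgn4_def)

lemma twisted_lc_nondistinct: "\<not> distinct [p, q, r, s] \<Longrightarrow> twisted_lc \<theta> p q r s = 0"
  unfolding twisted_lc_def by (subst sgn4_nondistinct) simp_all

lemma Ix_eq_list: "Ix = set [1, 2, 3, 4]"
  by (auto simp: index_cases)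

context complex_algebra
begin

text \<open>A permutation is determined by its four values, and these run exactly through the
  quadruples without repetition; on the others the summand vanishes by \<open>zero\<close>.\<close>

lemma fsum_permutations4:
  assumes closed: "\<And>p q r s. \<lbrakk>p \<in> Ix; q \<in> Ix; r \<in> Ix; s \<in> Ix\<rbrakk> \<Longrightarrow> f p q r s \<in> carrier A"
    and zero: "\<And>p q r s. p \<in> Ix \<Longrightarrow> q \<in> Ix \<Longrightarrow> r \<in> Ix \<Longrightarrow> s \<in> Ix \<Longrightarrow>
      \<not> distinct [p, q, r, s] \<Longrightarrow> f p q r s = \<zero>"
  shows "(\<Oplus>\<sigma>\<in>{\<sigma>. \<sigma> permutes Ix}. f (\<sigma> 1) (\<sigma> 2) (\<sigma> 3) (\<sigma> 4)) = sum4 A f"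
proof -
  let ?P = "{\<sigma>. \<sigma> permutes Ix}" and ?h = "\<lambda>\<sigma>. (\<sigma> 1, \<sigma> 2, \<sigma> 3, \<sigma> (4::nat)) :: nat \<times> nat \<times> nat \<times> nat"
  let ?f = "\<lambda>(p, q, r, s). f p q r s"
  let ?T = "{(p, q, r, s) \<in> idx4. distinct [p, q, r, s]}"
  have "\<sigma> = \<tau>" if "\<sigma> \<in> ?P" "\<tau> \<in> ?P" "?h \<sigma> = ?h \<tau>" for \<sigma> \<tau>
  proof
    fix x show "\<sigma> x = \<tau> x"
      using that permutes_not_in[of \<sigma> Ix x] permutes_not_in[of \<tau> Ix x] by (cases "x \<in> Ix") (auto simp: index_cases)
  qed
  then have inj: "inj_on ?h ?P" by (intro inj_onI) blast
  have image: "?h ` ?P = ?T"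
  proof (intro equalityI subsetI)
    fix u assume "u \<in> ?h ` ?P"
    then obtain \<sigma> where \<sigma>: "\<sigma> permutes Ix" "u = ?h \<sigma>" by blast
    have "inj \<sigma>" using permutes_inj \<sigma>(1) .
    then show "u \<in> ?T" using \<sigma> permutes_in_image[OF \<sigma>(1)] by (auto simp: inj_eq)
  next
    fix u assume "u \<in> ?T"
    then obtain p q r s where u: "u = (p, q, r, s)" and ix: "p \<in> Ix" "q \<in> Ix" "r \<in> Ix" "s \<in> Ix"
      and d: "distinct [p, q, r, s]" by auto
    have "set [p, q, r, s] = set [1, 2, 3, 4]"
      by (rule card_subset_eq) (use ix d distinct_card[OF d] in \<open>auto simp: index_cases\<close>)
    moreover have "distinct [1, 2, 3, 4 :: nat]" by simp
    ultimately obtain \<sigma> where "\<sigma> permutes set [1, 2, 3, 4]" "map \<sigma> [1, 2, 3, 4] = [p, q, r, s]"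
      using permutes_of_lists d by blast
    then have "\<sigma> permutes Ix" "u = ?h \<sigma>" unfolding u Ix_eq_list by simp_all
    then show "u \<in> ?h ` ?P" by blast
  qed
  have "(\<Oplus>\<sigma>\<in>?P. ?f (?h \<sigma>)) = finsum A ?f (?h ` ?P)"
    by (rule finsum_reindex[symmetric]) (use inj closed image in auto)
  also have "\<dots> = finsum A ?f idx4"
    unfolding image by (rule add.finprod_mono_neutral_cong_left) (use closed zero in auto)
  finally show ?thesis by (simp add: sum4_def)
qed

lemma fsum_permutations3:
  assumes l: "l \<in> Ix"
    and closed: "\<And>x y z. x \<in> Ix \<Longrightarrow> y \<in> Ix \<Longrightarrow> z \<in> Ix \<Longrightarrow> f x y z \<in> carrier A"
    and zero: "\<And>x y z. x \<in> Ix \<Longrightarrow> y \<in> Ix \<Longrightarrow> z \<in> Ix \<Longrightarrow>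
      \<not> distinct [l, x, y, z] \<Longrightarrow> f x y z = \<zero>"
  shows "(\<Oplus>\<sigma>\<in>{\<sigma>. \<sigma> permutes (Ix - {l})}. f (\<sigma> (rest l 0)) (\<sigma> (rest l 1)) (\<sigma> (rest l 2))) = sum3 A f"
proof -
  let ?P = "{\<sigma>. \<sigma> permutes (Ix - {l})}"
  let ?h = "\<lambda>\<sigma>. (\<sigma> (rest l 0), \<sigma> (rest l 1), \<sigma> (rest l 2)) :: nat \<times> nat \<times> nat"
  let ?f = "\<lambda>(x, y, z). f x y z"
  let ?T = "{(x, y, z) \<in> Ix \<times> Ix \<times> Ix. distinct [l, x, y, z]}"
  let ?xs = "[rest l 0, rest l 1, rest l 2]"
  have xs: "distinct ?xs" "set ?xs = Ix - {l}"
    using l unfolding index_cases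
    by (elim disjE; force simp: rest_def index_cases)+
  have "\<sigma> = \<tau>" if "\<sigma> \<in> ?P" "\<tau> \<in> ?P" "?h \<sigma> = ?h \<tau>" for \<sigma> \<tau>
  proof
    fix x show "\<sigma> x = \<tau> x"
    proof (cases "x \<in> Ix - {l}")
      case True
      then have "x \<in> set ?xs" using xs(2) by blast
      then show ?thesis using that(3) by auto
    next
      case False
      then show ?thesis using that permutes_not_in[of \<sigma> "Ix - {l}" x] permutes_not_in[of \<tau> "Ix - {l}" x] by simp
    qed
  qed
  then have inj: "inj_on ?h ?P" by (intro inj_onI) blast
  have image: "?h ` ?P = ?T"
  proof (intro equalityI subsetI)
    fix u assume "u \<in> ?h ` ?P"
    then obtain \<sigma> where \<sigma>: "\<sigma> permutes (Ix - {l})" "u = ?h \<sigma>" by blast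
    have m: "\<sigma> x \<in> Ix - {l}" if "x \<in> set ?xs" for x
      using permutes_in_image[OF \<sigma>(1)] that xs(2) by blast
    have "distinct (map \<sigma> ?xs)"
      using permutes_inj[OF \<sigma>(1)] xs(1) by (auto simp: inj_eq)
    then show "u \<in> ?T" using \<sigma>(2) m[of "rest l 0"] m[of "rest l 1"] m[of "rest l 2"] by auto
  next
    fix u assume "u \<in> ?T"
    then obtain x y z where u: "u = (x, y, z)" and ix: "x \<in> Ix" "y \<in> Ix" "z \<in> Ix"
      and d: "distinct [l, x, y, z]" by auto
    have dx: "distinct [x, y, z]" using d by simp
    have "set [x, y, z] = set ?xs"
    proof (rule card_subset_eq)
      show "set [x, y, z] \<subseteq> set ?xs" unfolding xs(2) using ix d by auto
      show "card (set [x, y, z]) = card (set ?xs)"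
        using distinct_card[OF xs(1)] distinct_card[OF dx] by simp
    qed simp
    then obtain \<sigma> where "\<sigma> permutes set ?xs" "map \<sigma> ?xs = [x, y, z]"
      using permutes_of_lists[OF xs(1) dx] by blast
    then have "\<sigma> permutes (Ix - {l})" "u = ?h \<sigma>" unfolding u xs(2)[symmetric] by simp_all
    then show "u \<in> ?h ` ?P" by blast
  qed
  have "(\<Oplus>\<sigma>\<in>?P. ?f (?h \<sigma>)) = finsum A ?f (?h ` ?P)"
    by (rule finsum_reindex[symmetric]) (use inj closed image in auto)
  also have "\<dots> = finsum A ?f (Ix \<times> Ix \<times> Ix)"
    unfolding image by (rule add.finprod_mono_neutral_cong_left) (use closed zero in auto)
  finally show ?thesis by (simp add: sum3_def)
qed

end

text \<open>Moving \<open>l\<close> from position \<open>i\<close> to the front absorbs the factors \<open>\<eta>\<close>; the sign of \<open>\<sigma>\<close>, a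
  permutation fixing \<open>l\<close>, is read off with \<open>l\<close> inserted at position \<open>l\<close>.\<close>

lemma hat_coefficient:
  assumes "i \<in> Ix" "l \<in> Ix" "x \<in> Ix" "y \<in> Ix" "z \<in> Ix"
  shows "(-1) ^ (i + l) * (of_int (case take (l - 1) [x, y, z] @ [l] @ drop (l - 1) [x, y, z] of
        [p, q, r, s] \<Rightarrow> sgn4 p q r s) *
      eps \<theta> (take (i - 1) [x, y, z] @ [l] @ drop (i - 1) [x, y, z]) *
      (\<Prod>k\<leftarrow>take (i - 1) [x, y, z]. \<eta> \<theta> k l)) = (-1) ^ (i + 1) * twisted_lc \<theta> l x y z"
proof -
  have sw: "sgn4 q p r s = - sgn4 p q r s" "sgn4 p r q s = - sgn4 p q r s" "sgn4 p q s r = - sgn4 p q r s"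
    for p q r s
    by (simp_all add: sgn4_def sgn_if)
  have sl: "(case take (l - 1) [x, y, z] @ [l] @ drop (l - 1) [x, y, z] of
        [p, q, r, s] \<Rightarrow> sgn4 p q r s) = (-1) ^ (l + 1) * sgn4 l x y z"
    using assms(2) sw(1)[of x l y z] sw(2)[of x l y z] sw(3)[of x y l z] unfolding index_cases
    by (elim disjE; hypsubst; simp)
  have lc: "twisted_lc \<theta> p q r s = of_int (sgn4 p q r s) * eps \<theta> [p, q, r, s]" for p q r s
    by (simp add: twisted_lc_def)
  have si: "of_int (sgn4 l x y z) * eps \<theta> (take (i - 1) [x, y, z] @ [l] @ drop (i - 1) [x, y, z]) *
      (\<Prod>k\<leftarrow>take (i - 1) [x, y, z]. \<eta> \<theta> k l) = twisted_lc \<theta> l x y z"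
    using assms(1) unfolding index_cases
  proof (elim disjE)
    assume "i = 1"
    then show ?thesis by (simp add: lc)
  next
    assume "i = 2"
    then show ?thesis
      using twisted_lc_swap[of l x y z \<theta>] sw(1)[of l x y z] assms by (simp add: lc)
  next
    assume "i = 3"
    then show ?thesis
      using twisted_lc_swap[of l x y z \<theta>] twisted_lc_swap'[of x l y z \<theta>]
        sw(1)[of l x y z] sw(2)[of x l y z] assms by (auto simp: lc mult_ac)
  next
    assume "i = 4"
    then show ?thesis
      using twisted_lc_swap[of l x y z \<theta>] twisted_lc_swap'[of x l y z \<theta>]
        twisted_lc_swap''[of x y l z \<theta>]
        sw(1)[of l x y z] sw(2)[of x l y z] sw(3)[of x y l z] assms by (auto simp: lc mult_ac)
  qed
  show ?thesis
    unfolding sl si[symmetric] by (simp add: power_add mult_ac)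
qed

context twisted_matrix
begin

text \<open>The bridge to the prescribed formula for the minors: the sum over permutations of the
  columns other than \<open>l\<close> becomes a sum over triples, and \<open>hat_coefficient\<close>
  matches the coefficients.\<close>

lemma hat_cofactor:
  assumes ix: "i \<in> Ix" "l \<in> Ix"
  shows "(-1) ^ (i + l) \<odot> (\<Oplus>\<sigma>\<in>{\<sigma>. \<sigma> permutes (Ix - {l})}.
      let s = map \<sigma> (remove1 l [1, 2, 3, 4]); r = remove1 i [1, 2, 3, 4] in
      (of_int (sign \<sigma>) * eps \<theta> (take (i - 1) s @ [l] @ drop (i - 1) s)
         * (\<Prod>k\<leftarrow>take (i - 1) s. \<eta> \<theta> k l)) \<odot>
        (a (r ! 0) (s ! 0) \<otimes> a (r ! 1) (s ! 1) \<otimes> a (r ! 2) (s ! 2))) = cofactor l i"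
    (is "_ \<odot> ?hat = _")
proof -
  let ?c = "\<lambda>x y z. of_int (case take (l - 1) [x, y, z] @ [l] @ drop (l - 1) [x, y, z] of
        [p, q, r, s] \<Rightarrow> sgn4 p q r s) * eps \<theta> (take (i - 1) [x, y, z] @ [l] @ drop (i - 1) [x, y, z]) *
      (\<Prod>k\<leftarrow>take (i - 1) [x, y, z]. \<eta> \<theta> k l)"
  let ?m = "\<lambda>x y z. a (rest i 0) x \<otimes> a (rest i 1) y \<otimes> a (rest i 2) z"
  let ?at = "\<lambda>f \<sigma>. f (\<sigma> (rest l 0)) (\<sigma> (rest l 1)) (\<sigma> (rest l 2))"
  have r: "rest i 0 \<in> Ix" "rest i 1 \<in> Ix" "rest i 2 \<in> Ix" "rest i (Suc 0) \<in> Ix"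
    "rest l 0 \<in> Ix" "rest l 1 \<in> Ix" "rest l 2 \<in> Ix" "rest l (Suc 0) \<in> Ix"
    using ix by simp_all
  have c: "(-1) ^ (i + l) * ?c x y z = (-1) ^ (i + 1) * twisted_lc \<theta> l x y z"
    if "x \<in> Ix" "y \<in> Ix" "z \<in> Ix" for x y z
    by (rule hat_coefficient[OF ix that])
  have list: "remove1 l [1, 2, 3, 4] = [rest l 0, rest l 1, rest l 2]" if "l \<in> Ix" for l
    using that unfolding index_cases by (elim disjE; hypsubst; simp add: rest_def)
  have sgn: "sign \<sigma> = (case take (l - 1) [\<sigma> (rest l 0), \<sigma> (rest l 1), \<sigma> (rest l 2)] @ [l] @
      drop (l - 1) [\<sigma> (rest l 0), \<sigma> (rest l 1), \<sigma> (rest l 2)] of [p, q, r, s] \<Rightarrow> sgn4 p q r s)"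
    if \<sigma>: "\<sigma> permutes (Ix - {l})" for \<sigma>
  proof -
    have "\<sigma> permutes Ix" by (rule permutes_subset[OF \<sigma>]) blast
    then have "sign \<sigma> = sgn4 (\<sigma> 1) (\<sigma> 2) (\<sigma> 3) (\<sigma> 4)" by (rule sign_eq_sgn4)
    moreover have "\<sigma> l = l" using permutes_not_in[OF \<sigma>] by simp
    ultimately show ?thesis
      using ix(2) unfolding index_cases by (elim disjE; hypsubst; simp add: rest_def)
  qed
  have s: "\<sigma> j \<in> Ix" if "\<sigma> permutes (Ix - {l})" "j \<in> Ix" for \<sigma> j
    using permutes_in_image[OF permutes_subset[OF that(1), of Ix]] that(2) by blast
  have "?hat = (\<Oplus>\<sigma>\<in>{\<sigma>. \<sigma> permutes (Ix - {l})}.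
      ?at ?c \<sigma> \<odot> ?at ?m \<sigma>)"
    unfolding Let_def
  proof (rule fsum_cong)
    fix \<sigma> assume "\<sigma> \<in> {\<sigma>. \<sigma> permutes (Ix - {l})}"
    then have \<sigma>: "\<sigma> permutes (Ix - {l})" by simp
    show "?at ?c \<sigma> \<odot> ?at ?m \<sigma> \<in> carrier A"
      using r s[OF \<sigma>] by simp
    show "(of_int (sign \<sigma>) * eps \<theta> (take (i - 1) (map \<sigma> (remove1 l [1, 2, 3, 4])) @ [l] @
            drop (i - 1) (map \<sigma> (remove1 l [1, 2, 3, 4]))) *
          (\<Prod>k\<leftarrow>take (i - 1) (map \<sigma> (remove1 l [1, 2, 3, 4])). \<eta> \<theta> k l)) \<odot>
         (a (remove1 i [1, 2, 3, 4] ! 0) (map \<sigma> (remove1 l [1, 2, 3, 4]) ! 0) \<otimes>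
          a (remove1 i [1, 2, 3, 4] ! 1) (map \<sigma> (remove1 l [1, 2, 3, 4]) ! 1) \<otimes>
          a (remove1 i [1, 2, 3, 4] ! 2) (map \<sigma> (remove1 l [1, 2, 3, 4]) ! 2)) =
        ?at ?c \<sigma> \<odot> ?at ?m \<sigma>"
      unfolding list[OF ix(1)] list[OF ix(2)] sgn[OF \<sigma>] by simp
  qed
  then have "(-1) ^ (i + l) \<odot> ?hat = (\<Oplus>\<sigma>\<in>{\<sigma>. \<sigma> permutes (Ix - {l})}.
      (-1) ^ (i + l) \<odot> (?at ?c \<sigma> \<odot> ?at ?m \<sigma>))"
    using r s finite_permutations[of "Ix - {l}"] by (simp only: fsum_smult) (subst fsum_smult; simp)
  also have "\<dots> = (\<Oplus>\<sigma>\<in>{\<sigma>. \<sigma> permutes (Ix - {l})}.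
      ((-1) ^ (i + 1) * ?at (twisted_lc \<theta> l) \<sigma>) \<odot>
      ?at ?m \<sigma>)"
  proof (rule fsum_cong)
    fix \<sigma> assume "\<sigma> \<in> {\<sigma>. \<sigma> permutes (Ix - {l})}"
    then have \<sigma>: "\<sigma> permutes (Ix - {l})" by simp
    note i = s[OF \<sigma> r(5)] s[OF \<sigma> r(6)] s[OF \<sigma> r(7)]
    have m: "?at ?m \<sigma> \<in> carrier A"
      using r i by simp
    show "(-1) ^ (i + l) \<odot> (?at ?c \<sigma> \<odot> ?at ?m \<sigma>) =
      ((-1) ^ (i + 1) * ?at (twisted_lc \<theta> l) \<sigma>) \<odot>
      ?at ?m \<sigma>"
      unfolding smult_smult[OF m] c[OF i] ..
  qed (use r s in simp)
  also have "\<dots> = sum3 A (\<lambda>x y z. ((-1) ^ (i + 1) * twisted_lc \<theta> l x y z) \<odot> ?m x y z)"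
  proof (rule fsum_permutations3[OF ix(2)])
    fix x y z assume "x \<in> Ix" "y \<in> Ix" "z \<in> Ix" "\<not> distinct [l, x, y, z]"
    then show "((-1) ^ (i + 1) * twisted_lc \<theta> l x y z) \<odot> ?m x y z = \<zero>"
      using twisted_lc_nondistinct[of l x y z \<theta>] r by simp
  qed (use r in simp)
  also have "\<dots> = (-1) ^ (i + 1) \<odot> sum3 A (\<lambda>x y z. twisted_lc \<theta> l x y z \<odot> ?m x y z)"
    unfolding sum3_def using r by (subst fsum_smult) (auto intro!: fsum_cong)
  finally show ?thesis unfolding cofactor_def .
qed

end

section \<open>Star algebras\<close>

locale complex_star_algebra = complex_algebra A for A :: "('a, 'm) star_algebra_scheme" (structure) +
  assumes star_closed [simp]: "x \<in> carrier A \<Longrightarrow> star A x \<in> carrier A"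
    and star_add: "x \<in> carrier A \<Longrightarrow> y \<in> carrier A \<Longrightarrow> star A (x \<oplus> y) = star A x \<oplus> star A y"
    and star_smult: "x \<in> carrier A \<Longrightarrow> star A (c \<odot> x) = cnj c \<odot> star A x"
    and star_mult: "x \<in> carrier A \<Longrightarrow> y \<in> carrier A \<Longrightarrow> star A (x \<otimes> y) = star A y \<otimes> star A x"
    and star_one: "star A \<one> = \<one>"
begin

lemma star_zero [simp]: "star A \<zero> = \<zero>"
  using star_smult[of \<zero> 0] by simp

lemma star_diff: "x \<in> carrier A \<Longrightarrow> y \<in> carrier A \<Longrightarrow> star A (x \<ominus> y) = star A x \<ominus> star A y"
  by (simp add: diff_eq_smult star_add star_smult)

lemma star_finsum:
  "finite I \<Longrightarrow> (\<And>i. i \<in> I \<Longrightarrow> f i \<in> carrier A) \<Longrightarrow> star A (finsum A f I) = (\<Oplus>i\<in>I. star A (f i))"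
  by (induction I rule: finite_induct) (auto simp: star_add Pi_def)

text \<open>The star is conjugate linear and reverses products, so the preimage of a two-sided ideal
  is a two-sided ideal. It contains the generators, hence the ideal they generate.\<close>

lemma star_genideal:
  assumes G: "G \<subseteq> carrier A" "\<And>g. g \<in> G \<Longrightarrow> star A g \<in> Idl G"
  shows "star A ` (Idl G) \<subseteq> Idl G"
proof -
  interpret I: ideal "Idl G" A by (rule genideal_ideal[OF G(1)])
  have "ideal {x \<in> carrier A. star A x \<in> Idl G} A"
  proof (rule idealI[OF ring_axioms])
    show "subgroup {x \<in> carrier A. star A x \<in> Idl G} (add_monoid A)"
    proof (rule add.subgroupI)
      fix x assume "x \<in> {x \<in> carrier A. star A x \<in> Idl G}"
      then show "\<ominus> x \<in> {x \<in> carrier A. star A x \<in> Idl G}"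
        using ideal_smult[OF I.ideal_axioms, of "star A x" "-1"] by (simp add: minus_eq_smult star_smult)
    next
      have "\<zero> \<in> {x \<in> carrier A. star A x \<in> Idl G}" by simp
      then show "{x \<in> carrier A. star A x \<in> Idl G} \<noteq> {}" by blast
    qed (auto simp: star_add)
  qed (auto simp: star_mult I.I_l_closed I.I_r_closed)
  then have "Idl G \<subseteq> {x \<in> carrier A. star A x \<in> Idl G}"
    by (rule genideal_minimal) (use G in auto)
  then show ?thesis by blast
qed

text \<open>This removes the star from the presentations, so that a homomorphism into an algebra
  without star factors as soon as it kills the generators.\<close>

lemma star_ideal_eq_genideal:
  assumes G: "G \<subseteq> carrier A" "\<And>g. g \<in> G \<Longrightarrow> star A g \<in> Idl G"
  shows "star_ideal A G = Idl G"
proof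
  show "star_ideal A G \<subseteq> Idl G"
    unfolding star_ideal_def
    using genideal_ideal[OF G(1)] star_genideal[OF G] genideal_self[OF G(1)] by blast
  show "Idl G \<subseteq> star_ideal A G"
    unfolding star_ideal_def genideal_def by blast
qed

end

lemma quot_star_algebra_simps:
  "carrier (quot_star_algebra A I) = carrier (quot_algebra A I)"
  "monoid.mult (quot_star_algebra A I) = monoid.mult (quot_algebra A I)"
  "one (quot_star_algebra A I) = one (quot_algebra A I)"
  "zero (quot_star_algebra A I) = zero (quot_algebra A I)"
  "add (quot_star_algebra A I) = add (quot_algebra A I)"
  "module.smult (quot_star_algebra A I) = module.smult (quot_algebra A I)"
  by (simp_all add: quot_star_algebra_def module.defs)

lemma quot_star_hom:
  "alg_hom (quot_star_algebra A I) B = alg_hom (quot_algebra A I) B"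
  "alg_hom B (quot_star_algebra A I) = alg_hom B (quot_algebra A I)"
  "linear_hom (quot_star_algebra A I) B = linear_hom (quot_algebra A I) B"
  by (simp_all add: alg_hom_def linear_hom_def ring_hom_def quot_star_algebra_simps)

locale algebra_star_ideal = complex_star_algebra A + ideal I A for A (structure) and I +
  assumes star_I: "star A ` I \<subseteq> I"
begin

sublocale algebra_ideal A I ..

lemma star_coset:
  assumes "x \<in> carrier A"
  shows "star (quot_star_algebra A I) (I +> x) = I +> star A x"
proof -
  have "I +> star A y = I +> star A x" if "y \<in> I +> x" for y
  proof -
    note y = coset_memberD[OF that assms]
    then have "star A (y \<ominus> x) \<in> I" using star_I by blast
    then show ?thesis using y assms by (subst coset_eq_iff) (simp_all add: star_diff)
  qed
  moreover have "x \<in> I +> x" using a_rcos_self assms by blast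
  moreover have "star (quot_star_algebra A I) (I +> x) = (\<Union>y\<in>I +> x. I +> star A y)"
    by (simp add: quot_star_algebra_def module.defs)
  ultimately show ?thesis by blast
qed

lemma quot_star_complex_algebra: "complex_algebra (quot_star_algebra A I)"
  by (rule complex_algebra_cong[OF complex_algebra_quot]) (simp_all add: quot_star_algebra_simps)

lemma quot_star_algebra_star: "complex_star_algebra (quot_star_algebra A I)"
proof -
  have one: "\<one>\<^bsub>quot_algebra A I\<^esub> = I +> \<one>" by (simp add: quot_algebra_simps)
  show ?thesis
    by (intro complex_star_algebra.intro quot_star_complex_algebra complex_star_algebra_axioms.intro;
      unfold quot_star_algebra_simps one)
     (auto simp: carrier_quot_algebra coset_ops coset_smult star_coset star_add star_smult star_mult star_one)
qed

end


section \<open>The free star algebra\<close>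

abbreviation word_monoid :: "(gen \<times> bool) list monoid" where
  "word_monoid \<equiv> \<lparr>carrier = UNIV, monoid.mult = (@), one = []\<rparr>"

abbreviation FA :: "free_elem star_algebra" where "FA \<equiv> free_star_algebra"

lemma monoid_word: "Group.monoid word_monoid"
  by (rule monoidI) simp_all

lemma FA_simps:
  "carrier FA = UNIV" "monoid.mult FA = monoid.mult (monoid_algebra word_monoid)"
  "\<one>\<^bsub>FA\<^esub> = single [] 1" "\<zero>\<^bsub>FA\<^esub> = 0" "p \<oplus>\<^bsub>FA\<^esub> q = p + q"
  "c \<odot>\<^bsub>FA\<^esub> p = scale c p"
  by (simp_all add: free_star_algebra_def module.defs monoid_algebra_def)

lemma complex_algebra_FA: "complex_algebra FA"
  by (rule complex_algebra_cong[OF complex_algebra_monoid_algebra[OF monoid_word]])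
    (simp_all add: free_star_algebra_def module.defs monoid_algebra_def)

lemma FA_hom: "alg_hom FA B = alg_hom (monoid_algebra word_monoid) B"
  by (simp add: alg_hom_def linear_hom_def ring_hom_def FA_simps)

lemma star_FA_superset:
  assumes "finite S" "keys p \<subseteq> S"
  shows "star FA p = (\<Sum>w\<in>S. single (rev (map (apsnd Not) w)) (cnj (lookup p w)))"
proof -
  have "(\<Sum>w\<in>S. single (rev (map (apsnd Not) w)) (cnj (lookup p w)))
      = (\<Sum>w\<in>keys p. single (rev (map (apsnd Not) w)) (cnj (lookup p w)))"
    using assms by (intro sum.mono_neutral_right) (auto simp: in_keys_iff)
  then show ?thesis by (simp add: free_star_algebra_def module.defs)
qed

lemma star_FA_single: "star FA (single w c) = single (rev (map (apsnd Not) w)) (cnj c)"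
  by (subst star_FA_superset[of "{w}"]) simp_all

lemma star_FA_add: "star FA (p + q) = star FA p + star FA q"
proof -
  let ?S = "keys p \<union> keys q"
  have "star FA r = (\<Sum>w\<in>?S. single (rev (map (apsnd Not) w)) (cnj (lookup r w)))"
    if "keys r \<subseteq> ?S" for r
    by (rule star_FA_superset) (use that in auto)
  then show ?thesis by (simp add: keys_add lookup_add single_add sum.distrib)
qed

lemma star_FA_mult: "star FA (p \<otimes>\<^bsub>FA\<^esub> q) = star FA q \<otimes>\<^bsub>FA\<^esub> star FA p"
proof -
  interpret F: complex_algebra FA by (rule complex_algebra_FA)
  have z: "star FA 0 = 0" using star_FA_single[of "[]" 0] by simp
  have m: "0 \<otimes>\<^bsub>FA\<^esub> q = 0" "q \<otimes>\<^bsub>FA\<^esub> 0 = 0" for q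
    using F.l_null[of q] F.r_null[of q] by (simp_all add: FA_simps)
  have d: "(p + p') \<otimes>\<^bsub>FA\<^esub> q = p \<otimes>\<^bsub>FA\<^esub> q + p' \<otimes>\<^bsub>FA\<^esub> q"
    "q \<otimes>\<^bsub>FA\<^esub> (p + p') = q \<otimes>\<^bsub>FA\<^esub> p + q \<otimes>\<^bsub>FA\<^esub> p'" for p p' q
    by (simp_all add: FA_simps(2) monoid_algebra_distrib)
  have s: "single v c \<otimes>\<^bsub>FA\<^esub> single w e = single (v @ w) (c * e)" for v w c e
    by (simp add: FA_simps(2))
  have p: "keys p \<subseteq> UNIV" and q: "keys q \<subseteq> UNIV" by simp_all
  from p show ?thesis
  proof (induction p rule: poly_mapping_induct)
    case (single v c)
    from q show ?case
      by (induction q rule: poly_mapping_induct)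
        (simp_all add: z m d s star_FA_add star_FA_single mult.commute)
  qed (simp_all add: z m d star_FA_add)
qed

lemma complex_star_algebra_FA: "complex_star_algebra FA"
proof (intro complex_star_algebra.intro complex_algebra_FA complex_star_algebra_axioms.intro)
  fix c and p :: free_elem
  have map_zero: "scale c (0 :: free_elem) = 0" for c :: complex
    by (rule poly_mapping_eqI) simp
  have "keys p \<subseteq> UNIV" by simp
  then show "star FA (c \<odot>\<^bsub>FA\<^esub> p) = cnj c \<odot>\<^bsub>FA\<^esub> star FA p"
  proof (induction p rule: poly_mapping_induct)
    case zero
    show ?case using star_FA_single[of "[]" 0] by (simp add: FA_simps map_zero)
  next
    case (single w d)
    show ?case by (simp add: FA_simps star_FA_single)
  next
    case (add p q)
    interpret F: complex_algebra FA by (rule complex_algebra_FA)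
    show ?case
      using add.IH F.smult_add_right[of p q c] F.smult_add_right[of "star FA p" "star FA q" "cnj c"]
      by (simp add: FA_simps star_FA_add)
  qed
qed (simp_all add: FA_simps(1,3,5) star_FA_add star_FA_mult star_FA_single)

interpretation FA: complex_star_algebra FA
  by (rule complex_star_algebra_FA)

section \<open>Matrix entries as signed letters of the free algebra\<close>

definition prime_index :: "nat \<Rightarrow> nat" where
  "prime_index i = [2, 1, 4, 3] ! (i - 1)"

lemma prime_index_simps [simp]:
  "prime_index 1 = 2" "prime_index (Suc 0) = 2" "prime_index 2 = 1" "prime_index 3 = 4" "prime_index 4 = 3"
  by (simp_all add: prime_index_def)

lemma prime_index_in [simp]: "i \<in> Ix \<Longrightarrow> prime_index i \<in> Ix"
  unfolding index_cases by (elim disjE) simp_all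

lemma prime_index_idem [simp]: "i \<in> Ix \<Longrightarrow> prime_index (prime_index i) = i"
  unfolding index_cases by (elim disjE) simp_all

text \<open>The position of the letter \<open>g\<close> itself, always in row 1 or 3. Its star sits
  at the primed position, with sign \<open>(-1) ^ (i + j)\<close>.\<close>

fun gen_pos :: "gen \<Rightarrow> nat \<times> nat" where
  "gen_pos a\<^sub>1 = (1, 1)" | "gen_pos a\<^sub>2 = (1, 2)" | "gen_pos b\<^sub>1 = (1, 3)" | "gen_pos b\<^sub>2 = (1, 4)"
| "gen_pos c\<^sub>1 = (3, 1)" | "gen_pos c\<^sub>2 = (3, 2)" | "gen_pos d\<^sub>1 = (3, 3)" | "gen_pos d\<^sub>2 = (3, 4)"

lemma gen_pos_in: "gen_pos g = (i, j) \<Longrightarrow> i \<in> Ix \<and> j \<in> Ix"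
  by (cases g) auto

definition entry_letter :: "nat \<Rightarrow> nat \<Rightarrow> gen \<times> bool" where
  "entry_letter i j =
     [[(a\<^sub>1, False), (a\<^sub>2, False), (b\<^sub>1, False), (b\<^sub>2, False)],
      [(a\<^sub>2, True), (a\<^sub>1, True), (b\<^sub>2, True), (b\<^sub>1, True)],
      [(c\<^sub>1, False), (c\<^sub>2, False), (d\<^sub>1, False), (d\<^sub>2, False)],
      [(c\<^sub>2, True), (c\<^sub>1, True), (d\<^sub>2, True), (d\<^sub>1, True)]] ! (i - 1) ! (j - 1)"

definition entry_sign :: "nat \<Rightarrow> nat \<Rightarrow> complex" where
  "entry_sign i j = (if even i \<and> odd j then -1 else 1)"

lemma free_mat_eq_single:
  assumes "i \<in> Ix" "j \<in> Ix"
  shows "free_mat i j = single [entry_letter i j] (entry_sign i j)"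
proof -
  have m: "\<ominus>\<^bsub>FA\<^esub> single w c = single w (- c)" for w c
    by (subst FA.minus_eq_smult) (simp_all add: FA_simps)
  show ?thesis
    using assms unfolding index_cases
    by (elim disjE; hypsubst;
        simp add: free_mat_def free_gen_def star_FA_single m entry_letter_def entry_sign_def)
qed

lemma star_free_mat:
  assumes "i \<in> Ix" "j \<in> Ix"
  shows "star FA (free_mat i j) = (-1) ^ (i + j) \<odot>\<^bsub>FA\<^esub> free_mat (prime_index i) (prime_index j)"
  using assms
  by (simp add: free_mat_eq_single star_FA_single FA_simps)
    (unfold index_cases, elim disjE; hypsubst; simp add: entry_letter_def entry_sign_def)

text \<open>Eight generators and their stars give sixteen letters, and up to sign these are the
  sixteen entries of the matrix.\<close>

lemma letter_eq_free_mat: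
  obtains i j c where "i \<in> Ix" "j \<in> Ix" "single [u] 1 = c \<odot>\<^bsub>FA\<^esub> free_mat i j"
proof -
  obtain g b where u: "u = (g, b)" by (cases u)
  obtain i j where ij: "gen_pos g = (i, j)" by (cases "gen_pos g")
  show thesis
  proof (cases b)
    case False
    have "single [u] 1 = 1 \<odot>\<^bsub>FA\<^esub> free_mat i j"
      using ij gen_pos_in[OF ij] unfolding u
      by (cases g) (auto simp: free_mat_eq_single entry_letter_def entry_sign_def FA_simps False)
    then show thesis using that gen_pos_in[OF ij] by blast
  next
    case True
    have "single [u] 1 = (-1) ^ (i + j) \<odot>\<^bsub>FA\<^esub> free_mat (prime_index i) (prime_index j)"
      using ij gen_pos_in[OF ij] unfolding u
      by (cases g) (auto simp: free_mat_eq_single entry_letter_def entry_sign_def FA_simps True)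
    then show thesis using that[OF prime_index_in prime_index_in] gen_pos_in[OF ij] by blast
  qed
qed

text \<open>As a plain algebra, the free star algebra is free on its sixteen letters, hence on the
  sixteen entries; their images can be prescribed independently in any algebra.\<close>

lemma free_hom_exists:
  fixes B (structure)
  assumes "complex_algebra B" and b: "\<And>i j. i \<in> Ix \<Longrightarrow> j \<in> Ix \<Longrightarrow> b i j \<in> carrier B"
  obtains f where "f \<in> alg_hom FA B" "\<And>i j. i \<in> Ix \<Longrightarrow> j \<in> Ix \<Longrightarrow> f (free_mat i j) = b i j"
proof -
  interpret B: complex_algebra B by fact
  \<comment> \<open>The image of a letter is forced by the entry that equals it up to sign.\<close>
  define \<phi> where "\<phi> u = (case u of (g, False) \<Rightarrow> b (fst (gen_pos g)) (snd (gen_pos g))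
    | (g, True) \<Rightarrow> (-1) ^ (fst (gen_pos g) + snd (gen_pos g)) \<odot>
        b (prime_index (fst (gen_pos g))) (prime_index (snd (gen_pos g))))" for u
  define W where "W w = foldr (\<lambda>u x. \<phi> u \<otimes> x) w \<one>" for w
  have pos: "fst (gen_pos g) \<in> Ix" "snd (gen_pos g) \<in> Ix" for g
    using gen_pos_in[of g "fst (gen_pos g)" "snd (gen_pos g)"] by simp_all
  have \<phi>: "\<phi> u \<in> carrier B" for u
    unfolding \<phi>_def using pos b by (auto split: prod.split bool.split)
  have W: "W w \<in> carrier B" for w
    unfolding W_def by (induction w) (simp_all add: \<phi>)
  have append: "W (v @ w) = W v \<otimes> W w" for v w
  proof (induction v)
    case Nil
    show ?case using W[of w] by (simp add: W_def)
  next
    case (Cons u v)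
    then show ?case using W \<phi>[of u] B.m_assoc[of "\<phi> u" "W v" "W w"] by (simp add: W_def)
  qed
  have hom: "linear_extension B W \<in> alg_hom FA B"
    unfolding FA_hom
    by (rule linear_extension_alg_hom[OF assms(1) monoid_word]) (simp_all add: W append, simp add: W_def)
  have "linear_extension B W (free_mat i j) = b i j" if ix: "i \<in> Ix" "j \<in> Ix" for i j
  proof -
    have "linear_extension B W (free_mat i j) = entry_sign i j \<odot> \<phi> (entry_letter i j)"
      using linear_extension_single[OF assms(1), of W "[entry_letter i j]" "entry_sign i j"] W \<phi>
      by (simp add: free_mat_eq_single ix W_def)
    also have "\<dots> = b i j"
      using ix unfolding index_cases
      by (elim disjE; hypsubst; simp add: entry_letter_def entry_sign_def \<phi>_def b)
    finally show ?thesis .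
  qed
  with hom show thesis by (rule that)
qed

lemma FA_induct [case_names one add smult mult entry]:
  assumes "P \<one>\<^bsub>FA\<^esub>" "\<And>x y. P x \<Longrightarrow> P y \<Longrightarrow> P (x \<oplus>\<^bsub>FA\<^esub> y)" "\<And>c x. P x \<Longrightarrow> P (c \<odot>\<^bsub>FA\<^esub> x)"
    "\<And>x y. P x \<Longrightarrow> P y \<Longrightarrow> P (x \<otimes>\<^bsub>FA\<^esub> y)"
    "\<And>i j. i \<in> Ix \<Longrightarrow> j \<in> Ix \<Longrightarrow> P (free_mat i j)"
  shows "P p"
proof -
  have word: "P (single w 1)" for w
  proof (induction w)
    case Nil
    show ?case using assms(1) by (simp add: FA_simps)
  next
    case (Cons u w)
    obtain i j c where "i \<in> Ix" "j \<in> Ix" "single [u] 1 = c \<odot>\<^bsub>FA\<^esub> free_mat i j"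
      by (rule letter_eq_free_mat)
    then have "P (single [u] 1)" using assms(3,5) by simp
    then have "P (single [u] 1 \<otimes>\<^bsub>FA\<^esub> single w 1)"
      using Cons.IH assms(4) by blast
    then show ?case by (simp add: FA_simps(2))
  qed
  have single: "P (single w c)" for w c
    using assms(3)[OF word, of c w] by (simp add: FA_simps)
  have "keys p \<subseteq> UNIV" by simp
  then show ?thesis
    by (induction p rule: poly_mapping_induct)
      (use single[of "[]" 0] single assms(2) in \<open>simp_all add: FA_simps\<close>)
qed

section \<open>Quaternionic matrices\<close>

text \<open>Conjugation transposes \<eta>, and priming both indices leaves \<eta> unchanged.\<close>

lemma cnj_\<eta>: "i \<in> Ix \<Longrightarrow> k \<in> Ix \<Longrightarrow> cnj (\<eta> \<theta> k i) = \<eta> \<theta> (prime_index i) (prime_index k)"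
  unfolding index_cases by (elim disjE; hypsubst; simp add: \<eta>_def)

lemma \<eta>_prime [simp]: "i \<in> Ix \<Longrightarrow> \<eta> \<theta> i (prime_index i) = 1" "i \<in> Ix \<Longrightarrow> \<eta> \<theta> (prime_index i) i = 1"
  unfolding index_cases by (elim disjE; hypsubst; simp add: \<eta>_def)+

text \<open>The star reverses a monomial and primes its column indices. The symbol is compatible
  with this operation, which is what \<open>star_row_det\<close> needs.\<close>

lemma twisted_lc_star:
  assumes "p \<in> Ix" "q \<in> Ix" "r \<in> Ix" "s \<in> Ix"
  shows "(-1) ^ (p + q + r + s) * cnj (twisted_lc \<theta> p q r s)
    = twisted_lc \<theta> (prime_index s) (prime_index r) (prime_index q) (prime_index p)"
  using assms unfolding index_cases
  by (elim disjE; hypsubst; simp add: twisted_lc_eval sgn4_def)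

lemma prime_index_sign: "i \<in> Ix \<Longrightarrow> (-1) ^ prime_index i = - ((-1) ^ i :: complex)"
  unfolding index_cases by (elim disjE) simp_all

lemma prime_index_image: "prime_index ` Ix = Ix"
proof (intro equalityI subsetI)
  fix i assume "i \<in> Ix"
  then show "i \<in> prime_index ` Ix" using prime_index_idem prime_index_in by (metis imageI)
qed auto

lemma (in complex_algebra) sum4_prime_rev:
  assumes "\<And>p q r s. \<lbrakk>p \<in> Ix; q \<in> Ix; r \<in> Ix; s \<in> Ix\<rbrakk> \<Longrightarrow> f p q r s \<in> carrier A"
  shows "sum4 A f = sum4 A (\<lambda>p q r s. f (prime_index s) (prime_index r) (prime_index q) (prime_index p))"
proof -
  let ?h = "\<lambda>(p, q, r, s). (prime_index s, prime_index r, prime_index q, prime_index p)"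
  have "?h ` idx4 = idx4"
  proof (intro equalityI subsetI)
    fix u assume u: "u \<in> idx4"
    then have "u = ?h (?h u)" "?h u \<in> idx4" by auto
    then show "u \<in> ?h ` idx4" by (rule image_eqI)
  qed auto
  then show ?thesis
    unfolding sum4_def using assms by (subst fsum_permute[of ?h]) (auto simp: case_prod_unfold)
qed

locale quaternionic_matrix = complex_star_algebra A + twisted_matrix A \<theta> a
  for A (structure) and \<theta> a +
  assumes star_entry: "i \<in> Ix \<Longrightarrow> j \<in> Ix \<Longrightarrow>
    star A (a i j) = (-1) ^ (i + j) \<odot> a (prime_index i) (prime_index j)"
begin

text \<open>\<open>prime_index\<close> is an involution that changes the parity of its argument, so
  the signs of the two steps agree and cancel.\<close>

lemma star_star_entry: "i \<in> Ix \<Longrightarrow> j \<in> Ix \<Longrightarrow> star A (star A (a i j)) = a i j"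
proof -
  have "(-1) ^ i * (-1) ^ j * ((-1) ^ i * (-1) ^ j) = (1 :: complex)"
    by (cases "even i"; cases "even j") simp_all
  then show "i \<in> Ix \<Longrightarrow> j \<in> Ix \<Longrightarrow> star A (star A (a i j)) = a i j"
    by (simp add: star_entry star_smult power_add prime_index_sign)
qed

text \<open>The rows 1, 2, 3, 4 become, reversed and primed, the rows 3, 4, 1, 2, whose symbol is 1.
  The row indices contribute the sign \<open>(-1) ^ 10\<close>, so only the columns leave a
  sign.\<close>

lemma star_row_det: "star A (row_det 1 2 3 4) = row_det 1 2 3 4"
proof -
  have "star A (row_det 1 2 3 4) = sum4 A (\<lambda>p q r s. star A (twisted_lc \<theta> p q r s \<odot> (a 1 p \<otimes> a 2 q \<otimes> a 3 r \<otimes> a 4 s)))"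
    unfolding row_det_def sum4_def by (subst star_finsum) (auto simp: case_prod_unfold)
  also have "\<dots> = sum4 A (\<lambda>p q r s. ((-1) ^ (p + q + r + s) * cnj (twisted_lc \<theta> p q r s)) \<odot>
      (a 3 (prime_index s) \<otimes> a 4 (prime_index r) \<otimes> a 1 (prime_index q) \<otimes> a 2 (prime_index p)))"
    by (intro sum4_cong)
      (simp_all add: star_smult star_mult star_entry m_assoc power_add mult_ac)
  also have "\<dots> = sum4 A (\<lambda>p q r s. twisted_lc \<theta> (prime_index s) (prime_index r) (prime_index q) (prime_index p) \<odot>
      (a 3 (prime_index s) \<otimes> a 4 (prime_index r) \<otimes> a 1 (prime_index q) \<otimes> a 2 (prime_index p)))"
    by (intro sum4_cong) (simp_all only: twisted_lc_star, simp)
  also have "\<dots> = row_det 3 4 1 2"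
    unfolding row_det_def by (rule sum4_prime_rev[symmetric]) simp
  also have "\<dots> = row_det 1 2 3 4"
    using row_det_eq[of 3 4 1 2] row_det_closed[of 1 2 3 4] unfolding twisted_lc_3412 by simp
  finally show ?thesis .
qed

end

section \<open>Transport along homomorphisms and generation by the entries\<close>

lemma alg_hom_twisted:
  assumes "twisted_matrix A \<theta> a" "complex_algebra B" "f \<in> alg_hom A B"
    and b: "\<And>i j. i \<in> Ix \<Longrightarrow> j \<in> Ix \<Longrightarrow> b i j = f (a i j)"
  shows "twisted_matrix B \<theta> b"
    and "f (twisted_matrix.row_det A \<theta> a 1 2 3 4) = twisted_matrix.row_det B \<theta> b 1 2 3 4"
proof -
  interpret A: twisted_matrix A \<theta> a by fact
  interpret B: complex_algebra B by fact
  note h = alg_homD[OF assms(3)]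
  show tw: "twisted_matrix B \<theta> b"
  proof (intro twisted_matrix.intro assms(2) twisted_matrix_axioms.intro)
    fix i j k l assume ix: "i \<in> Ix" "j \<in> Ix" "k \<in> Ix" "l \<in> Ix"
    show "b i j \<otimes>\<^bsub>B\<^esub> b k l = (\<eta> \<theta> k i * \<eta> \<theta> j l) \<odot>\<^bsub>B\<^esub> (b k l \<otimes>\<^bsub>B\<^esub> b i j)"
      using arg_cong[OF A.twisted_comm[OF ix], of f] ix by (simp add: b h)
  qed (simp add: b h)
  interpret B: twisted_matrix B \<theta> b by (rule tw)
  have "f (A.row_det 1 2 3 4) = sum4 B (\<lambda>p q r s. f (twisted_lc \<theta> p q r s \<odot>\<^bsub>A\<^esub>
      (a 1 p \<otimes>\<^bsub>A\<^esub> a 2 q \<otimes>\<^bsub>A\<^esub> a 3 r \<otimes>\<^bsub>A\<^esub> a 4 s)))"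
    unfolding A.row_det_def sum4_def
    by (subst linear_hom_finsum[OF A.complex_algebra_axioms assms(2) h(1)]) (auto simp: case_prod_unfold)
  also have "\<dots> = B.row_det 1 2 3 4"
    unfolding B.row_det_def by (intro B.sum4_cong) (simp_all add: h b)
  finally show "f (A.row_det 1 2 3 4) = B.row_det 1 2 3 4" .
qed

text \<open>Generation is encoded as an induction principle, which covers equality of homomorphisms
  as well as properties such as the antipode axioms, where the two sides are not
  homomorphisms.\<close>

definition generated_by_entries ::
  "(complex, 'a, 'm) module_scheme \<Rightarrow> (nat \<Rightarrow> nat \<Rightarrow> 'a) \<Rightarrow> bool" where
  "generated_by_entries A a \<longleftrightarrow> (\<forall>P. P \<one>\<^bsub>A\<^esub> \<longrightarrow>
     (\<forall>x\<in>carrier A. \<forall>y\<in>carrier A. P x \<longrightarrow> P y \<longrightarrow> P (x \<oplus>\<^bsub>A\<^esub> y)) \<longrightarrow>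
     (\<forall>c. \<forall>x\<in>carrier A. P x \<longrightarrow> P (c \<odot>\<^bsub>A\<^esub> x)) \<longrightarrow>
     (\<forall>x\<in>carrier A. \<forall>y\<in>carrier A. P x \<longrightarrow> P y \<longrightarrow> P (x \<otimes>\<^bsub>A\<^esub> y)) \<longrightarrow>
     (\<forall>i\<in>Ix. \<forall>j\<in>Ix. P (a i j)) \<longrightarrow> (\<forall>x\<in>carrier A. P x))"

lemma generated_induct [consumes 2, case_names one add smult mult entry]:
  assumes "generated_by_entries A a" "x \<in> carrier A" "P \<one>\<^bsub>A\<^esub>"
    "\<And>x y. x \<in> carrier A \<Longrightarrow> y \<in> carrier A \<Longrightarrow> P x \<Longrightarrow> P y \<Longrightarrow> P (x \<oplus>\<^bsub>A\<^esub> y)"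
    "\<And>c x. x \<in> carrier A \<Longrightarrow> P x \<Longrightarrow> P (c \<odot>\<^bsub>A\<^esub> x)"
    "\<And>x y. x \<in> carrier A \<Longrightarrow> y \<in> carrier A \<Longrightarrow> P x \<Longrightarrow> P y \<Longrightarrow> P (x \<otimes>\<^bsub>A\<^esub> y)"
    "\<And>i j. i \<in> Ix \<Longrightarrow> j \<in> Ix \<Longrightarrow> P (a i j)"
  shows "P x"
proof -
  note g = assms(1)[unfolded generated_by_entries_def, THEN spec[of _ P]]
  show ?thesis
    by (rule g[THEN mp, THEN mp, THEN mp, THEN mp, THEN mp, THEN bspec]) (use assms(2-) in blast)+
qed

lemma generated_image:
  assumes "generated_by_entries A a" "f \<in> alg_hom A B" "carrier B \<subseteq> f ` carrier A"
    and b: "\<And>i j. i \<in> Ix \<Longrightarrow> j \<in> Ix \<Longrightarrow> b i j = f (a i j)"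
  shows "generated_by_entries B b"
  unfolding generated_by_entries_def
proof (intro allI impI ballI)
  fix P y
  assume P: "P \<one>\<^bsub>B\<^esub>" "\<forall>x\<in>carrier B. \<forall>y\<in>carrier B. P x \<longrightarrow> P y \<longrightarrow> P (x \<oplus>\<^bsub>B\<^esub> y)"
    "\<forall>c. \<forall>x\<in>carrier B. P x \<longrightarrow> P (c \<odot>\<^bsub>B\<^esub> x)"
    "\<forall>x\<in>carrier B. \<forall>y\<in>carrier B. P x \<longrightarrow> P y \<longrightarrow> P (x \<otimes>\<^bsub>B\<^esub> y)"
    "\<forall>i\<in>Ix. \<forall>j\<in>Ix. P (b i j)" and "y \<in> carrier B"
  then obtain x where x: "x \<in> carrier A" "y = f x" using assms(3) by blast
  note h = alg_homD[OF assms(2)]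
  from assms(1) x(1) have "P (f x)"
    by (induction x rule: generated_induct) (use P h b in auto)
  then show "P y" using x by simp
qed

lemma alg_hom_eqI:
  assumes "generated_by_entries A a" "f \<in> alg_hom A B" "g \<in> alg_hom A B"
    and "\<And>i j. i \<in> Ix \<Longrightarrow> j \<in> Ix \<Longrightarrow> f (a i j) = g (a i j)" and "x \<in> carrier A"
  shows "f x = g x"
  using assms(1,5)
  by (induction x rule: generated_induct)
    (simp_all add: alg_homD[OF assms(2)] alg_homD[OF assms(3)] assms(4))

lemma FA_generated: "generated_by_entries FA free_mat"
  unfolding generated_by_entries_def
proof (intro allI impI ballI)
  fix P x
  assume P: "P \<one>\<^bsub>FA\<^esub>" "\<forall>x\<in>carrier FA. \<forall>y\<in>carrier FA. P x \<longrightarrow> P y \<longrightarrow> P (x \<oplus>\<^bsub>FA\<^esub> y)"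
    "\<forall>c. \<forall>x\<in>carrier FA. P x \<longrightarrow> P (c \<odot>\<^bsub>FA\<^esub> x)"
    "\<forall>x\<in>carrier FA. \<forall>y\<in>carrier FA. P x \<longrightarrow> P y \<longrightarrow> P (x \<otimes>\<^bsub>FA\<^esub> y)"
    "\<forall>i\<in>Ix. \<forall>j\<in>Ix. P (free_mat i j)"
  have c: "x \<in> carrier FA" for x by (simp add: FA_simps)
  show "P x"
    by (induction x rule: FA_induct)
      (rule P(1), erule (1) P(2)[rule_format, OF c c], erule P(3)[rule_format, OF c],
        erule (1) P(4)[rule_format, OF c c], erule (1) P(5)[rule_format])
qed

lemma free_mat_carrier: "free_mat i j \<in> carrier FA"
  by (simp add: FA_simps)


section \<open>The algebra of the quantum special linear group\<close>

definition M_relation :: "real \<Rightarrow> nat \<Rightarrow> nat \<Rightarrow> nat \<Rightarrow> nat \<Rightarrow> free_elem" where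
  "M_relation \<theta> i j k l = free_mat i j \<otimes>\<^bsub>FA\<^esub> free_mat k l \<ominus>\<^bsub>FA\<^esub>
     (\<eta> \<theta> k i * \<eta> \<theta> j l) \<odot>\<^bsub>FA\<^esub> (free_mat k l \<otimes>\<^bsub>FA\<^esub> free_mat i j)"

text \<open>The reversed product with primed indices satisfies a relation of the same family;
  \<open>cnj_\<eta>\<close> shows that the conjugated coefficient is the right one.\<close>

lemma star_M_relation:
  assumes "i \<in> Ix" "j \<in> Ix" "k \<in> Ix" "l \<in> Ix"
  shows "star FA (M_relation \<theta> i j k l) = (-1) ^ (i + j + k + l) \<odot>\<^bsub>FA\<^esub>
    M_relation \<theta> (prime_index k) (prime_index l) (prime_index i) (prime_index j)"
  unfolding M_relation_def using assms
  by (simp add: FA.star_add FA.star_mult FA.star_smult star_free_mat free_mat_carrier cnj_\<eta>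
      FA.diff_eq_smult FA.smult_add_right power_add mult_ac)

text \<open>By \<open>star_M_relation\<close> the star of each relation is a multiple of another
  one, so the generated ideal is already stable under the star.\<close>

lemma M_ideal_eq:
  "M_ideal \<theta> = Idl\<^bsub>FA\<^esub> {M_relation \<theta> i j k l | i j k l. i \<in> Ix \<and> j \<in> Ix \<and> k \<in> Ix \<and> l \<in> Ix}"
  (is "_ = Idl\<^bsub>FA\<^esub> ?R")
  and star_M_ideal: "star FA ` M_ideal \<theta> \<subseteq> M_ideal \<theta>"
proof -
  have R: "?R \<subseteq> carrier FA" by (simp add: FA_simps)
  interpret I: ideal "Idl\<^bsub>FA\<^esub> ?R" FA by (rule FA.genideal_ideal[OF R])
  have star: "star FA x \<in> Idl\<^bsub>FA\<^esub> ?R" if x_in: "x \<in> ?R" for x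
  proof -
    obtain i j k l where x: "x = M_relation \<theta> i j k l" and ix: "i \<in> Ix" "j \<in> Ix" "k \<in> Ix" "l \<in> Ix"
      using x_in by blast
    have "M_relation \<theta> (prime_index k) (prime_index l) (prime_index i) (prime_index j) \<in> ?R"
      using ix[THEN prime_index_in] by blast
    then have "M_relation \<theta> (prime_index k) (prime_index l) (prime_index i) (prime_index j) \<in> Idl\<^bsub>FA\<^esub> ?R"
      using FA.genideal_self[OF R] by blast
    then show ?thesis
      unfolding x star_M_relation[OF ix] by (rule FA.ideal_smult[OF I.ideal_axioms])
  qed
  have "M_ideal \<theta> = star_ideal FA ?R"
    unfolding M_ideal_def M_relation_def Ix_def
    by (rule arg_cong[of _ _ "star_ideal FA"]) blast
  also have "\<dots> = Idl\<^bsub>FA\<^esub> ?R" by (rule FA.star_ideal_eq_genideal[OF R star])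
  finally show "M_ideal \<theta> = Idl\<^bsub>FA\<^esub> ?R" .
  then show "star FA ` M_ideal \<theta> \<subseteq> M_ideal \<theta>" using FA.star_genideal[OF R star] by simp
qed

lemma M_relations_carrier:
  "{M_relation \<theta> i j k l | i j k l. i \<in> Ix \<and> j \<in> Ix \<and> k \<in> Ix \<and> l \<in> Ix} \<subseteq> carrier FA"
  by (simp add: FA_simps)

lemma M_algebra_star_ideal: "algebra_star_ideal FA (M_ideal \<theta>)"
  using FA.genideal_ideal[OF M_relations_carrier, of \<theta>] star_M_ideal[of \<theta>]
  unfolding M_ideal_eq[symmetric]
  by (intro algebra_star_ideal.intro FA.complex_star_algebra_axioms algebra_star_ideal_axioms.intro)

lemma M_proj_alg_hom: "(\<lambda>x. M_ideal \<theta> +>\<^bsub>FA\<^esub> x) \<in> alg_hom FA (M_alg \<theta>)"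
proof -
  interpret MI: algebra_star_ideal FA "M_ideal \<theta>" by (rule M_algebra_star_ideal)
  show ?thesis unfolding M_alg_def quot_star_hom by (rule MI.quot_proj_alg_hom)
qed

lemma M_quaternionic: "quaternionic_matrix (M_alg \<theta>) \<theta> (M_mat \<theta>)"
proof -
  interpret MI: algebra_star_ideal FA "M_ideal \<theta>" by (rule M_algebra_star_ideal)
  interpret M: complex_star_algebra "M_alg \<theta>" unfolding M_alg_def by (rule MI.quot_star_algebra_star)
  note h = alg_homD[OF M_proj_alg_hom[of \<theta>]]
  show ?thesis
  proof (intro quaternionic_matrix.intro M.complex_star_algebra_axioms twisted_matrix.intro
      M.complex_algebra_axioms twisted_matrix_axioms.intro quaternionic_matrix_axioms.intro)
    fix i j k l assume ix: "i \<in> Ix" "j \<in> Ix" "k \<in> Ix" "l \<in> Ix"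
    show "M_mat \<theta> i j \<in> carrier (M_alg \<theta>)"
      unfolding M_mat_def by (rule h(3)[OF free_mat_carrier])
    have "M_relation \<theta> i j k l \<in> M_ideal \<theta>"
      unfolding M_ideal_eq using FA.genideal_self[OF M_relations_carrier] ix by blast
    then have "M_ideal \<theta> +>\<^bsub>FA\<^esub> (free_mat i j \<otimes>\<^bsub>FA\<^esub> free_mat k l) = M_ideal \<theta> +>\<^bsub>FA\<^esub>
        ((\<eta> \<theta> k i * \<eta> \<theta> j l) \<odot>\<^bsub>FA\<^esub> (free_mat k l \<otimes>\<^bsub>FA\<^esub> free_mat i j))"
      unfolding M_relation_def by (subst MI.coset_eq_iff) (simp_all add: free_mat_carrier)
    then show "M_mat \<theta> i j \<otimes>\<^bsub>M_alg \<theta>\<^esub> M_mat \<theta> k l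
        = (\<eta> \<theta> k i * \<eta> \<theta> j l) \<odot>\<^bsub>M_alg \<theta>\<^esub> (M_mat \<theta> k l \<otimes>\<^bsub>M_alg \<theta>\<^esub> M_mat \<theta> i j)"
      unfolding M_mat_def by (simp add: h free_mat_carrier)
  next
    fix i j assume ix: "i \<in> Ix" "j \<in> Ix"
    show "star (M_alg \<theta>) (M_mat \<theta> i j)
        = (-1) ^ (i + j) \<odot>\<^bsub>M_alg \<theta>\<^esub> M_mat \<theta> (prime_index i) (prime_index j)"
      unfolding M_mat_def M_alg_def
      by (simp add: MI.star_coset free_mat_carrier star_free_mat ix MI.coset_smult quot_star_algebra_simps)
  qed
qed

interpretation M: quaternionic_matrix "M_alg \<theta>" \<theta> "M_mat \<theta>" for \<theta>
  by (rule M_quaternionic)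

lemma M_det_eq: "M_det \<theta> = twisted_matrix.row_det (M_alg \<theta>) \<theta> (M_mat \<theta>) 1 2 3 4"
proof -
  let ?f = "\<lambda>p q r s. twisted_lc \<theta> p q r s \<odot>\<^bsub>M_alg \<theta>\<^esub> (M_mat \<theta> 1 p \<otimes>\<^bsub>M_alg \<theta>\<^esub> M_mat \<theta> 2 q
      \<otimes>\<^bsub>M_alg \<theta>\<^esub> M_mat \<theta> 3 r \<otimes>\<^bsub>M_alg \<theta>\<^esub> M_mat \<theta> 4 s)"
  have s: "\<sigma> i \<in> Ix" if "\<sigma> permutes Ix" "i \<in> Ix" for \<sigma> i
    using permutes_in_image[OF that(1)] that(2) by blast
  have "M_det \<theta> = (\<Oplus>\<^bsub>M_alg \<theta>\<^esub>\<sigma>\<in>{\<sigma>. \<sigma> permutes Ix}. ?f (\<sigma> 1) (\<sigma> 2) (\<sigma> 3) (\<sigma> 4))"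
    unfolding M_det_def Ix_def[symmetric]
    by (rule M.fsum_cong) (simp_all add: s sign_eq_sgn4 twisted_lc_def)
  also have "\<dots> = sum4 (M_alg \<theta>) ?f"
  proof (rule M.fsum_permutations4)
    fix p q r s assume "p \<in> Ix" "q \<in> Ix" "r \<in> Ix" "s \<in> Ix" "\<not> distinct [p, q, r, s]"
    then show "?f p q r s = \<zero>\<^bsub>M_alg \<theta>\<^esub>" using twisted_lc_nondistinct[of p q r s \<theta>] by simp
  qed simp
  finally show ?thesis unfolding M.row_det_def .
qed

lemma M_generated: "generated_by_entries (M_alg \<theta>) (M_mat \<theta>)"
  by (rule generated_image[OF FA_generated M_proj_alg_hom])
    (simp_all add: M_alg_def quot_star_algebra_simps carrier_quot_algebra M_mat_def)

text \<open>The universal property of M. The kernel of the map from the free algebra contains every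
  \<open>M_relation\<close>, because these are the commutation relations of
  \<open>b\<close>.\<close>

lemma M_hom_exists:
  assumes "twisted_matrix B \<theta> b"
  obtains f where "f \<in> alg_hom (M_alg \<theta>) B" "\<And>i j. i \<in> Ix \<Longrightarrow> j \<in> Ix \<Longrightarrow> f (M_mat \<theta> i j) = b i j"
proof -
  interpret MI: algebra_star_ideal FA "M_ideal \<theta>" by (rule M_algebra_star_ideal)
  interpret B: twisted_matrix B \<theta> b by fact
  obtain f where f: "f \<in> alg_hom FA B" "\<And>i j. i \<in> Ix \<Longrightarrow> j \<in> Ix \<Longrightarrow> f (free_mat i j) = b i j"
    using free_hom_exists[OF B.complex_algebra_axioms, of b] B.entry_closed by blast
  note h = alg_homD[OF f(1)]
  let ?K = "{x \<in> carrier FA. f x = \<zero>\<^bsub>B\<^esub>}"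
  have "M_relation \<theta> i j k l \<in> ?K" if ix: "i \<in> Ix" "j \<in> Ix" "k \<in> Ix" "l \<in> Ix" for i j k l
  proof -
    have "f (M_relation \<theta> i j k l) = b i j \<otimes>\<^bsub>B\<^esub> b k l \<ominus>\<^bsub>B\<^esub> (\<eta> \<theta> k i * \<eta> \<theta> j l) \<odot>\<^bsub>B\<^esub> (b k l \<otimes>\<^bsub>B\<^esub> b i j)"
      unfolding M_relation_def
      using linear_hom_diff[OF FA.complex_algebra_axioms B.complex_algebra_axioms h(1)] ix
      by (simp add: h free_mat_carrier f(2))
    also have "\<dots> = \<zero>\<^bsub>B\<^esub>"
      unfolding B.twisted_comm[OF ix] using ix by (simp add: B.minus_eq B.r_neg)
    finally show ?thesis by (simp add: FA_simps)
  qed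
  then have "M_ideal \<theta> \<subseteq> ?K"
    unfolding M_ideal_eq
    by (intro FA.genideal_minimal kernel_ideal[OF FA.complex_algebra_axioms B.complex_algebra_axioms f(1)]) blast
  then obtain g where "g \<in> alg_hom (quot_algebra FA (M_ideal \<theta>)) B"
    "\<And>x. x \<in> carrier FA \<Longrightarrow> g (M_ideal \<theta> +>\<^bsub>FA\<^esub> x) = f x"
    using MI.quot_factor_alg[OF B.complex_algebra_axioms f(1)] by blast
  then show thesis
    using that[of g] f(2) by (simp add: M_alg_def quot_star_hom M_mat_def free_mat_carrier)
qed

text \<open>\<open>SL_ideal\<close> is generated without reference to the star; it is stable because
  the determinant is fixed by the star. This makes the star well defined on the quotient.\<close>

lemma SL_algebra_star_ideal: "algebra_star_ideal (M_alg \<theta>) (SL_ideal \<theta>)"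
proof -
  let ?r = "M_det \<theta> \<ominus>\<^bsub>M_alg \<theta>\<^esub> \<one>\<^bsub>M_alg \<theta>\<^esub>"
  have d: "M_det \<theta> \<in> carrier (M_alg \<theta>)" unfolding M_det_eq by (rule M.row_det_closed) simp_all
  have r: "{?r} \<subseteq> carrier (M_alg \<theta>)" using d by simp
  have star: "star (M_alg \<theta>) x \<in> Idl\<^bsub>M_alg \<theta>\<^esub> {?r}" if "x \<in> {?r}" for x
  proof -
    have "star (M_alg \<theta>) (M_det \<theta>) = M_det \<theta>" unfolding M_det_eq by (rule M.star_row_det)
    then have "star (M_alg \<theta>) ?r = ?r" using d by (simp add: M.star_diff M.star_one)
    then show ?thesis using that M.genideal_self[OF r] by auto
  qed
  show ?thesis
    unfolding SL_ideal_def
    by (intro algebra_star_ideal.intro M.complex_star_algebra_axioms M.genideal_ideal[OF r]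
        algebra_star_ideal_axioms.intro M.star_genideal[OF r star])
qed

lemma SL_proj_alg_hom: "(\<lambda>x. SL_ideal \<theta> +>\<^bsub>M_alg \<theta>\<^esub> x) \<in> alg_hom (M_alg \<theta>) (SL_alg \<theta>)"
proof -
  interpret SLI: algebra_star_ideal "M_alg \<theta>" "SL_ideal \<theta>" by (rule SL_algebra_star_ideal)
  show ?thesis unfolding SL_alg_def quot_star_hom by (rule SLI.quot_proj_alg_hom)
qed

lemma SL_quaternionic: "quaternionic_matrix (SL_alg \<theta>) \<theta> (SL_mat \<theta>)"
proof -
  interpret SLI: algebra_star_ideal "M_alg \<theta>" "SL_ideal \<theta>" by (rule SL_algebra_star_ideal)
  interpret SL: complex_star_algebra "SL_alg \<theta>" unfolding SL_alg_def by (rule SLI.quot_star_algebra_star)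
  show ?thesis
  proof (intro quaternionic_matrix.intro SL.complex_star_algebra_axioms quaternionic_matrix_axioms.intro)
    show "twisted_matrix (SL_alg \<theta>) \<theta> (SL_mat \<theta>)"
      by (rule alg_hom_twisted(1)[OF M.twisted_matrix_axioms SL.complex_algebra_axioms SL_proj_alg_hom])
        (simp add: SL_mat_def)
    fix i j assume ix: "i \<in> Ix" "j \<in> Ix"
    show "star (SL_alg \<theta>) (SL_mat \<theta> i j)
        = (-1) ^ (i + j) \<odot>\<^bsub>SL_alg \<theta>\<^esub> SL_mat \<theta> (prime_index i) (prime_index j)"
      unfolding SL_mat_def SL_alg_def
      by (simp add: SLI.star_coset M.star_entry ix SLI.coset_smult quot_star_algebra_simps)
  qed
qed

interpretation SL: quaternionic_matrix "SL_alg \<theta>" \<theta> "SL_mat \<theta>" for \<theta>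
  by (rule SL_quaternionic)

lemma SL_special: "special_twisted_matrix (SL_alg \<theta>) \<theta> (SL_mat \<theta>)"
proof -
  interpret SLI: algebra_star_ideal "M_alg \<theta>" "SL_ideal \<theta>" by (rule SL_algebra_star_ideal)
  let ?r = "M_det \<theta> \<ominus>\<^bsub>M_alg \<theta>\<^esub> \<one>\<^bsub>M_alg \<theta>\<^esub>"
  have d: "M_det \<theta> \<in> carrier (M_alg \<theta>)" unfolding M_det_eq by (rule M.row_det_closed) simp_all
  have "?r \<in> SL_ideal \<theta>"
    unfolding SL_ideal_def using M.genideal_self[of "{?r}"] d by auto
  then have "SL_ideal \<theta> +>\<^bsub>M_alg \<theta>\<^esub> M_det \<theta> = SL_ideal \<theta> +>\<^bsub>M_alg \<theta>\<^esub> \<one>\<^bsub>M_alg \<theta>\<^esub>"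
    using d by (subst SLI.coset_eq_iff) simp_all
  also have "\<dots> = \<one>\<^bsub>SL_alg \<theta>\<^esub>" by (rule alg_homD(2)[OF SL_proj_alg_hom])
  finally have "SL.row_det \<theta> 1 2 3 4 = \<one>\<^bsub>SL_alg \<theta>\<^esub>"
    using alg_hom_twisted(2)[OF M.twisted_matrix_axioms SL.complex_algebra_axioms SL_proj_alg_hom, of "SL_mat \<theta>"]
    by (simp add: SL_mat_def M_det_eq)
  then show ?thesis
    by (intro special_twisted_matrix.intro SL.twisted_matrix_axioms special_twisted_matrix_axioms.intro)
qed

interpretation SL: special_twisted_matrix "SL_alg \<theta>" \<theta> "SL_mat \<theta>" for \<theta>
  by (rule SL_special)

lemma SL_generated: "generated_by_entries (SL_alg \<theta>) (SL_mat \<theta>)"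
  by (rule generated_image[OF M_generated SL_proj_alg_hom])
    (simp_all add: SL_alg_def quot_star_algebra_simps carrier_quot_algebra SL_mat_def)

text \<open>The universal property of SL and the common source of its structure maps: the coproduct
  matrix, the identity matrix and the cofactor matrix over the opposite algebra are the points
  used.\<close>

lemma SL_hom_exists:
  assumes "special_twisted_matrix B \<theta> b"
  obtains f where "f \<in> alg_hom (SL_alg \<theta>) B" "\<And>i j. i \<in> Ix \<Longrightarrow> j \<in> Ix \<Longrightarrow> f (SL_mat \<theta> i j) = b i j"
proof -
  interpret SLI: algebra_star_ideal "M_alg \<theta>" "SL_ideal \<theta>" by (rule SL_algebra_star_ideal)
  interpret B: special_twisted_matrix B \<theta> b by fact
  obtain f where f: "f \<in> alg_hom (M_alg \<theta>) B" "\<And>i j. i \<in> Ix \<Longrightarrow> j \<in> Ix \<Longrightarrow> f (M_mat \<theta> i j) = b i j"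
    using M_hom_exists[OF B.twisted_matrix_axioms] by blast
  note h = alg_homD[OF f(1)]
  let ?K = "{x \<in> carrier (M_alg \<theta>). f x = \<zero>\<^bsub>B\<^esub>}"
  have d: "M_det \<theta> \<in> carrier (M_alg \<theta>)" unfolding M_det_eq by (rule M.row_det_closed) simp_all
  have "f (M_det \<theta>) = B.row_det 1 2 3 4"
    unfolding M_det_eq
    by (rule alg_hom_twisted(2)[OF M.twisted_matrix_axioms B.complex_algebra_axioms f(1)]) (simp add: f(2))
  then have "f (M_det \<theta>) = \<one>\<^bsub>B\<^esub>" using B.det_one by simp
  then have "f (M_det \<theta> \<ominus>\<^bsub>M_alg \<theta>\<^esub> \<one>\<^bsub>M_alg \<theta>\<^esub>) = \<zero>\<^bsub>B\<^esub>"
    using linear_hom_diff[OF M.complex_algebra_axioms B.complex_algebra_axioms h(1) d M.one_closed]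
    by (simp add: h B.minus_eq B.r_neg)
  then have "SL_ideal \<theta> \<subseteq> ?K"
    unfolding SL_ideal_def using d
    by (intro M.genideal_minimal kernel_ideal[OF M.complex_algebra_axioms B.complex_algebra_axioms f(1)]) simp
  then obtain g where "g \<in> alg_hom (quot_algebra (M_alg \<theta>) (SL_ideal \<theta>)) B"
    "\<And>x. x \<in> carrier (M_alg \<theta>) \<Longrightarrow> g (SL_ideal \<theta> +>\<^bsub>M_alg \<theta>\<^esub> x) = f x"
    using SLI.quot_factor_alg[OF B.complex_algebra_axioms f(1)] by blast
  then show thesis
    using that[of g] f(2) by (simp add: SL_alg_def quot_star_hom SL_mat_def)
qed

lemma SL_hat_cofactor:
  assumes "i \<in> Ix" "l \<in> Ix"
  shows "(-1) ^ (i + l) \<odot>\<^bsub>SL_alg \<theta>\<^esub> SL_hat \<theta> i l = twisted_matrix.cofactor (SL_alg \<theta>) \<theta> (SL_mat \<theta>) l i"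
  unfolding SL_hat_def Ix_def[symmetric]
  by (rule twisted_matrix.hat_cofactor[OF special_twisted_matrix.axioms(1)[OF SL_special] assms])

text \<open>\<open>SL_comult\<close> is a choice, so its defining property holds once some map has
  it; the point \<open>tensor_square_special\<close> supplies one. The counit and the antipode
  follow the same pattern.\<close>

lemma SL_comult:
  "SL_comult \<theta> \<in> alg_hom (SL_alg \<theta>) (tensor (SL_alg \<theta>) (SL_alg \<theta>))"
  "i \<in> Ix \<Longrightarrow> j \<in> Ix \<Longrightarrow> SL_comult \<theta> (SL_mat \<theta> i j) = (\<Oplus>\<^bsub>tensor (SL_alg \<theta>) (SL_alg \<theta>)\<^esub>k\<in>Ix.
    pure_tensor (SL_alg \<theta>) (SL_alg \<theta>) (SL_mat \<theta> i k) (SL_mat \<theta> k j))"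
proof -
  obtain f where "f \<in> alg_hom (SL_alg \<theta>) (tensor (SL_alg \<theta>) (SL_alg \<theta>))"
    "\<And>i j. i \<in> Ix \<Longrightarrow> j \<in> Ix \<Longrightarrow> f (SL_mat \<theta> i j) = (\<Oplus>\<^bsub>tensor (SL_alg \<theta>) (SL_alg \<theta>)\<^esub>k\<in>Ix.
      pure_tensor (SL_alg \<theta>) (SL_alg \<theta>) (SL_mat \<theta> i k) (SL_mat \<theta> k j))"
    by (rule SL_hom_exists[OF tensor_square_special[OF SL_special]]) blast
  then have "\<exists>f. f \<in> alg_hom (SL_alg \<theta>) (tensor (SL_alg \<theta>) (SL_alg \<theta>)) \<and>
    (\<forall>i\<in>Ix. \<forall>j\<in>Ix. f (SL_mat \<theta> i j) = (\<Oplus>\<^bsub>tensor (SL_alg \<theta>) (SL_alg \<theta>)\<^esub>k\<in>Ix.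
      pure_tensor (SL_alg \<theta>) (SL_alg \<theta>) (SL_mat \<theta> i k) (SL_mat \<theta> k j)))" by blast
  from someI_ex[OF this]
  show "SL_comult \<theta> \<in> alg_hom (SL_alg \<theta>) (tensor (SL_alg \<theta>) (SL_alg \<theta>))"
    "i \<in> Ix \<Longrightarrow> j \<in> Ix \<Longrightarrow> SL_comult \<theta> (SL_mat \<theta> i j) = (\<Oplus>\<^bsub>tensor (SL_alg \<theta>) (SL_alg \<theta>)\<^esub>k\<in>Ix.
      pure_tensor (SL_alg \<theta>) (SL_alg \<theta>) (SL_mat \<theta> i k) (SL_mat \<theta> k j))"
    unfolding SL_comult_def Ix_def[symmetric] by blast+
qed

text \<open>Two diagonal entries in rows \<open>i\<close> and \<open>k\<close> commute up to
  \<open>\<eta> \<theta> k i * \<eta> \<theta> i k = 1\<close>, and the determinant has the single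
  nonzero term 1, 2, 3, 4.\<close>

lemma identity_special: "special_twisted_matrix complex_alg \<theta> (\<lambda>i j. if i = j then 1 else 0)"
proof -
  interpret C: complex_algebra complex_alg by (rule complex_algebra_complex_alg)
  have tw: "twisted_matrix complex_alg \<theta> (\<lambda>i j. if i = j then 1 else 0)"
    by (intro twisted_matrix.intro C.complex_algebra_axioms twisted_matrix_axioms.intro) auto
  then interpret T: twisted_matrix complex_alg \<theta> "\<lambda>i j. if i = j then 1 else 0" .
  have "T.row_det 1 2 3 4 = 1"
    unfolding T.row_det_def sum4_def
    by (subst C.fsum_eq_single[of _ "(1, 2, 3, 4)"]) (auto split: if_splits)
  then show ?thesis
    by (intro special_twisted_matrix.intro tw special_twisted_matrix_axioms.intro) simp
qed

lemma SL_counit: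
  "SL_counit \<theta> \<in> alg_hom (SL_alg \<theta>) complex_alg"
  "i \<in> Ix \<Longrightarrow> j \<in> Ix \<Longrightarrow> SL_counit \<theta> (SL_mat \<theta> i j) = (if i = j then 1 else 0)"
proof -
  obtain f where "f \<in> alg_hom (SL_alg \<theta>) complex_alg"
    "\<And>i j. i \<in> Ix \<Longrightarrow> j \<in> Ix \<Longrightarrow> f (SL_mat \<theta> i j) = (if i = j then 1 else 0)"
    by (rule SL_hom_exists[OF identity_special]) blast
  then have "\<exists>f. f \<in> alg_hom (SL_alg \<theta>) complex_alg \<and>
    (\<forall>i\<in>Ix. \<forall>j\<in>Ix. f (SL_mat \<theta> i j) = (if i = j then 1 else 0))" by blast
  from someI_ex[OF this]
  show "SL_counit \<theta> \<in> alg_hom (SL_alg \<theta>) complex_alg"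
    "i \<in> Ix \<Longrightarrow> j \<in> Ix \<Longrightarrow> SL_counit \<theta> (SL_mat \<theta> i j) = (if i = j then 1 else 0)"
    unfolding SL_counit_def Ix_def[symmetric] by blast+
qed

lemma SL_antipode:
  "SL_antipode \<theta> \<in> alg_hom (SL_alg \<theta>) (op_algebra (SL_alg \<theta>))"
  "i \<in> Ix \<Longrightarrow> j \<in> Ix \<Longrightarrow>
    SL_antipode \<theta> (SL_mat \<theta> i j) = twisted_matrix.cofactor (SL_alg \<theta>) \<theta> (SL_mat \<theta>) i j"
proof -
  \<comment> \<open>\<open>SL_hat\<close> is indexed by the deleted row and column,
    \<open>cofactor\<close> by the position in the inverse matrix; hence the exchanged
    indices.\<close>
  have hat: "(-1) ^ (i + j) \<odot>\<^bsub>SL_alg \<theta>\<^esub> SL_hat \<theta> j i = SL.cofactor \<theta> i j" if "i \<in> Ix" "j \<in> Ix" for i j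
    using SL_hat_cofactor[OF that(2,1)] by (simp add: add.commute)
  obtain f where "f \<in> alg_hom (SL_alg \<theta>) (op_algebra (SL_alg \<theta>))"
    "\<And>i j. i \<in> Ix \<Longrightarrow> j \<in> Ix \<Longrightarrow> f (SL_mat \<theta> i j) = SL.cofactor \<theta> i j"
    by (rule SL_hom_exists[OF SL.cofactor_special]) blast
  then have "\<exists>f. f \<in> alg_antihom (SL_alg \<theta>) (SL_alg \<theta>) \<and>
    (\<forall>i\<in>Ix. \<forall>j\<in>Ix. f (SL_mat \<theta> i j) = (-1) ^ (i + j) \<odot>\<^bsub>SL_alg \<theta>\<^esub> SL_hat \<theta> j i)"
    unfolding alg_antihom_op using hat by auto
  from someI_ex[OF this]
  have a: "SL_antipode \<theta> \<in> alg_antihom (SL_alg \<theta>) (SL_alg \<theta>)"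
    "\<forall>i\<in>Ix. \<forall>j\<in>Ix. SL_antipode \<theta> (SL_mat \<theta> i j) = (-1) ^ (i + j) \<odot>\<^bsub>SL_alg \<theta>\<^esub> SL_hat \<theta> j i"
    unfolding SL_antipode_def Ix_def[symmetric] by blast+
  from a(1) show "SL_antipode \<theta> \<in> alg_hom (SL_alg \<theta>) (op_algebra (SL_alg \<theta>))"
    unfolding alg_antihom_op .
  show "i \<in> Ix \<Longrightarrow> j \<in> Ix \<Longrightarrow> SL_antipode \<theta> (SL_mat \<theta> i j) = SL.cofactor \<theta> i j"
    using a(2) hat by simp
qed

section \<open>Hopf algebras generated by a matrix\<close>

lemma (in complex_algebra) bilinear_smult_functional:
  assumes "e \<in> alg_hom A complex_alg"
  shows "bilinear_map A A A (\<lambda>y z. e y \<odot> z)" "bilinear_map A A A (\<lambda>y z. e z \<odot> y)"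
  using alg_homD[OF assms]
  by (auto intro!: bilinear_mapI linear_homI simp: smult_add_left smult_add_right mult.commute)

text \<open>Coassociativity and the counit laws compare algebra homomorphisms and are settled on the
  entries, where they are double sums over the same indices. The antipode laws are shown by
  induction, with a separate argument for products.\<close>

lemma matrix_hopf_algebra:
  fixes A (structure)
  assumes "complex_algebra A" and gen: "generated_by_entries A a"
    and a: "\<And>i j. i \<in> Ix \<Longrightarrow> j \<in> Ix \<Longrightarrow> a i j \<in> carrier A"
    and \<Delta>: "\<Delta> \<in> alg_hom A (tensor A A)"
      "\<And>i j. i \<in> Ix \<Longrightarrow> j \<in> Ix \<Longrightarrow> \<Delta> (a i j) = (\<Oplus>\<^bsub>tensor A A\<^esub>k\<in>Ix. pure_tensor A A (a i k) (a k j))"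
    and \<epsilon>: "\<epsilon> \<in> alg_hom A complex_alg"
      "\<And>i j. i \<in> Ix \<Longrightarrow> j \<in> Ix \<Longrightarrow> \<epsilon> (a i j) = (if i = j then 1 else 0)"
    and S: "S \<in> alg_hom A (op_algebra A)"
      "\<And>i j. i \<in> Ix \<Longrightarrow> j \<in> Ix \<Longrightarrow> (\<Oplus>k\<in>Ix. S (a i k) \<otimes> a k j) = (if i = j then \<one> else \<zero>)"
      "\<And>i j. i \<in> Ix \<Longrightarrow> j \<in> Ix \<Longrightarrow> (\<Oplus>k\<in>Ix. a i k \<otimes> S (a k j)) = (if i = j then \<one> else \<zero>)"
  shows "hopf_algebra A \<Delta> \<epsilon> S"
proof -
  interpret A: complex_algebra A by fact
  interpret AA: tensor_product A A by unfold_locales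
  interpret A_AA: tensor_product A "tensor A A" by unfold_locales
  interpret AA_A: tensor_product "tensor A A" A by unfold_locales
  note D = alg_homD[OF \<Delta>(1)] and e = alg_homD[OF \<epsilon>(1)] and s = alg_homD[OF S(1), simplified]
  note AC = A.complex_algebra_axioms and AAC = AA.T.complex_algebra_axioms
  have Slin: "S \<in> linear_hom A A" using s(1) by (simp add: linear_hom_def)

  have coassoc: "tensor_assoc A (tensor_map (tensor A A) A \<Delta> (\<lambda>y. y) (\<Delta> x))
      = tensor_map A (tensor A A) (\<lambda>y. y) \<Delta> (\<Delta> x)" if x: "x \<in> carrier A" for x
  proof -
    note m1 = tensor_map_alg_hom[OF AC AC AAC AC \<Delta>(1) alg_hom_id]
    note m2 = tensor_map_alg_hom[OF AC AC AC AAC alg_hom_id \<Delta>(1)]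
    note as = tensor_assoc_alg_hom[OF AC]
    let ?l = "\<lambda>x. tensor_assoc A (tensor_map (tensor A A) A \<Delta> (\<lambda>y. y) (\<Delta> x))"
    let ?r = "\<lambda>x. tensor_map A (tensor A A) (\<lambda>y. y) \<Delta> (\<Delta> x)"
    have l: "?l \<in> alg_hom A (tensor A (tensor A A))"
      by (rule alg_hom_compose[OF alg_hom_compose[OF \<Delta>(1) m1(1)] as(1)])
    have r: "?r \<in> alg_hom A (tensor A (tensor A A))"
      by (rule alg_hom_compose[OF \<Delta>(1) m2(1)])
    show ?thesis
    proof (rule alg_hom_eqI[OF gen l r _ x])
      fix i j assume ix: "i \<in> Ix" "j \<in> Ix"
      have lin1: "(\<lambda>t. pure_tensor (tensor A A) A t y) \<in> linear_hom (tensor A A) (tensor (tensor A A) A)"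
        if "y \<in> carrier A" for y
        using AA_A.pure_bilinear that by (simp add: bilinear_map_def)
      have lin2: "pure_tensor A (tensor A A) y \<in> linear_hom (tensor A A) (tensor A (tensor A A))"
        if "y \<in> carrier A" for y
        using A_AA.pure_bilinear that by (simp add: bilinear_map_def)
      have "tensor_map (tensor A A) A \<Delta> (\<lambda>y. y) (\<Delta> (a i j))
        = (\<Oplus>\<^bsub>tensor (tensor A A) A\<^esub>k\<in>Ix. AA_A.pure (\<Delta> (a i k)) (a k j))"
        unfolding \<Delta>(2)[OF ix] using ix a
        by (subst linear_hom_finsum[OF AAC AA_A.T.complex_algebra_axioms alg_homD(1)[OF m1(1)]])
          (simp_all add: m1(2) D cong: AA_A.T.finsum_cong)
      also have "\<dots> = (\<Oplus>\<^bsub>tensor (tensor A A) A\<^esub>k\<in>Ix. \<Oplus>\<^bsub>tensor (tensor A A) A\<^esub>m\<in>Ix.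
          AA_A.pure (AA.pure (a i m) (a m k)) (a k j))"
      proof (rule AA_A.T.fsum_cong)
        fix k assume k: "k \<in> Ix"
        show "AA_A.pure (\<Delta> (a i k)) (a k j) = (\<Oplus>\<^bsub>tensor (tensor A A) A\<^esub>m\<in>Ix.
          AA_A.pure (AA.pure (a i m) (a m k)) (a k j))"
          unfolding \<Delta>(2)[OF ix(1) k] using ix k a
          by (intro linear_hom_finsum[OF AAC AA_A.T.complex_algebra_axioms lin1]) simp_all
      qed (use ix a in simp)
      finally have "?l (a i j) = tensor_assoc A (\<Oplus>\<^bsub>tensor (tensor A A) A\<^esub>k\<in>Ix. \<Oplus>\<^bsub>tensor (tensor A A) A\<^esub>m\<in>Ix.
          AA_A.pure (AA.pure (a i m) (a m k)) (a k j))" by simp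
      also have "\<dots> = (\<Oplus>\<^bsub>tensor A (tensor A A)\<^esub>k\<in>Ix. \<Oplus>\<^bsub>tensor A (tensor A A)\<^esub>m\<in>Ix.
          A_AA.pure (a i m) (AA.pure (a m k) (a k j)))"
        using ix a
        by (simp add: linear_hom_finsum[OF AA_A.T.complex_algebra_axioms A_AA.T.complex_algebra_axioms alg_homD(1)[OF as(1)]]
            as(2) cong: A_AA.T.finsum_cong)
      also have "\<dots> = (\<Oplus>\<^bsub>tensor A (tensor A A)\<^esub>m\<in>Ix. \<Oplus>\<^bsub>tensor A (tensor A A)\<^esub>k\<in>Ix.
          A_AA.pure (a i m) (AA.pure (a m k) (a k j)))"
        using ix a by (intro A_AA.T.fsum_swap) simp_all
      also have "\<dots> = (\<Oplus>\<^bsub>tensor A (tensor A A)\<^esub>m\<in>Ix. A_AA.pure (a i m) (\<Delta> (a m j)))"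
      proof (rule A_AA.T.fsum_cong)
        fix m assume m: "m \<in> Ix"
        show "(\<Oplus>\<^bsub>tensor A (tensor A A)\<^esub>k\<in>Ix. A_AA.pure (a i m) (AA.pure (a m k) (a k j)))
          = A_AA.pure (a i m) (\<Delta> (a m j))"
          unfolding \<Delta>(2)[OF m ix(2)] using ix m a
          by (intro linear_hom_finsum[OF AAC A_AA.T.complex_algebra_axioms lin2, symmetric]) simp_all
      qed (use ix a D in simp)
      also have "\<dots> = ?r (a i j)"
        unfolding \<Delta>(2)[OF ix] using ix a
        by (subst linear_hom_finsum[OF AAC A_AA.T.complex_algebra_axioms alg_homD(1)[OF m2(1)]])
          (simp_all add: m2(2) D cong: A_AA.T.finsum_cong)
      finally show "?l (a i j) = ?r (a i j)" .
    qed
  qed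

  have counit_left: "tensor_lift A (\<lambda>y z. \<epsilon> y \<odot> z) (\<Delta> x) = x" if x: "x \<in> carrier A" for x
  proof -
    note b = A.bilinear_smult_functional(1)[OF \<epsilon>(1)]
    have h: "tensor_lift A (\<lambda>y z. \<epsilon> y \<odot> z) \<in> alg_hom (tensor A A) A"
      by (rule AA.tensor_lift_alg_hom[OF AC b]) (simp_all add: e mult.commute)
    show ?thesis
    proof (rule alg_hom_eqI[OF gen alg_hom_compose[OF \<Delta>(1) h] alg_hom_id _ x])
      fix i j assume ix: "i \<in> Ix" "j \<in> Ix"
      have "tensor_lift A (\<lambda>y z. \<epsilon> y \<odot> z) (\<Delta> (a i j)) = (\<Oplus>k\<in>Ix. \<epsilon> (a i k) \<odot> a k j)"
        unfolding \<Delta>(2)[OF ix] using ix a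
        by (subst linear_hom_finsum[OF AAC AC alg_homD(1)[OF h]])
          (simp_all add: AA.tensor_lift_pure[OF AC b] cong: A.finsum_cong)
      also have "\<dots> = a i j"
        using ix a \<epsilon>(2) by (subst A.fsum_eq_single[of Ix i]) auto
      finally show "tensor_lift A (\<lambda>y z. \<epsilon> y \<odot> z) (\<Delta> (a i j)) = a i j" .
    qed
  qed

  have counit_right: "tensor_lift A (\<lambda>y z. \<epsilon> z \<odot> y) (\<Delta> x) = x" if x: "x \<in> carrier A" for x
  proof -
    note b = A.bilinear_smult_functional(2)[OF \<epsilon>(1)]
    have h: "tensor_lift A (\<lambda>y z. \<epsilon> z \<odot> y) \<in> alg_hom (tensor A A) A"
      by (rule AA.tensor_lift_alg_hom[OF AC b]) (simp_all add: e mult.commute)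
    show ?thesis
    proof (rule alg_hom_eqI[OF gen alg_hom_compose[OF \<Delta>(1) h] alg_hom_id _ x])
      fix i j assume ix: "i \<in> Ix" "j \<in> Ix"
      have "tensor_lift A (\<lambda>y z. \<epsilon> z \<odot> y) (\<Delta> (a i j)) = (\<Oplus>k\<in>Ix. \<epsilon> (a k j) \<odot> a i k)"
        unfolding \<Delta>(2)[OF ix] using ix a
        by (subst linear_hom_finsum[OF AAC AC alg_homD(1)[OF h]])
          (simp_all add: AA.tensor_lift_pure[OF AC b] cong: A.finsum_cong)
      also have "\<dots> = a i j"
        using ix a \<epsilon>(2) by (subst A.fsum_eq_single[of Ix j]) auto
      finally show "tensor_lift A (\<lambda>y z. \<epsilon> z \<odot> y) (\<Delta> (a i j)) = a i j" .
    qed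
  qed

  have bl: "bilinear_map A A A (\<lambda>y z. S y \<otimes> z)"
    by (intro bilinear_mapI linear_homI) (simp_all add: s A.l_distr A.r_distr)
  have br: "bilinear_map A A A (\<lambda>y z. y \<otimes> S z)"
    by (intro bilinear_mapI linear_homI) (simp_all add: s A.l_distr A.r_distr)
  let ?l = "tensor_lift A (\<lambda>y z. S y \<otimes> z)" and ?r = "tensor_lift A (\<lambda>y z. y \<otimes> S z)"
  note lp = AA.tensor_lift_pure[OF AC bl] and rp = AA.tensor_lift_pure[OF AC br]
  note ll = linear_homD[OF AA.tensor_lift_linear[OF AC bl]] and rl = linear_homD[OF AA.tensor_lift_linear[OF AC br]]

  \<comment> \<open>Since \<open>S\<close> reverses products, a pure tensor multiplied on the right
    wraps around the value: \<open>S (x y) w z = S y (S x w) z\<close>.\<close>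
  have l_mult: "?l (t \<otimes>\<^bsub>tensor A A\<^esub> AA.pure y z) = S y \<otimes> ?l t \<otimes> z"
    if t: "t \<in> carrier (tensor A A)" and yz: "y \<in> carrier A" "z \<in> carrier A" for t y z
    using t
    by (induction t rule: AA.tensor_induct)
      (use yz s in \<open>simp_all add: lp ll AA.pure_mult AA.T.l_distr A.l_distr A.r_distr A.m_assoc\<close>)
  \<comment> \<open>If the inner value is a multiple of 1, it can be pulled out of the wrapping.
    With \<open>t\<close> and \<open>u\<close> the coproducts of two elements, this is the product
    case of the left antipode law.\<close>
  have l_scalar: "?l (t \<otimes>\<^bsub>tensor A A\<^esub> u) = c \<odot> ?l u"
    if t: "t \<in> carrier (tensor A A)" "?l t = c \<odot> \<one>" and u: "u \<in> carrier (tensor A A)" for t u c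
    using u
    by (induction u rule: AA.tensor_induct)
      (use t s in \<open>simp_all add: l_mult lp ll AA.T.r_distr A.smult_add_right\<close>)
  \<comment> \<open>The mirror image: here the pure tensor stands on the left, so the scalar comes
    from the second factor of the product.\<close>
  have r_mult: "?r (AA.pure y z \<otimes>\<^bsub>tensor A A\<^esub> t) = y \<otimes> ?r t \<otimes> S z"
    if t: "t \<in> carrier (tensor A A)" and yz: "y \<in> carrier A" "z \<in> carrier A" for t y z
    using t
    by (induction t rule: AA.tensor_induct)
      (use yz s in \<open>simp_all add: rp rl AA.pure_mult AA.T.r_distr A.l_distr A.r_distr A.m_assoc\<close>)
  have r_scalar: "?r (u \<otimes>\<^bsub>tensor A A\<^esub> t) = c \<odot> ?r u"
    if t: "t \<in> carrier (tensor A A)" "?r t = c \<odot> \<one>" and u: "u \<in> carrier (tensor A A)" for t u c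
    using u
    by (induction u rule: AA.tensor_induct)
      (use t s in \<open>simp_all add: r_mult rp rl AA.T.l_distr A.smult_add_right\<close>)

  have antipode_left: "?l (\<Delta> x) = \<epsilon> x \<odot> \<one>" if "x \<in> carrier A" for x
    using gen that
  proof (induction x rule: generated_induct)
    case one
    show ?case using lp[of \<one> \<one>] by (simp add: D e s AA.pure_one)
  next
    case (entry i j)
    have "?l (\<Delta> (a i j)) = (\<Oplus>k\<in>Ix. S (a i k) \<otimes> a k j)"
      unfolding \<Delta>(2)[OF entry] using entry a
      by (subst linear_hom_finsum[OF AAC AC AA.tensor_lift_linear[OF AC bl]])
        (simp_all add: lp s cong: A.finsum_cong)
    then show ?case using S(2)[OF entry] \<epsilon>(2)[OF entry] by simp
  next
    case (mult x y)
    then show ?case by (simp add: D e l_scalar)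
  qed (simp_all add: D e ll A.smult_add_left)
  have antipode_right: "?r (\<Delta> x) = \<epsilon> x \<odot> \<one>" if "x \<in> carrier A" for x
    using gen that
  proof (induction x rule: generated_induct)
    case one
    show ?case using rp[of \<one> \<one>] by (simp add: D e s AA.pure_one)
  next
    case (entry i j)
    have "?r (\<Delta> (a i j)) = (\<Oplus>k\<in>Ix. a i k \<otimes> S (a k j))"
      unfolding \<Delta>(2)[OF entry] using entry a
      by (subst linear_hom_finsum[OF AAC AC AA.tensor_lift_linear[OF AC br]])
        (simp_all add: rp s cong: A.finsum_cong)
    then show ?case using S(3)[OF entry] \<epsilon>(2)[OF entry] by simp
  next
    case (mult x y)
    then show ?case by (simp add: D e r_scalar mult.commute)
  qed (simp_all add: D e rl A.smult_add_left)

  show ?thesis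
    by (intro hopf_algebra.intro AC hopf_algebra_axioms.intro \<Delta>(1) \<epsilon>(1) Slin coassoc counit_left
        counit_right antipode_left antipode_right)
qed


section \<open>The quantum symplectic group\<close>

definition dagger_relation :: "real \<Rightarrow> nat \<Rightarrow> nat \<Rightarrow> free_elem set set" where
  "dagger_relation \<theta> i j =
     (\<Oplus>\<^bsub>SL_alg \<theta>\<^esub>k\<in>Ix. star (SL_alg \<theta>) (SL_mat \<theta> k i) \<otimes>\<^bsub>SL_alg \<theta>\<^esub> SL_mat \<theta> k j)
       \<ominus>\<^bsub>SL_alg \<theta>\<^esub> (if i = j then \<one>\<^bsub>SL_alg \<theta>\<^esub> else \<zero>\<^bsub>SL_alg \<theta>\<^esub>)"

lemma dagger_relations_carrier: "{dagger_relation \<theta> i j | i j. i \<in> Ix \<and> j \<in> Ix} \<subseteq> carrier (SL_alg \<theta>)"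
  by (auto simp: dagger_relation_def)

text \<open>As the double star is trivial on entries, the star of the relation at
  \<open>(i, j)\<close> is the relation at \<open>(j, i)\<close>.\<close>

lemma Sp_ideal_eq: "Sp_ideal \<theta> = Idl\<^bsub>SL_alg \<theta>\<^esub> {dagger_relation \<theta> i j | i j. i \<in> Ix \<and> j \<in> Ix}"
proof -
  let ?R = "{dagger_relation \<theta> i j | i j. i \<in> Ix \<and> j \<in> Ix}"
  have star: "star (SL_alg \<theta>) x \<in> Idl\<^bsub>SL_alg \<theta>\<^esub> ?R" if x_in: "x \<in> ?R" for x
  proof -
    obtain i j where x: "x = dagger_relation \<theta> i j" and ix: "i \<in> Ix" "j \<in> Ix" using x_in by blast
    have "star (SL_alg \<theta>) (dagger_relation \<theta> i j) = dagger_relation \<theta> j i"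
      unfolding dagger_relation_def using ix
      by (simp add: SL.star_diff SL.star_finsum SL.star_mult SL.star_star_entry SL.star_one
          cong: SL.finsum_cong)
    moreover have "dagger_relation \<theta> j i \<in> ?R" using ix by blast
    ultimately show ?thesis
      unfolding x using subsetD[OF SL.genideal_self[OF dagger_relations_carrier]] by (simp only:)
  qed
  have "Sp_ideal \<theta> = star_ideal (SL_alg \<theta>) ?R"
    unfolding Sp_ideal_def dagger_relation_def Ix_def ..
  then show ?thesis using SL.star_ideal_eq_genideal[OF dagger_relations_carrier star] by simp
qed

lemma Sp_algebra_ideal: "algebra_ideal (SL_alg \<theta>) (Sp_ideal \<theta>)"
  unfolding Sp_ideal_eq
  by (intro algebra_ideal.intro SL.complex_algebra_axioms SL.genideal_ideal dagger_relations_carrier)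

lemma Sp_complex_algebra: "complex_algebra (Sp_alg \<theta>)"
  unfolding Sp_alg_def
  by (rule complex_algebra_cong[OF algebra_ideal.complex_algebra_quot[OF Sp_algebra_ideal]])
    (simp_all add: quot_star_algebra_simps)

lemma Sp_proj_alg_hom: "Sp_proj \<theta> \<in> alg_hom (SL_alg \<theta>) (Sp_alg \<theta>)"
proof -
  interpret SpI: algebra_ideal "SL_alg \<theta>" "Sp_ideal \<theta>" by (rule Sp_algebra_ideal)
  have "Sp_proj \<theta> = (\<lambda>x. Sp_ideal \<theta> +>\<^bsub>SL_alg \<theta>\<^esub> x)" by (simp add: fun_eq_iff Sp_proj_def)
  then show ?thesis
    using SpI.quot_proj_alg_hom
    by (simp add: Sp_alg_def quot_star_hom)
qed

definition Sp_mat :: "real \<Rightarrow> nat \<Rightarrow> nat \<Rightarrow> free_elem set set set" where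
  "Sp_mat \<theta> i j = Sp_proj \<theta> (SL_mat \<theta> i j)"

lemma Sp_special: "special_twisted_matrix (Sp_alg \<theta>) \<theta> (Sp_mat \<theta>)"
proof -
  note t = alg_hom_twisted[OF SL.twisted_matrix_axioms Sp_complex_algebra Sp_proj_alg_hom, of "Sp_mat \<theta>"]
  show ?thesis
    using t SL.det_one alg_homD(2)[OF Sp_proj_alg_hom, of \<theta>]
    by (intro special_twisted_matrix.intro special_twisted_matrix_axioms.intro) (simp_all add: Sp_mat_def)
qed

interpretation Sp: special_twisted_matrix "Sp_alg \<theta>" \<theta> "Sp_mat \<theta>" for \<theta>
  by (rule Sp_special)

lemma Sp_generated: "generated_by_entries (Sp_alg \<theta>) (Sp_mat \<theta>)"
  by (rule generated_image[OF SL_generated Sp_proj_alg_hom])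
    (auto simp: Sp_alg_def quot_star_algebra_simps carrier_quot_algebra Sp_mat_def Sp_proj_def)

text \<open>The conjugate transpose of a quaternionic matrix with the star eliminated by
  \<open>star_entry\<close>. In this form it makes sense over any algebra, in particular over those
  to which the structure maps lead.\<close>

definition dagger :: "(complex, 'a, 'm) module_scheme \<Rightarrow> (nat \<Rightarrow> nat \<Rightarrow> 'a) \<Rightarrow> nat \<Rightarrow> nat \<Rightarrow> 'a" where
  "dagger A a i k = (-1) ^ (k + i) \<odot>\<^bsub>A\<^esub> a (prime_index k) (prime_index i)"

text \<open>The star of an entry is rewritten as a signed entry before \<open>f\<close> is applied;
  for an algebra homomorphism the image is then determined by the matrix of values.\<close>

lemma hom_dagger_relation:
  assumes "complex_algebra B" "f \<in> alg_hom (SL_alg \<theta>) B" "i \<in> Ix" "j \<in> Ix"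
  shows "f (dagger_relation \<theta> i j) =
    (\<Oplus>\<^bsub>B\<^esub>k\<in>Ix. dagger B (\<lambda>i j. f (SL_mat \<theta> i j)) i k \<otimes>\<^bsub>B\<^esub> f (SL_mat \<theta> k j))
      \<ominus>\<^bsub>B\<^esub> (if i = j then \<one>\<^bsub>B\<^esub> else \<zero>\<^bsub>B\<^esub>)"
proof -
  interpret B: complex_algebra B by fact
  note h = alg_homD[OF assms(2)]
  show ?thesis
    unfolding dagger_relation_def dagger_def using assms(3,4)
    by (simp add: linear_hom_diff[OF SL.complex_algebra_axioms assms(1) h(1)]
        linear_hom_finsum[OF SL.complex_algebra_axioms assms(1) h(1)]
        linear_hom_zero[OF SL.complex_algebra_axioms assms(1) h(1)] h SL.star_entry
        cong: B.finsum_cong)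
qed

text \<open>Descent of a structure map to Sp becomes the single matrix identity \<open>rel\<close>,
  to be verified for the coproduct matrix, for the identity matrix, and for the dagger over the
  opposite algebra.\<close>

lemma Sp_hom_exists:
  assumes "complex_algebra B" "f \<in> alg_hom (SL_alg \<theta>) B"
    and b: "\<And>i j. i \<in> Ix \<Longrightarrow> j \<in> Ix \<Longrightarrow> f (SL_mat \<theta> i j) = b i j"
    and rel: "\<And>i j. i \<in> Ix \<Longrightarrow> j \<in> Ix \<Longrightarrow>
      (\<Oplus>\<^bsub>B\<^esub>k\<in>Ix. dagger B b i k \<otimes>\<^bsub>B\<^esub> b k j) = (if i = j then \<one>\<^bsub>B\<^esub> else \<zero>\<^bsub>B\<^esub>)"
  obtains g where "g \<in> alg_hom (Sp_alg \<theta>) B" "\<And>x. x \<in> carrier (SL_alg \<theta>) \<Longrightarrow> g (Sp_proj \<theta> x) = f x"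
proof -
  interpret SpI: algebra_ideal "SL_alg \<theta>" "Sp_ideal \<theta>" by (rule Sp_algebra_ideal)
  interpret B: complex_algebra B by fact
  note h = alg_homD[OF assms(2)]
  have bc: "b i j \<in> carrier B" if "i \<in> Ix" "j \<in> Ix" for i j
    using h(3)[of "SL_mat \<theta> i j"] b that by simp
  have "f (dagger_relation \<theta> i j) = \<zero>\<^bsub>B\<^esub>" if ix: "i \<in> Ix" "j \<in> Ix" for i j
  proof -
    have "(\<Oplus>\<^bsub>B\<^esub>k\<in>Ix. dagger B (\<lambda>i j. f (SL_mat \<theta> i j)) i k \<otimes>\<^bsub>B\<^esub> f (SL_mat \<theta> k j))
        = (\<Oplus>\<^bsub>B\<^esub>k\<in>Ix. dagger B b i k \<otimes>\<^bsub>B\<^esub> b k j)"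
      using ix bc by (intro B.fsum_cong) (simp_all add: dagger_def b)
    then show ?thesis
      unfolding hom_dagger_relation[OF assms(1,2) ix] by (simp add: rel ix B.minus_eq B.r_neg)
  qed
  then have "Sp_ideal \<theta> \<subseteq> {x \<in> carrier (SL_alg \<theta>). f x = \<zero>\<^bsub>B\<^esub>}"
    unfolding Sp_ideal_eq using dagger_relations_carrier[of \<theta>]
    by (intro SL.genideal_minimal kernel_ideal[OF SL.complex_algebra_axioms assms(1,2)]) blast
  then obtain g where "g \<in> alg_hom (quot_algebra (SL_alg \<theta>) (Sp_ideal \<theta>)) B"
    "\<And>x. x \<in> carrier (SL_alg \<theta>) \<Longrightarrow> g (Sp_ideal \<theta> +>\<^bsub>SL_alg \<theta>\<^esub> x) = f x"
    using SpI.quot_factor_alg[OF assms(1,2)] by blast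
  then show thesis using that[of g] by (simp add: Sp_alg_def quot_star_hom Sp_proj_def)
qed

lemma Sp_dagger:
  assumes "i \<in> Ix" "j \<in> Ix"
  shows "(\<Oplus>\<^bsub>Sp_alg \<theta>\<^esub>k\<in>Ix. dagger (Sp_alg \<theta>) (Sp_mat \<theta>) i k \<otimes>\<^bsub>Sp_alg \<theta>\<^esub> Sp_mat \<theta> k j)
    = (if i = j then \<one>\<^bsub>Sp_alg \<theta>\<^esub> else \<zero>\<^bsub>Sp_alg \<theta>\<^esub>)"
proof -
  interpret SpI: algebra_ideal "SL_alg \<theta>" "Sp_ideal \<theta>" by (rule Sp_algebra_ideal)
  let ?s = "\<Oplus>\<^bsub>Sp_alg \<theta>\<^esub>k\<in>Ix. dagger (Sp_alg \<theta>) (Sp_mat \<theta>) i k \<otimes>\<^bsub>Sp_alg \<theta>\<^esub> Sp_mat \<theta> k j"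
  have r: "dagger_relation \<theta> i j \<in> carrier (SL_alg \<theta>)" "dagger_relation \<theta> i j \<in> Sp_ideal \<theta>"
    using assms dagger_relations_carrier[of \<theta>] SL.genideal_self[OF dagger_relations_carrier[of \<theta>]]
    unfolding Sp_ideal_eq by blast+
  then have "Sp_proj \<theta> (dagger_relation \<theta> i j) = \<zero>\<^bsub>Sp_alg \<theta>\<^esub>"
    using SpI.coset_eq_zero_iff by (simp add: Sp_proj_def Sp_alg_def quot_star_algebra_simps)
  then have "?s \<ominus>\<^bsub>Sp_alg \<theta>\<^esub> (if i = j then \<one>\<^bsub>Sp_alg \<theta>\<^esub> else \<zero>\<^bsub>Sp_alg \<theta>\<^esub>) = \<zero>\<^bsub>Sp_alg \<theta>\<^esub>"
    using hom_dagger_relation[OF Sp_complex_algebra Sp_proj_alg_hom assms]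
    unfolding Sp_mat_def[symmetric] by simp
  moreover have "?s \<in> carrier (Sp_alg \<theta>)" using assms by (simp add: dagger_def)
  ultimately show ?thesis by (simp split: if_splits)
qed

text \<open>In Sp the dagger is a left inverse by the relations and the cofactor matrix is a right
  inverse, so they agree. As a consequence the dagger is a right inverse too.\<close>

lemma Sp_cofactor:
  assumes "i \<in> Ix" "j \<in> Ix"
  shows "twisted_matrix.cofactor (Sp_alg \<theta>) \<theta> (Sp_mat \<theta>) i j = dagger (Sp_alg \<theta>) (Sp_mat \<theta>) i j"
  by (rule Sp.matrix_inverse_unique[where I = Ix and a = "Sp_mat \<theta>" and c = "Sp.cofactor \<theta>", symmetric])
    (use assms Sp_dagger Sp.cofactor_right in \<open>auto simp: dagger_def\<close>)

text \<open>A homomorphism carries an inverse matrix to an inverse matrix, and inverses are unique;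
  the formula for the minors is not expanded.\<close>

lemma alg_hom_cofactor:
  assumes "special_twisted_matrix A \<theta> a" "special_twisted_matrix B \<theta> b" "f \<in> alg_hom A B"
    and b: "\<And>i j. i \<in> Ix \<Longrightarrow> j \<in> Ix \<Longrightarrow> b i j = f (a i j)" and ix: "i \<in> Ix" "j \<in> Ix"
  shows "f (twisted_matrix.cofactor A \<theta> a i j) = twisted_matrix.cofactor B \<theta> b i j"
proof -
  interpret A: special_twisted_matrix A \<theta> a by fact
  interpret B: special_twisted_matrix B \<theta> b by fact
  note h = alg_homD[OF assms(3)]
  have left: "(\<Oplus>\<^bsub>B\<^esub>k\<in>Ix. f (A.cofactor i k) \<otimes>\<^bsub>B\<^esub> b k j) = (if i = j then \<one>\<^bsub>B\<^esub> else \<zero>\<^bsub>B\<^esub>)"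
    if ij: "i \<in> Ix" "j \<in> Ix" for i j
  proof -
    have "(\<Oplus>\<^bsub>B\<^esub>k\<in>Ix. f (A.cofactor i k) \<otimes>\<^bsub>B\<^esub> b k j) = f (\<Oplus>\<^bsub>A\<^esub>k\<in>Ix. A.cofactor i k \<otimes>\<^bsub>A\<^esub> a k j)"
      using ij by (simp add: linear_hom_finsum[OF A.complex_algebra_axioms B.complex_algebra_axioms h(1)]
          h b cong: B.finsum_cong)
    then show ?thesis
      using A.cofactor_left[OF ij] linear_hom_zero[OF A.complex_algebra_axioms B.complex_algebra_axioms h(1)]
      by (simp add: h)
  qed
  show ?thesis
    by (rule B.matrix_inverse_unique[of Ix b "\<lambda>i k. f (A.cofactor i k)" B.cofactor])
      (use ix left B.cofactor_right h in auto)
qed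

lemma minus_one_powers_cancel: "(-1) ^ (m + i) * (-1) ^ (k + m) = ((-1) ^ (k + i) :: complex)"
  by (cases "even i"; cases "even k"; cases "even m") simp_all

text \<open>The dagger of the coproduct matrix has entries
  \<open>\<Sum> d m k \<otimes> d i m\<close>, with \<open>d\<close> the dagger of \<open>a\<close>
  and the factors in the opposite order to those of \<open>b\<close>. In the product with
  \<open>b\<close> the first tensor factors therefore contract over the row index, and then the
  second ones do.\<close>

lemma dagger_tensor:
  fixes A (structure)
  assumes "complex_algebra A"
    and a: "\<And>i j. i \<in> Ix \<Longrightarrow> j \<in> Ix \<Longrightarrow> a i j \<in> carrier A"
    and rel: "\<And>i j. i \<in> Ix \<Longrightarrow> j \<in> Ix \<Longrightarrow>
      (\<Oplus>k\<in>Ix. dagger A a i k \<otimes> a k j) = (if i = j then \<one> else \<zero>)"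
    and b: "\<And>i j. b i j = (\<Oplus>\<^bsub>tensor A A\<^esub>k\<in>Ix. pure_tensor A A (a i k) (a k j))"
    and ix: "i \<in> Ix" "j \<in> Ix"
  shows "(\<Oplus>\<^bsub>tensor A A\<^esub>k\<in>Ix. dagger (tensor A A) b i k \<otimes>\<^bsub>tensor A A\<^esub> b k j)
    = (if i = j then \<one>\<^bsub>tensor A A\<^esub> else \<zero>\<^bsub>tensor A A\<^esub>)"
proof -
  interpret A: complex_algebra A by fact
  interpret AA: tensor_product A A by unfold_locales
  let ?T = "tensor A A" and ?d = "dagger A a"
  have d: "?d i k \<in> carrier A" if "i \<in> Ix" "k \<in> Ix" for i k
    using that a by (simp add: dagger_def)
  \<comment> \<open>The summation index is replaced by its primed version, and the sign is split as
    \<open>(-1) ^ (m + i) * (-1) ^ (k + m)\<close>, one part for each factor.\<close>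
  have bd: "dagger ?T b i k = (\<Oplus>\<^bsub>?T\<^esub>m\<in>Ix. AA.pure (?d m k) (?d i m))" if k: "k \<in> Ix" for k
  proof -
    have "b (prime_index k) (prime_index i) = (\<Oplus>\<^bsub>?T\<^esub>m\<in>Ix.
        AA.pure (a (prime_index k) (prime_index m)) (a (prime_index m) (prime_index i)))"
      unfolding b using ix k a by (intro AA.T.fsum_permute prime_index_image) simp_all
    then have "dagger ?T b i k = (\<Oplus>\<^bsub>?T\<^esub>m\<in>Ix. (-1) ^ (k + i) \<odot>\<^bsub>?T\<^esub>
        AA.pure (a (prime_index k) (prime_index m)) (a (prime_index m) (prime_index i)))"
      unfolding dagger_def using ix k a by (simp add: AA.T.fsum_smult)
    also have "\<dots> = (\<Oplus>\<^bsub>?T\<^esub>m\<in>Ix. AA.pure (?d m k) (?d i m))"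
      using ix k a
      by (intro AA.T.fsum_cong) (simp_all add: dagger_def AA.pureD minus_one_powers_cancel)
    finally show ?thesis .
  qed
  have lin: "AA.pure (finsum A f Ix) y = (\<Oplus>\<^bsub>?T\<^esub>k\<in>Ix. AA.pure (f k) y)"
    "AA.pure y (finsum A f Ix) = (\<Oplus>\<^bsub>?T\<^esub>k\<in>Ix. AA.pure y (f k))"
    if y: "y \<in> carrier A" and f: "\<And>k. k \<in> Ix \<Longrightarrow> f k \<in> carrier A" for f y
  proof -
    have "AA.pure y \<in> linear_hom A ?T" "(\<lambda>x. AA.pure x y) \<in> linear_hom A ?T"
      using AA.pure_bilinear y by (simp_all add: bilinear_map_def)
    from this[THEN linear_hom_finsum[OF A.complex_algebra_axioms AA.T.complex_algebra_axioms], OF finite_Ix f]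
    show "AA.pure (finsum A f Ix) y = (\<Oplus>\<^bsub>?T\<^esub>k\<in>Ix. AA.pure (f k) y)"
      "AA.pure y (finsum A f Ix) = (\<Oplus>\<^bsub>?T\<^esub>k\<in>Ix. AA.pure y (f k))" by simp_all
  qed
  have zero: "AA.pure \<zero> y = \<zero>\<^bsub>?T\<^esub>" "AA.pure y \<zero> = \<zero>\<^bsub>?T\<^esub>" if "y \<in> carrier A" for y
    using AA.pureD(4)[of \<zero> y 0] AA.pureD(5)[of y \<zero> 0] that by simp_all
  have "(\<Oplus>\<^bsub>?T\<^esub>k\<in>Ix. dagger ?T b i k \<otimes>\<^bsub>?T\<^esub> b k j)
      = (\<Oplus>\<^bsub>?T\<^esub>k\<in>Ix. \<Oplus>\<^bsub>?T\<^esub>n\<in>Ix. \<Oplus>\<^bsub>?T\<^esub>m\<in>Ix. AA.pure (?d m k \<otimes> a k n) (?d i m \<otimes> a n j))"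
    using ix a d
    by (simp add: bd b AA.T.fsum_mult_left AA.T.fsum_mult_right AA.pure_mult cong: AA.T.finsum_cong)
  also have "\<dots> = (\<Oplus>\<^bsub>?T\<^esub>n\<in>Ix. \<Oplus>\<^bsub>?T\<^esub>k\<in>Ix. \<Oplus>\<^bsub>?T\<^esub>m\<in>Ix. AA.pure (?d m k \<otimes> a k n) (?d i m \<otimes> a n j))"
    using ix a d by (intro AA.T.fsum_swap) simp_all
  also have "\<dots> = (\<Oplus>\<^bsub>?T\<^esub>n\<in>Ix. \<Oplus>\<^bsub>?T\<^esub>m\<in>Ix. \<Oplus>\<^bsub>?T\<^esub>k\<in>Ix. AA.pure (?d m k \<otimes> a k n) (?d i m \<otimes> a n j))"
    using ix a d by (intro AA.T.fsum_cong AA.T.fsum_swap) simp_all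
  \<comment> \<open>The sum over \<open>k\<close> is the relation in the first tensor factor and
    forces \<open>m = n\<close>; the remaining sum over \<open>n\<close> is the relation in the
    second.\<close>
  also have "\<dots> = (\<Oplus>\<^bsub>?T\<^esub>n\<in>Ix. AA.pure \<one> (?d i n \<otimes> a n j))"
  proof (rule AA.T.fsum_cong)
    fix n assume n: "n \<in> Ix"
    have "(\<Oplus>\<^bsub>?T\<^esub>m\<in>Ix. \<Oplus>\<^bsub>?T\<^esub>k\<in>Ix. AA.pure (?d m k \<otimes> a k n) (?d i m \<otimes> a n j))
        = (\<Oplus>\<^bsub>?T\<^esub>m\<in>Ix. AA.pure (if m = n then \<one> else \<zero>) (?d i m \<otimes> a n j))"
      using ix n a d by (intro AA.T.fsum_cong) (simp_all add: lin[symmetric] rel)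
    also have "\<dots> = AA.pure \<one> (?d i n \<otimes> a n j)"
      using ix n a d by (subst AA.T.fsum_eq_single[of Ix n]) (simp_all add: zero)
    finally show "(\<Oplus>\<^bsub>?T\<^esub>m\<in>Ix. \<Oplus>\<^bsub>?T\<^esub>k\<in>Ix. AA.pure (?d m k \<otimes> a k n) (?d i m \<otimes> a n j))
      = AA.pure \<one> (?d i n \<otimes> a n j)" .
  qed (use ix a d in simp)
  also have "\<dots> = AA.pure \<one> (if i = j then \<one> else \<zero>)"
    using ix a d by (simp add: lin[symmetric] rel)
  also have "\<dots> = (if i = j then \<one>\<^bsub>?T\<^esub> else \<zero>\<^bsub>?T\<^esub>)" by (simp add: AA.pure_one zero)
  finally show ?thesis .
qed

lemma Sp_dagger_right:
  assumes ix: "i \<in> Ix" "j \<in> Ix"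
  shows "(\<Oplus>\<^bsub>Sp_alg \<theta>\<^esub>k\<in>Ix. Sp_mat \<theta> i k \<otimes>\<^bsub>Sp_alg \<theta>\<^esub> dagger (Sp_alg \<theta>) (Sp_mat \<theta>) k j)
    = (if i = j then \<one>\<^bsub>Sp_alg \<theta>\<^esub> else \<zero>\<^bsub>Sp_alg \<theta>\<^esub>)"
proof -
  have "(\<Oplus>\<^bsub>Sp_alg \<theta>\<^esub>k\<in>Ix. Sp_mat \<theta> i k \<otimes>\<^bsub>Sp_alg \<theta>\<^esub> dagger (Sp_alg \<theta>) (Sp_mat \<theta>) k j)
      = (\<Oplus>\<^bsub>Sp_alg \<theta>\<^esub>k\<in>Ix. Sp_mat \<theta> i k \<otimes>\<^bsub>Sp_alg \<theta>\<^esub> Sp.cofactor \<theta> k j)"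
    by (rule Sp.fsum_cong) (simp_all add: ix Sp_cofactor[symmetric])
  then show ?thesis using Sp.cofactor_right[OF ix] by simp
qed

text \<open>Each entry of the dagger is up to sign an entry of the matrix, so the two factors of
  $A A^\dagger = 1$ commute up to a coefficient that is \<open>1\<close> on the diagonal.\<close>

lemma Sp_antipode_relation:
  assumes ix: "i \<in> Ix" "j \<in> Ix"
  shows "(\<Oplus>\<^bsub>Sp_alg \<theta>\<^esub>k\<in>Ix. dagger (op_algebra (Sp_alg \<theta>)) (dagger (Sp_alg \<theta>) (Sp_mat \<theta>)) i k
      \<otimes>\<^bsub>op_algebra (Sp_alg \<theta>)\<^esub> dagger (Sp_alg \<theta>) (Sp_mat \<theta>) k j)
    = (if i = j then \<one>\<^bsub>Sp_alg \<theta>\<^esub> else \<zero>\<^bsub>Sp_alg \<theta>\<^esub>)"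
proof -
  let ?d = "dagger (Sp_alg \<theta>) (Sp_mat \<theta>)" and ?p = "Sp_mat \<theta>"
  have sq: "(-1) ^ (k + i) * ((-1) ^ i * (-1) ^ k) = (1 :: complex)" for k i
    by (cases "even i"; cases "even k") simp_all
  have d: "?d i k \<in> carrier (Sp_alg \<theta>)" if "i \<in> Ix" "k \<in> Ix" for i k
    using that by (simp add: dagger_def)
  \<comment> \<open>Applying the dagger twice gives back the matrix: the primes undo each other and
    the signs cancel.\<close>
  have dd: "dagger (op_algebra (Sp_alg \<theta>)) ?d i k = ?p i k" if "k \<in> Ix" for k
    using that ix(1) by (simp add: dagger_def power_add prime_index_sign sq[unfolded power_add])
  \<comment> \<open>The column factor \<open>\<eta> \<theta> (prime_index k) k\<close> is 1, so the
    coefficient does not depend on \<open>k\<close> and leaves the sum.\<close>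
  have comm: "?d k j \<otimes>\<^bsub>Sp_alg \<theta>\<^esub> ?p i k = \<eta> \<theta> i (prime_index j) \<odot>\<^bsub>Sp_alg \<theta>\<^esub> (?p i k \<otimes>\<^bsub>Sp_alg \<theta>\<^esub> ?d k j)"
    if k: "k \<in> Ix" for k
    using ix k Sp.twisted_comm[of "prime_index j" "prime_index k" i k] by (simp add: dagger_def mult.commute)
  have "(\<Oplus>\<^bsub>Sp_alg \<theta>\<^esub>k\<in>Ix. dagger (op_algebra (Sp_alg \<theta>)) ?d i k \<otimes>\<^bsub>op_algebra (Sp_alg \<theta>)\<^esub> ?d k j)
      = (\<Oplus>\<^bsub>Sp_alg \<theta>\<^esub>k\<in>Ix. \<eta> \<theta> i (prime_index j) \<odot>\<^bsub>Sp_alg \<theta>\<^esub> (?p i k \<otimes>\<^bsub>Sp_alg \<theta>\<^esub> ?d k j))"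
    using ix d by (intro Sp.fsum_cong) (simp_all add: dd comm)
  also have "\<dots> = \<eta> \<theta> i (prime_index j) \<odot>\<^bsub>Sp_alg \<theta>\<^esub> (\<Oplus>\<^bsub>Sp_alg \<theta>\<^esub>k\<in>Ix. ?p i k \<otimes>\<^bsub>Sp_alg \<theta>\<^esub> ?d k j)"
    using ix d by (subst Sp.fsum_smult) simp_all
  also have "(\<Oplus>\<^bsub>Sp_alg \<theta>\<^esub>k\<in>Ix. ?p i k \<otimes>\<^bsub>Sp_alg \<theta>\<^esub> ?d k j) = (if i = j then \<one>\<^bsub>Sp_alg \<theta>\<^esub> else \<zero>\<^bsub>Sp_alg \<theta>\<^esub>)"
    by (rule Sp_dagger_right[OF ix])
  finally show ?thesis using ix by (simp split: if_splits)
qed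

theorem corollary3p5:
  fixes \<theta> :: real
  shows "\<exists>\<Delta> \<epsilon> S. hopf_algebra (Sp_alg \<theta>) \<Delta> \<epsilon> S \<and>
    (\<forall>x\<in>carrier (SL_alg \<theta>).
       \<Delta> (Sp_proj \<theta> x) =
         tensor_map (Sp_alg \<theta>) (Sp_alg \<theta>) (Sp_proj \<theta>) (Sp_proj \<theta>) (SL_comult \<theta> x) \<and>
       \<epsilon> (Sp_proj \<theta> x) = SL_counit \<theta> x \<and>
       S (Sp_proj \<theta> x) = Sp_proj \<theta> (SL_antipode \<theta> x))"
proof -
  interpret SS: tensor_product "SL_alg \<theta>" "SL_alg \<theta>" by unfold_locales
  interpret PP: tensor_product "Sp_alg \<theta>" "Sp_alg \<theta>" by unfold_locales
  note SLC = SL.complex_algebra_axioms and SpC = Sp.complex_algebra_axioms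
  note \<pi> = Sp_proj_alg_hom[of \<theta>]
  let ?T = "tensor (Sp_alg \<theta>) (Sp_alg \<theta>)"
  let ?b = "\<lambda>i j. \<Oplus>\<^bsub>?T\<^esub>k\<in>Ix. PP.pure (Sp_mat \<theta> i k) (Sp_mat \<theta> k j)"
  let ?\<Delta> = "\<lambda>x. tensor_map (Sp_alg \<theta>) (Sp_alg \<theta>) (Sp_proj \<theta>) (Sp_proj \<theta>) (SL_comult \<theta> x)"
  let ?S = "\<lambda>x. Sp_proj \<theta> (SL_antipode \<theta> x)"
  note m = tensor_map_alg_hom[OF SLC SLC SpC SpC \<pi> \<pi>]

  have \<Delta>_hom: "?\<Delta> \<in> alg_hom (SL_alg \<theta>) ?T"
    by (rule alg_hom_compose[OF SL_comult(1) m(1)])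
  have \<Delta>_entry: "?\<Delta> (SL_mat \<theta> i j) = ?b i j" if ix: "i \<in> Ix" "j \<in> Ix" for i j
    unfolding SL_comult(2)[OF ix] using ix
    by (subst linear_hom_finsum[OF SS.T.complex_algebra_axioms PP.T.complex_algebra_axioms alg_homD(1)[OF m(1)]])
      (simp_all add: m(2) Sp_mat_def[symmetric] cong: PP.T.finsum_cong)
  obtain \<Delta> where \<Delta>: "\<Delta> \<in> alg_hom (Sp_alg \<theta>) ?T"
    "\<And>x. x \<in> carrier (SL_alg \<theta>) \<Longrightarrow> \<Delta> (Sp_proj \<theta> x) = ?\<Delta> x"
    using Sp_hom_exists[OF PP.T.complex_algebra_axioms \<Delta>_hom \<Delta>_entry
        dagger_tensor[OF SpC Sp.entry_closed Sp_dagger refl]] by blast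

  \<comment> \<open>The identity matrix is its own dagger: \<open>prime_index\<close> is injective
    on the indices, and the sign is 1 on the diagonal.\<close>
  have \<epsilon>_rel: "(\<Oplus>\<^bsub>complex_alg\<^esub>k\<in>Ix. dagger complex_alg (\<lambda>i j. if i = j then 1 else 0) i k
      \<otimes>\<^bsub>complex_alg\<^esub> (if k = j then 1 else 0)) = (if i = j then \<one>\<^bsub>complex_alg\<^esub> else \<zero>\<^bsub>complex_alg\<^esub>)"
    if ix: "i \<in> Ix" "j \<in> Ix" for i j
  proof -
    interpret C: complex_algebra complex_alg by (rule complex_algebra_complex_alg)
    have "prime_index j = prime_index i \<longleftrightarrow> i = j" using ix by (metis prime_index_idem)
    then show ?thesis
      using ix by (subst C.fsum_eq_single[of Ix j]) (auto simp: dagger_def)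
  qed
  obtain \<epsilon> where \<epsilon>: "\<epsilon> \<in> alg_hom (Sp_alg \<theta>) complex_alg"
    "\<And>x. x \<in> carrier (SL_alg \<theta>) \<Longrightarrow> \<epsilon> (Sp_proj \<theta> x) = SL_counit \<theta> x"
    using Sp_hom_exists[OF complex_algebra_complex_alg SL_counit(1) SL_counit(2) \<epsilon>_rel] by blast

  have S_hom: "?S \<in> alg_hom (SL_alg \<theta>) (op_algebra (Sp_alg \<theta>))"
    using alg_homD[OF SL_antipode(1)[of \<theta>]] alg_homD[OF \<pi>]
    by (intro alg_homI linear_homI) simp_all
  \<comment> \<open>The antipode of SL gives the inverse matrix; its image is the inverse matrix in
    Sp, which is the dagger.\<close>
  have S_entry: "?S (SL_mat \<theta> i j) = dagger (Sp_alg \<theta>) (Sp_mat \<theta>) i j" if ix: "i \<in> Ix" "j \<in> Ix" for i j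
    using alg_hom_cofactor[OF SL_special Sp_special \<pi> Sp_mat_def ix] Sp_cofactor[OF ix] SL_antipode(2)[OF ix]
    by simp
  \<comment> \<open>The matrix to be tested is the dagger itself, over the opposite algebra, so the
    relation involves the dagger of the dagger.\<close>
  obtain S where S: "S \<in> alg_hom (Sp_alg \<theta>) (op_algebra (Sp_alg \<theta>))"
    "\<And>x. x \<in> carrier (SL_alg \<theta>) \<Longrightarrow> S (Sp_proj \<theta> x) = ?S x"
    using Sp_hom_exists[OF complex_algebra_op[OF SpC] S_hom S_entry] Sp_antipode_relation
    unfolding finsum_op_algebra op_algebra_simps(3,4) by blast

  have entry: "\<Delta> (Sp_mat \<theta> i j) = ?b i j" "\<epsilon> (Sp_mat \<theta> i j) = (if i = j then 1 else 0)"
    "S (Sp_mat \<theta> i j) = dagger (Sp_alg \<theta>) (Sp_mat \<theta>) i j" if ix: "i \<in> Ix" "j \<in> Ix" for i j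
    using \<Delta>(2)[OF SL.entry_closed[OF ix]] \<epsilon>(2)[OF SL.entry_closed[OF ix]] S(2)[OF SL.entry_closed[OF ix]]
      \<Delta>_entry[OF ix] SL_counit(2)[OF ix] S_entry[OF ix] unfolding Sp_mat_def[symmetric] by simp_all
  have d: "dagger (Sp_alg \<theta>) (Sp_mat \<theta>) i k \<in> carrier (Sp_alg \<theta>)" if "i \<in> Ix" "k \<in> Ix" for i k
    using that by (simp add: dagger_def)
  have "hopf_algebra (Sp_alg \<theta>) \<Delta> \<epsilon> S"
  proof (rule matrix_hopf_algebra[OF SpC Sp_generated Sp.entry_closed \<Delta>(1) entry(1) \<epsilon>(1) entry(2) S(1)])
    fix i j assume ix: "i \<in> Ix" "j \<in> Ix"
    show "(\<Oplus>\<^bsub>Sp_alg \<theta>\<^esub>k\<in>Ix. S (Sp_mat \<theta> i k) \<otimes>\<^bsub>Sp_alg \<theta>\<^esub> Sp_mat \<theta> k j)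
        = (if i = j then \<one>\<^bsub>Sp_alg \<theta>\<^esub> else \<zero>\<^bsub>Sp_alg \<theta>\<^esub>)"
      using Sp_dagger[OF ix] ix d by (simp add: entry cong: Sp.finsum_cong)
    show "(\<Oplus>\<^bsub>Sp_alg \<theta>\<^esub>k\<in>Ix. Sp_mat \<theta> i k \<otimes>\<^bsub>Sp_alg \<theta>\<^esub> S (Sp_mat \<theta> k j))
        = (if i = j then \<one>\<^bsub>Sp_alg \<theta>\<^esub> else \<zero>\<^bsub>Sp_alg \<theta>\<^esub>)"
      using Sp_dagger_right[OF ix] ix d by (simp add: entry cong: Sp.finsum_cong)
  qed
  with \<Delta>(2) \<epsilon>(2) S(2) show ?thesis by blast
qed

end
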